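(* The categories $\mathbf{Map}$ and $\mathbf{RWFlowGS}$ are equivalent.
   Context: Topological manifolds are assumed second countable and Hausdorff. $\mathbf{Map}$: objects are pairs $(f,X)$ with $X$ a topological manifold without boundary and $f:X\to X$ a homeomorphism; morphisms $h:(f,X)\to(g,Y)$ are continuous maps $h:X\to Y$ with $h\circ f=g\circ h$. Flows. A flow $(\Phi,X)$ is a topological manifold $X$ without boundary together with a continuous map $\Phi: X\times\mathbb{R}\to X$ with $\Phi(x,0)=x$ and $\Phi(\Phi(x,t),s)=\Phi(x,t+s)$. A weak morphism $(h,\tau):(\Phi,X)\to(\Psi,Y)$ is a pair of a continuous map $h:X\to Y$ and a map $\tau:X\times\mathbb{R}\to\mathbb{R}$ such that $h(\Phi(x,t))=\Psi(h(x),\tau(x,t))$ for all $x,t$, and for each $x$, $\tau(x,-)$ is an increasing homeomorphism of $\mathbb{R}$ with $\tau(x,0)=0$. Composition: $(h_2,\tau_2)\circ(h_1,\tau_1)=(h_2\circ h_1,\tau_2\circ\tau_1)$ with $\tau_2\circ\tau_1(x,t):=\tau_2(h_1(x),\tau_1(x,t))$. Sections. Let $X$ be $n$-dimensional. A submanifold $S\subset X$ without boundary is topologically transversal to $\Phi$ if: (1) $S$ is of codimension one and locally flat. (2) For each $x\in S$ there exist a neighborhood $U$ of $x$ in $X$ and a homeomorphism $\phi:U\to B\subset\mathbb{R}^n$, where $B$ is the unit ball, such that $\phi(U\cap S)=B\cap(\mathbb{R}^{n-1}\times\{0\})$. Further, there exist $\delta_+(x)>0$ and $\delta_-(x)<0$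 such that $\Phi(x,[\delta_-(x),0))$ and $\Phi(x,(0,\delta_+(x)])$ are contained in different connected components of $U\setminus S$ and $\Phi(x,[\delta_-(x),\delta_+(x)])\cap S=\{x\}$. Here $\delta_+$ and $\delta_-$ can be taken locally uniformly, that is, there exist a neighborhood $V\subset U$ of $x$ and $\delta>0$ such that $\delta_+(y)>\delta$ and $\delta_-(y)<-\delta$ for all $y\in V\cap S$. (3) For each set of the form $\Phi(y,[a,b])$, where $y\in X$ and $a,b\in\mathbb{R}$, $\Phi(y,[a,b])\cap S$ is compact in $S$. A submanifold $S\subset X$ is a global Poincaré section if $S$ is topologically transversal to $\Phi$ and for each $x\in X$ there exist $t_+>0$ and $t_-<0$ with $\Phi(x,t_+)\in S$ and $\Phi(x,t_-)\in S$. For a global Poincaré section $S$ and $x\in S$, $T_\Phi(x)>0$ is the first return time (the smallest $t>0$ with $\Phi(x,t)\in S$) and $P\Phi:S\to S$, $P\Phi(x)=\Phi(x,T_\Phi(x))$, is the Poincaré map. Put $R_\Phi(x)(u):=\sum_{i\in\mathbb{Z}}T_\Phi((P\Phi)^i(x))\,\chi_{[i,i+1)}(u)$ for $x\in S$, $u\in\mathbb{R}$, where $\chi_{[i,i+1)}$ is the indicator function. The category $\mathbf{RWFlowGS}$ has as objects the triples $(\Phi,X,S)$ with $(\Phi,X)$ a flow and $S$ a global Poincaré section; its morphisms $(\Phi_1,X_1,S_1)\to(\Phi_2,X_2,S_2)$ are the weak morphisms $(h,\sigma):(\Phi_1,X_1)\to(\Phi_2,X_2)$ with $S_1=h^{-1}(S_2)$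 that are rate-preserving, i.e. $$\sigma\Big(\Phi_1(x,tT_{\Phi_1}(x)),\int_0^{s+t}R_{\Phi_1}(x)(u)\,du-tT_{\Phi_1}(x)\Big)=\int_0^{s+t}R_{\Phi_2}(h(x))(u)\,du-tT_{\Phi_2}(h(x))$$ for all $x\in S_1$, $0\le t<1$, $s\in\mathbb{R}$.
   Formalization: Global Poincaré sections S are additionally required to be closed subsets of X; without this the first return map can be discontinuous (rotation flow on an annulus with S = {0}×R ∪ {π}×(0,∞)) and the categories are not equivalent. *)

theory Defs
  imports "HOL-Analysis.Analysis"
begin

section \<open>Categories and equivalence of categories\<close>

text \<open>
  Categories are presented by hom-sets. \<open>Comp C A B D g f\<close> is the composite \<open>g \<circ> f\<close> of
  \<open>f : A \<rightarrow> B\<close> and \<open>g : B \<rightarrow> D\<close>; the objects are arguments because a HOL function does not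
  determine its domain and codomain.
\<close>

record ('o, 'm) cat =
  Obj :: "'o set"
  Hom :: "'o \<Rightarrow> 'o \<Rightarrow> 'm set"
  Comp :: "'o \<Rightarrow> 'o \<Rightarrow> 'o \<Rightarrow> 'm \<Rightarrow> 'm \<Rightarrow> 'm"
  Ident :: "'o \<Rightarrow> 'm"

definition is_category :: "('o, 'm) cat \<Rightarrow> bool" where
  "is_category C \<longleftrightarrow>
     (\<forall>A\<in>Obj C. Ident C A \<in> Hom C A A) \<and>
     (\<forall>A\<in>Obj C. \<forall>B\<in>Obj C. \<forall>D\<in>Obj C. \<forall>f\<in>Hom C A B. \<forall>g\<in>Hom C B D.
        Comp C A B D g f \<in> Hom C A D) \<and>
     (\<forall>A\<in>Obj C. \<forall>B\<in>Obj C. \<forall>f\<in>Hom C A B.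
        Comp C A A B f (Ident C A) = f \<and> Comp C A B B (Ident C B) f = f) \<and>
     (\<forall>A\<in>Obj C. \<forall>B\<in>Obj C. \<forall>D\<in>Obj C. \<forall>E\<in>Obj C.
      \<forall>f\<in>Hom C A B. \<forall>g\<in>Hom C B D. \<forall>k\<in>Hom C D E.
        Comp C A D E k (Comp C A B D g f) = Comp C A B E (Comp C B D E k g) f)"

record ('o, 'm, 'p, 'n) funct =
  omap :: "'o \<Rightarrow> 'p"
  amap :: "'o \<Rightarrow> 'o \<Rightarrow> 'm \<Rightarrow> 'n"

definition is_functor ::
  "('o, 'm) cat \<Rightarrow> ('p, 'n) cat \<Rightarrow> ('o, 'm, 'p, 'n) funct \<Rightarrow> bool" where
  "is_functor C D F \<longleftrightarrow>
     (\<forall>A\<in>Obj C. omap F A \<in> Obj D) \<and>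
     (\<forall>A\<in>Obj C. \<forall>B\<in>Obj C. \<forall>f\<in>Hom C A B. amap F A B f \<in> Hom D (omap F A) (omap F B)) \<and>
     (\<forall>A\<in>Obj C. amap F A A (Ident C A) = Ident D (omap F A)) \<and>
     (\<forall>A\<in>Obj C. \<forall>B\<in>Obj C. \<forall>E\<in>Obj C. \<forall>f\<in>Hom C A B. \<forall>g\<in>Hom C B E.
        amap F A E (Comp C A B E g f) =
        Comp D (omap F A) (omap F B) (omap F E) (amap F B E g) (amap F A B f))"

definition id_funct :: "('o, 'm, 'o, 'm) funct" where
  "id_funct = \<lparr> omap = (\<lambda>A. A), amap = (\<lambda>A B f. f) \<rparr>"

definition comp_funct ::
  "('p, 'n, 'q, 'k) funct \<Rightarrow> ('o, 'm, 'p, 'n) funct \<Rightarrow> ('o, 'm, 'q, 'k) funct" where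
  "comp_funct G F =
     \<lparr> omap = (\<lambda>A. omap G (omap F A)),
       amap = (\<lambda>A B f. amap G (omap F A) (omap F B) (amap F A B f)) \<rparr>"

definition is_iso :: "('o, 'm) cat \<Rightarrow> 'o \<Rightarrow> 'o \<Rightarrow> 'm \<Rightarrow> bool" where
  "is_iso C A B f \<longleftrightarrow> f \<in> Hom C A B \<and>
     (\<exists>g\<in>Hom C B A. Comp C A B A g f = Ident C A \<and> Comp C B A B f g = Ident C B)"

definition is_natural_iso ::
  "('o, 'm) cat \<Rightarrow> ('p, 'n) cat \<Rightarrow> ('o, 'm, 'p, 'n) funct \<Rightarrow> ('o, 'm, 'p, 'n) funct
     \<Rightarrow> ('o \<Rightarrow> 'n) \<Rightarrow> bool" where
  "is_natural_iso C D F G \<eta> \<longleftrightarrow>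
     (\<forall>A\<in>Obj C. is_iso D (omap F A) (omap G A) (\<eta> A)) \<and>
     (\<forall>A\<in>Obj C. \<forall>B\<in>Obj C. \<forall>f\<in>Hom C A B.
        Comp D (omap F A) (omap F B) (omap G B) (\<eta> B) (amap F A B f) =
        Comp D (omap F A) (omap G A) (omap G B) (amap G A B f) (\<eta> A))"

definition equivalent_categories :: "('o, 'm) cat \<Rightarrow> ('p, 'n) cat \<Rightarrow> bool" where
  "equivalent_categories C D \<longleftrightarrow>
     is_category C \<and> is_category D \<and>
     (\<exists>F G \<eta> \<epsilon>. is_functor C D F \<and> is_functor D C G \<and>
        is_natural_iso C C id_funct (comp_funct G F) \<eta> \<and>
        is_natural_iso D D (comp_funct F G) id_funct \<epsilon>)"


section \<open>Topological manifolds and the category Map\<close>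

text \<open>
  Spaces are abstract topologies whose carrier is a subset of a type \<open>'a\<close>, which plays the role
  of the universe. A second countable Hausdorff space has at most continuum many points, so as
  soon as the reals inject into \<open>'a\<close>, every topological manifold has a homeomorphic copy in
  \<open>'a topology\<close>.

  The locally Euclidean condition uses open subsets of Euclidean space, so these are manifolds
  without boundary. The empty space is a manifold of every dimension.
\<close>

definition topological_manifold :: "nat \<Rightarrow> 'a topology \<Rightarrow> bool" where
  "topological_manifold n X \<longleftrightarrow>
     second_countable X \<and> Hausdorff_space X \<and>
     (\<forall>x\<in>topspace X. \<exists>U V. openin X U \<and> x \<in> U \<and> openin (Euclidean_space n) V \<and>
        subtopology X U homeomorphic_space subtopology (Euclidean_space n) V)"

text \<open>
  Maps are required to be \<open>extensional\<close> (that is, \<open>undefined\<close> off their domain), so that equality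
  of HOL functions is equality of maps.
\<close>

type_synonym 'a map_obj = "('a \<Rightarrow> 'a) \<times> 'a topology"

definition map_objects :: "'a map_obj set" where
  "map_objects = {(f, X). (\<exists>n. topological_manifold n X) \<and>
     f \<in> extensional (topspace X) \<and> homeomorphic_map X X f}"

definition map_hom :: "'a map_obj \<Rightarrow> 'a map_obj \<Rightarrow> ('a \<Rightarrow> 'a) set" where
  "map_hom = (\<lambda>(f, X) (g, Y). {h. h \<in> extensional (topspace X) \<and> continuous_map X Y h \<and>
     (\<forall>x\<in>topspace X. h (f x) = g (h x))})"

definition Map :: "('a map_obj, 'a \<Rightarrow> 'a) cat" where
  "Map = \<lparr> Obj = map_objects,
           Hom = map_hom,
           Comp = (\<lambda>(f, X) B D k h. restrict (k \<circ> h) (topspace X)),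
           Ident = (\<lambda>(f, X). restrict id (topspace X)) \<rparr>"


section \<open>Flows and weak morphisms\<close>

definition is_flow :: "('a \<times> real \<Rightarrow> 'a) \<Rightarrow> 'a topology \<Rightarrow> bool" where
  "is_flow \<Phi> X \<longleftrightarrow>
     (\<exists>n. topological_manifold n X) \<and>
     \<Phi> \<in> extensional (topspace X \<times> UNIV) \<and>
     continuous_map (prod_topology X euclideanreal) X \<Phi> \<and>
     (\<forall>x\<in>topspace X. \<Phi> (x, 0) = x) \<and>
     (\<forall>x\<in>topspace X. \<forall>s t. \<Phi> (\<Phi> (x, t), s) = \<Phi> (x, t + s))"

definition weak_morphism ::
  "('a \<times> real \<Rightarrow> 'a) \<times> 'a topology \<Rightarrow> ('a \<times> real \<Rightarrow> 'a) \<times> 'a topology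
     \<Rightarrow> ('a \<Rightarrow> 'a) \<times> ('a \<times> real \<Rightarrow> real) \<Rightarrow> bool" where
  "weak_morphism = (\<lambda>(\<Phi>, X) (\<Psi>, Y) (h, \<tau>).
     h \<in> extensional (topspace X) \<and> continuous_map X Y h \<and>
     \<tau> \<in> extensional (topspace X \<times> UNIV) \<and>
     (\<forall>x\<in>topspace X. \<forall>t. h (\<Phi> (x, t)) = \<Psi> (h x, \<tau> (x, t))) \<and>
     (\<forall>x\<in>topspace X.
        strict_mono (\<lambda>t. \<tau> (x, t)) \<and>
        homeomorphic_map euclideanreal euclideanreal (\<lambda>t. \<tau> (x, t)) \<and>
        \<tau> (x, 0) = 0))"


section \<open>Global Poincare sections\<close>

definition neighbourhood_in :: "'a topology \<Rightarrow> 'a \<Rightarrow> 'a set \<Rightarrow> bool" where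
  "neighbourhood_in X x U \<longleftrightarrow> U \<subseteq> topspace X \<and> (\<exists>W. openin X W \<and> x \<in> W \<and> W \<subseteq> U)"

definition unit_ball :: "nat \<Rightarrow> (nat \<Rightarrow> real) set" where
  "unit_ball n = {v \<in> topspace (Euclidean_space n). (\<Sum>i<n. (v i)\<^sup>2) < 1}"

text \<open>
  Coordinates are numbered from \<open>0\<close>, so \<open>v (n - 1) = 0\<close> cuts out the hyperplane
  \<open>\<real>\<^sup>n\<^sup>-\<^sup>1 \<times> {0}\<close>.
\<close>

definition flat_chart ::
  "nat \<Rightarrow> 'a topology \<Rightarrow> 'a set \<Rightarrow> 'a set \<Rightarrow> ('a \<Rightarrow> nat \<Rightarrow> real) \<Rightarrow> bool" where
  "flat_chart n X S U \<phi> \<longleftrightarrow>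
     homeomorphic_map (subtopology X U) (subtopology (Euclidean_space n) (unit_ball n)) \<phi> \<and>
     \<phi> ` (U \<inter> S) = unit_ball n \<inter> {v. v (n - 1) = 0}"

definition locally_flat :: "nat \<Rightarrow> 'a topology \<Rightarrow> 'a set \<Rightarrow> bool" where
  "locally_flat n X S \<longleftrightarrow> (\<forall>x\<in>S. \<exists>U \<phi>. neighbourhood_in X x U \<and> flat_chart n X S U \<phi>)"

text \<open>
  Submanifolds are properly embedded, i.e. closed as subsets. Closedness does not follow from the
  transversality conditions below, and without it the Poincare map may be discontinuous: for
  the rotation flow on the annulus \<open>\<real>/2\<pi>\<int> \<times> \<real>\<close>, the set
  \<open>{0} \<times> \<real> \<union> {\<pi>} \<times> {0<..}\<close> meets all the other requirements, but its first return map jumps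
  at \<open>(0, 0)\<close>.
\<close>

definition codim_one_submanifold :: "nat \<Rightarrow> 'a topology \<Rightarrow> 'a set \<Rightarrow> bool" where
  "codim_one_submanifold n X S \<longleftrightarrow>
     1 \<le> n \<and> closedin X S \<and> topological_manifold (n - 1) (subtopology X S)"

definition topologically_transversal ::
  "nat \<Rightarrow> ('a \<times> real \<Rightarrow> 'a) \<Rightarrow> 'a topology \<Rightarrow> 'a set \<Rightarrow> bool" where
  "topologically_transversal n \<Phi> X S \<longleftrightarrow>
     codim_one_submanifold n X S \<and> locally_flat n X S \<and>
     (\<exists>\<delta>p \<delta>m :: 'a \<Rightarrow> real. \<forall>x\<in>S. \<exists>U \<phi>.
        neighbourhood_in X x U \<and> flat_chart n X S U \<phi> \<and>
        0 < \<delta>p x \<and> \<delta>m x < 0 \<and>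
        (\<exists>C D. C \<in> connected_components_of (subtopology X (U - S)) \<and>
               D \<in> connected_components_of (subtopology X (U - S)) \<and> C \<noteq> D \<and>
               \<Phi> ` ({x} \<times> {\<delta>m x..<0}) \<subseteq> C \<and> \<Phi> ` ({x} \<times> {0<..\<delta>p x}) \<subseteq> D) \<and>
        \<Phi> ` ({x} \<times> {\<delta>m x..\<delta>p x}) \<inter> S = {x} \<and>
        (\<exists>V \<delta>. neighbourhood_in X x V \<and> V \<subseteq> U \<and> 0 < \<delta> \<and>
               (\<forall>y\<in>V \<inter> S. \<delta> < \<delta>p y \<and> \<delta>m y < - \<delta>))) \<and>
     (\<forall>y\<in>topspace X. \<forall>a b. compactin (subtopology X S) (\<Phi> ` ({y} \<times> {a..b}) \<inter> S))"

definition global_section :: "('a \<times> real \<Rightarrow> 'a) \<Rightarrow> 'a topology \<Rightarrow> 'a set \<Rightarrow> bool" where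
  "global_section \<Phi> X S \<longleftrightarrow>
     (\<exists>n. topological_manifold n X \<and> topologically_transversal n \<Phi> X S) \<and>
     (\<forall>x\<in>topspace X. (\<exists>t>0. \<Phi> (x, t) \<in> S) \<and> (\<exists>t<0. \<Phi> (x, t) \<in> S))"

definition return_time :: "('a \<times> real \<Rightarrow> 'a) \<Rightarrow> 'a set \<Rightarrow> 'a \<Rightarrow> real" where
  "return_time \<Phi> S x = (LEAST t. 0 < t \<and> \<Phi> (x, t) \<in> S)"

definition poincare_map :: "('a \<times> real \<Rightarrow> 'a) \<Rightarrow> 'a set \<Rightarrow> 'a \<Rightarrow> 'a" where
  "poincare_map \<Phi> S x = \<Phi> (x, return_time \<Phi> S x)"

definition poincare_iterate :: "('a \<times> real \<Rightarrow> 'a) \<Rightarrow> 'a set \<Rightarrow> int \<Rightarrow> 'a \<Rightarrow> 'a" where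
  "poincare_iterate \<Phi> S i x =
     (if 0 \<le> i then (poincare_map \<Phi> S ^^ nat i) x
      else (inv_into S (poincare_map \<Phi> S) ^^ nat (- i)) x)"

definition rate :: "('a \<times> real \<Rightarrow> 'a) \<Rightarrow> 'a set \<Rightarrow> 'a \<Rightarrow> real \<Rightarrow> real" where
  "rate \<Phi> S x u =
     (\<Sum>\<^sub>\<infinity>i::int. return_time \<Phi> S (poincare_iterate \<Phi> S i x)
        * indicator {real_of_int i..<real_of_int i + 1} u)"


section \<open>The category RWFlowGS\<close>

type_synonym 'a flow_obj = "('a \<times> real \<Rightarrow> 'a) \<times> 'a topology \<times> 'a set"
type_synonym 'a flow_mor = "('a \<Rightarrow> 'a) \<times> ('a \<times> real \<Rightarrow> real)"

text \<open>
  The interval integral is oriented, as needed when the upper endpoint \<open>s + t\<close> is negative.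
\<close>

definition rate_preserving :: "'a flow_obj \<Rightarrow> 'a flow_obj \<Rightarrow> 'a flow_mor \<Rightarrow> bool" where
  "rate_preserving = (\<lambda>(\<Phi>1, X1, S1) (\<Phi>2, X2, S2) (h, \<sigma>).
     \<forall>x\<in>S1. \<forall>t s. 0 \<le> t \<and> t < 1 \<longrightarrow>
       \<sigma> (\<Phi>1 (x, t * return_time \<Phi>1 S1 x),
          (LBINT u = ereal 0..ereal (s + t). rate \<Phi>1 S1 x u) - t * return_time \<Phi>1 S1 x)
       = (LBINT u = ereal 0..ereal (s + t). rate \<Phi>2 S2 (h x) u) - t * return_time \<Phi>2 S2 (h x))"

definition flow_objects :: "'a flow_obj set" where
  "flow_objects = {(\<Phi>, X, S). is_flow \<Phi> X \<and> global_section \<Phi> X S}"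

definition flow_hom :: "'a flow_obj \<Rightarrow> 'a flow_obj \<Rightarrow> 'a flow_mor set" where
  "flow_hom = (\<lambda>(\<Phi>1, X1, S1) (\<Phi>2, X2, S2).
     {(h, \<sigma>). weak_morphism (\<Phi>1, X1) (\<Phi>2, X2) (h, \<sigma>) \<and>
        S1 = {x \<in> topspace X1. h x \<in> S2} \<and>
        rate_preserving (\<Phi>1, X1, S1) (\<Phi>2, X2, S2) (h, \<sigma>)})"

definition RWFlowGS :: "('a flow_obj, 'a flow_mor) cat" where
  "RWFlowGS =
     \<lparr> Obj = flow_objects,
       Hom = flow_hom,
       Comp = (\<lambda>(\<Phi>, X, S) B D (h2, \<tau>2) (h1, \<tau>1).
         (restrict (h2 \<circ> h1) (topspace X),
          restrict (\<lambda>(x, t). \<tau>2 (h1 x, \<tau>1 (x, t))) (topspace X \<times> UNIV))),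
       Ident = (\<lambda>(\<Phi>, X, S).
         (restrict id (topspace X), restrict snd (topspace X \<times> UNIV))) \<rparr>"

end

theory Submission
  imports Defs
begin

text \<open>
  The equivalence is induced by first return. A flow with a global section \<open>(\<Phi>, X, S)\<close> goes to the
  Poincare map of \<open>S\<close>, and a morphism \<open>(h, \<sigma>)\<close> goes to the restriction of \<open>h\<close> to the section. This
  functor is fully faithful and essentially surjective; choosing preimages of objects and of
  morphisms then gives a quasi-inverse (\<open>equivalent_categories_if_fully_faithful_ess_surj\<close>).
  
  Everything about a single flow rests on three consequences of topological transversality, collected
  in the locale \<open>section_flow\<close>: the section is closed, nearby section points stay off the section for a
  uniform positive time, and the orbit of a section point crosses the section in the sense that some
  continuous function vanishing only on \<open>S\<close> changes sign. The sign change and the intermediate value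
  theorem make hitting times persist under perturbation, the uniform gap makes them locally unique;
  together they give continuous local hitting times (\<open>local_section\<close>), continuity of the return time
  and, because the three properties survive time reversal, a homeomorphic Poincare map.
  
  The clock of \<open>x \<in> S\<close> is the integral of its rate function, started at \<open>0\<close>. It is the
  piecewise linear function that sends the integer \<open>i\<close> to the time of the \<open>i\<close>-th return. Hitting times
  cannot accumulate, so the clock is an increasing bijection of the line. A point of \<open>X\<close> is uniquely
  \<open>\<Phi> (b, p * T b)\<close> with \<open>b \<in> S\<close> and \<open>0 \<le> p < 1\<close>, and the rate condition says that \<open>\<sigma>\<close> intertwines
  the clocks of \<open>b\<close> and \<open>h b\<close>, up to the offsets \<open>p * T b\<close> and \<open>p * T (h b)\<close>. Since clocks are
  bijections this determines \<open>\<sigma>\<close>, and then \<open>h\<close>, from the restriction of \<open>h\<close> to \<open>S\<close>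
  (\<open>flow_morphism_unique\<close>). Conversely the same formulas extend every continuous map between sections
  that commutes with the Poincare maps (\<open>extend_hom\<close>). The only delicate point is continuity of the
  extension across the section, where the time change has a corner: there it is written as one
  expression in \<open>max s 0\<close> and \<open>min s 0\<close> whose coefficients are continuous on the section.
  
  Essential surjectivity is the suspension construction: \<open>(X \<times> \<real>) / ((x, t) \<sim> (f x, t - 1))\<close> with the
  translation flow and the section \<open>t = 0\<close>. The quotient map is open, and it is injective on open strips
  of width one; this makes the quotient a manifold and produces the flat charts across the section.
  The hypothesis that the reals inject into the type of points leaves room for the quotient inside
  that type, since the type then also contains a copy of its product with \<open>\<real>\<close>.
\<close>

section \<open>Fully faithful and essentially surjective functors\<close>

text \<open>
  The quasi-inverse sends \<open>A\<close> to a chosen \<open>F0 A\<close> with an isomorphism \<open>e A\<close> from \<open>A\<close> to \<open>G (F0 A)\<close>,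
  and \<open>f\<close> to the unique morphism that \<open>G\<close> maps to the conjugate \<open>c A B f\<close> of \<open>f\<close> by these
  isomorphisms. Every identity between morphisms of \<open>D\<close> is checked after applying the faithful
  functor \<open>G\<close>, where it becomes a computation with the \<open>e A\<close> and their inverses.
\<close>
lemma equivalent_categories_if_fully_faithful_ess_surj:
  assumes C: "is_category C" and D: "is_category D" and G: "is_functor D C G"
    and faithful: "\<And>A B f g. A \<in> Obj D \<Longrightarrow> B \<in> Obj D \<Longrightarrow> f \<in> Hom D A B \<Longrightarrow> g \<in> Hom D A B
        \<Longrightarrow> amap G A B f = amap G A B g \<Longrightarrow> f = g"
    and full: "\<And>A B k. A \<in> Obj D \<Longrightarrow> B \<in> Obj D \<Longrightarrow> k \<in> Hom C (omap G A) (omap G B)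
        \<Longrightarrow> \<exists>f\<in>Hom D A B. amap G A B f = k"
    and ess_surj: "\<And>A. A \<in> Obj C \<Longrightarrow> \<exists>B\<in>Obj D. \<exists>e. is_iso C A (omap G B) e"
  shows "equivalent_categories C D"
proof -
  note Cid = C[unfolded is_category_def, THEN conjunct1, rule_format]
  note Ccomp = C[unfolded is_category_def, THEN conjunct2, THEN conjunct1, rule_format]
  note Cunit = C[unfolded is_category_def, THEN conjunct2, THEN conjunct2, THEN conjunct1, rule_format]
  note Cassoc = C[unfolded is_category_def, THEN conjunct2, THEN conjunct2, THEN conjunct2, rule_format]
  note Did = D[unfolded is_category_def, THEN conjunct1, rule_format]
  note Dcomp = D[unfolded is_category_def, THEN conjunct2, THEN conjunct1, rule_format]
  note Gob = G[unfolded is_functor_def, THEN conjunct1, rule_format]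
  note Ghom = G[unfolded is_functor_def, THEN conjunct2, THEN conjunct1, rule_format]
  note Gid = G[unfolded is_functor_def, THEN conjunct2, THEN conjunct2, THEN conjunct1, rule_format]
  note Gcomp = G[unfolded is_functor_def, THEN conjunct2, THEN conjunct2, THEN conjunct2, rule_format]
  have "\<forall>A. \<exists>B e e'. A \<in> Obj C \<longrightarrow> B \<in> Obj D \<and> e \<in> Hom C A (omap G B) \<and> e' \<in> Hom C (omap G B) A \<and>
      Comp C A (omap G B) A e' e = Ident C A \<and> Comp C (omap G B) A (omap G B) e e' = Ident C (omap G B)"
    using ess_surj unfolding is_iso_def by metis
  then obtain F0 e e' where F0: "\<And>A. A \<in> Obj C \<Longrightarrow> F0 A \<in> Obj D"
    and e: "\<And>A. A \<in> Obj C \<Longrightarrow> e A \<in> Hom C A (omap G (F0 A))"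
    and e': "\<And>A. A \<in> Obj C \<Longrightarrow> e' A \<in> Hom C (omap G (F0 A)) A"
    and e'e: "\<And>A. A \<in> Obj C \<Longrightarrow> Comp C A (omap G (F0 A)) A (e' A) (e A) = Ident C A"
    and ee': "\<And>A. A \<in> Obj C \<Longrightarrow> Comp C (omap G (F0 A)) A (omap G (F0 A)) (e A) (e' A) = Ident C (omap G (F0 A))"
    by metis
  have "\<forall>A B k. \<exists>f. A \<in> Obj D \<and> B \<in> Obj D \<and> k \<in> Hom C (omap G A) (omap G B)
      \<longrightarrow> f \<in> Hom D A B \<and> amap G A B f = k"
    using full by blast
  then obtain L where L: "\<And>A B k. A \<in> Obj D \<Longrightarrow> B \<in> Obj D \<Longrightarrow> k \<in> Hom C (omap G A) (omap G B)
      \<Longrightarrow> L A B k \<in> Hom D A B"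
    and GL: "\<And>A B k. A \<in> Obj D \<Longrightarrow> B \<in> Obj D \<Longrightarrow> k \<in> Hom C (omap G A) (omap G B)
      \<Longrightarrow> amap G A B (L A B k) = k"
    by metis
  define c where "c A B f = Comp C (omap G (F0 A)) A (omap G (F0 B)) (Comp C A B (omap G (F0 B)) (e B) f) (e' A)" for A B f
  define F where "F = \<lparr> omap = F0, amap = (\<lambda>A B f. L (F0 A) (F0 B) (c A B f)) \<rparr>"
  have F_simps: "omap F A = F0 A" "amap F A B f = L (F0 A) (F0 B) (c A B f)" for A B f
    by (simp_all add: F_def)
  note mem = F0 Gob e e' Ccomp Cid Did Dcomp L Ghom
  have c_mem: "c A B f \<in> Hom C (omap G (F0 A)) (omap G (F0 B))"
    if "A \<in> Obj C" "B \<in> Obj C" "f \<in> Hom C A B" for A B f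
    using that unfolding c_def by (meson mem)
  have c_e: "Comp C A (omap G (F0 A)) (omap G (F0 B)) (c A B f) (e A) = Comp C A B (omap G (F0 B)) (e B) f"
    if "A \<in> Obj C" "B \<in> Obj C" "f \<in> Hom C A B" for A B f
  proof -
    have "Comp C A B (omap G (F0 B)) (e B) f \<in> Hom C A (omap G (F0 B))"
      using that by (meson mem)
    then show ?thesis
      using that unfolding c_def
      by (simp add: Cassoc[symmetric] mem e'e Cunit)
  qed
  have F_functor: "is_functor C D F"
    unfolding is_functor_def F_simps
  proof (intro conjI ballI)
    fix A assume A: "A \<in> Obj C"
    have "c A A (Ident C A) = Ident C (omap G (F0 A))"
      using A unfolding c_def by (simp add: Cunit mem ee')
    then show "L (F0 A) (F0 A) (c A A (Ident C A)) = Ident D (F0 A)"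
      using A by (intro faithful[of "F0 A" "F0 A"]) (simp_all add: mem GL Gid)
  next
    fix A B E f g assume ob: "A \<in> Obj C" "B \<in> Obj C" "E \<in> Obj C" and f: "f \<in> Hom C A B" and g: "g \<in> Hom C B E"
    have gf: "Comp C A B E g f \<in> Hom C A E" using ob f g by (meson mem)
    have m: "Comp C B E (omap G (F0 E)) (e E) g \<in> Hom C B (omap G (F0 E))"
      "Comp C A B (omap G (F0 B)) (e B) f \<in> Hom C A (omap G (F0 B))"
      using ob f g by (meson mem)+
    have "Comp C (omap G (F0 A)) (omap G (F0 B)) (omap G (F0 E)) (c B E g) (c A B f)
        = Comp C (omap G (F0 A)) A (omap G (F0 E))
            (Comp C A (omap G (F0 B)) (omap G (F0 E)) (c B E g) (Comp C A B (omap G (F0 B)) (e B) f)) (e' A)"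
      using ob f g m c_mem unfolding c_def[of A] by (intro Cassoc) (simp_all add: mem)
    also have "Comp C A (omap G (F0 B)) (omap G (F0 E)) (c B E g) (Comp C A B (omap G (F0 B)) (e B) f)
        = Comp C A B (omap G (F0 E)) (Comp C B (omap G (F0 B)) (omap G (F0 E)) (c B E g) (e B)) f"
      using ob f g m c_mem by (intro Cassoc) (simp_all add: mem)
    also have "\<dots> = Comp C A E (omap G (F0 E)) (e E) (Comp C A B E g f)"
      using ob f g by (simp add: c_e Cassoc mem)
    finally have "c A E (Comp C A B E g f) = Comp C (omap G (F0 A)) (omap G (F0 B)) (omap G (F0 E)) (c B E g) (c A B f)"
      unfolding c_def[of A E] by simp
    then show "L (F0 A) (F0 E) (c A E (Comp C A B E g f)) =
       Comp D (F0 A) (F0 B) (F0 E) (L (F0 B) (F0 E) (c B E g)) (L (F0 A) (F0 B) (c A B f))"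
      using ob f g gf by (intro faithful[of "F0 A" "F0 E"]) (auto simp: mem GL Gcomp c_mem)
  qed (use mem c_mem in auto)
  have nat1: "is_natural_iso C C id_funct (comp_funct G F) e"
    unfolding is_natural_iso_def id_funct_def comp_funct_def funct.simps F_simps
  proof (intro conjI ballI)
    show "is_iso C A (omap G (F0 A)) (e A)" if "A \<in> Obj C" for A
      unfolding is_iso_def using that e e' e'e ee' by blast
    show "Comp C A B (omap G (F0 B)) (e B) f
        = Comp C A (omap G (F0 A)) (omap G (F0 B)) (amap G (F0 A) (F0 B) (L (F0 A) (F0 B) (c A B f))) (e A)"
      if "A \<in> Obj C" "B \<in> Obj C" "f \<in> Hom C A B" for A B f
      using that by (simp add: GL F0 c_mem c_e)
  qed
  define \<epsilon> where "\<epsilon> B = L (F0 (omap G B)) B (e' (omap G B))" for B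
  have \<epsilon>: "\<epsilon> B \<in> Hom D (F0 (omap G B)) B" "amap G (F0 (omap G B)) B (\<epsilon> B) = e' (omap G B)"
    if "B \<in> Obj D" for B
    using that by (simp_all add: \<epsilon>_def GL mem)
  have nat2: "is_natural_iso D D (comp_funct F G) id_funct \<epsilon>"
    unfolding is_natural_iso_def id_funct_def comp_funct_def funct.simps F_simps
  proof (intro conjI ballI)
    fix B assume B: "B \<in> Obj D"
    let ?B = "F0 (omap G B)" and ?g = "L B (F0 (omap G B)) (e (omap G B))"
    have g: "?g \<in> Hom D B ?B" "amap G B ?B ?g = e (omap G B)"
      using B by (simp_all add: GL mem)
    have "Comp D ?B B ?B ?g (\<epsilon> B) = Ident D ?B"
      using B g \<epsilon>[OF B] by (intro faithful[of ?B ?B]) (simp_all add: mem Gcomp[of _ B] Gid ee')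
    moreover have "Comp D B ?B B (\<epsilon> B) ?g = Ident D B"
      using B g \<epsilon>[OF B] by (intro faithful[of B B]) (auto simp: Dcomp[of _ ?B] Gcomp[of _ ?B] mem Gid e'e)
    ultimately show "is_iso D ?B B (\<epsilon> B)"
      unfolding is_iso_def using \<epsilon>[OF B] g by blast
  next
    fix A B f assume ob: "A \<in> Obj D" "B \<in> Obj D" and f: "f \<in> Hom D A B"
    let ?A = "F0 (omap G A)" and ?B = "F0 (omap G B)" and ?f = "amap G A B f"
    let ?c = "c (omap G A) (omap G B) ?f"
    have f': "?f \<in> Hom C (omap G A) (omap G B)" using ob f by (simp add: mem)
    have cm: "?c \<in> Hom C (omap G ?A) (omap G ?B)" using ob f' by (simp add: mem c_mem)
    have m: "Comp C (omap G A) (omap G B) (omap G ?B) (e (omap G B)) ?f \<in> Hom C (omap G A) (omap G ?B)"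
      using ob f' by (meson mem)
    have "Comp C (omap G ?A) (omap G ?B) (omap G B) (e' (omap G B)) ?c
        = Comp C (omap G ?A) (omap G A) (omap G B)
            (Comp C (omap G A) (omap G ?B) (omap G B) (e' (omap G B)) (Comp C (omap G A) (omap G B) (omap G ?B) (e (omap G B)) ?f)) (e' (omap G A))"
      using ob f' m unfolding c_def by (intro Cassoc) (simp_all add: mem)
    also have "Comp C (omap G A) (omap G ?B) (omap G B) (e' (omap G B)) (Comp C (omap G A) (omap G B) (omap G ?B) (e (omap G B)) ?f)
        = ?f"
      using ob f' by (simp add: Cassoc mem e'e Cunit)
    finally have *: "Comp C (omap G ?A) (omap G ?B) (omap G B) (e' (omap G B)) ?c
        = Comp C (omap G ?A) (omap G A) (omap G B) ?f (e' (omap G A))" .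
    have "L ?A ?B ?c \<in> Hom D ?A ?B" "amap G ?A ?B (L ?A ?B ?c) = ?c"
      using ob cm by (simp_all add: mem GL)
    then show "Comp D ?A ?B B (\<epsilon> B) (L ?A ?B ?c) = Comp D ?A A B f (\<epsilon> A)"
      using ob f \<epsilon> * by (intro faithful[of ?A B]) (auto simp: Dcomp[of _ ?B] Dcomp[of _ A] Gcomp[of _ A] Gcomp[of _ ?B] mem)
  qed
  show ?thesis
    unfolding equivalent_categories_def using C D G F_functor nat1 nat2 by blast
qed

section \<open>Continuity criteria\<close>

lemma continuous_map_real_if_eps:
  fixes f :: "'a \<Rightarrow> real"
  assumes "\<And>x e. x \<in> topspace X \<Longrightarrow> 0 < e \<Longrightarrow> \<exists>N. openin X N \<and> x \<in> N \<and> (\<forall>y\<in>N. \<bar>f y - f x\<bar> < e)"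
  shows "continuous_map X euclideanreal f"
  unfolding continuous_map_upper_lower_semicontinuous_lt
proof (intro conjI allI)
  fix a
  show "openin X {x \<in> topspace X. a < f x}"
  proof (subst openin_subopen, intro ballI)
    fix x assume "x \<in> {x \<in> topspace X. a < f x}"
    then obtain N where N: "openin X N" "x \<in> N" "\<forall>y\<in>N. \<bar>f y - f x\<bar> < f x - a"
      using assms[of x "f x - a"] by auto
    then have "N \<subseteq> {x \<in> topspace X. a < f x}"
      using openin_subset by fastforce
    then show "\<exists>T. openin X T \<and> x \<in> T \<and> T \<subseteq> {x \<in> topspace X. a < f x}" using N by blast
  qed
  show "openin X {x \<in> topspace X. f x < a}"
  proof (subst openin_subopen, intro ballI)
    fix x assume "x \<in> {x \<in> topspace X. f x < a}"
    then obtain N where N: "openin X N" "x \<in> N" "\<forall>y\<in>N. \<bar>f y - f x\<bar> < a - f x"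
      using assms[of x "a - f x"] by auto
    then have "N \<subseteq> {x \<in> topspace X. f x < a}"
      using openin_subset by fastforce
    then show "\<exists>T. openin X T \<and> x \<in> T \<and> T \<subseteq> {x \<in> topspace X. f x < a}" using N by blast
  qed
qed

lemma continuous_map_if_locally:
  assumes "\<And>x. x \<in> topspace X \<Longrightarrow> \<exists>N. openin X N \<and> x \<in> N \<and> continuous_map (subtopology X N) Y f"
  shows "continuous_map X Y f"
  unfolding continuous_map_def
proof (intro conjI allI impI)
  show "f \<in> topspace X \<rightarrow> topspace Y"
  proof
    fix x assume x: "x \<in> topspace X"
    then obtain N where "x \<in> N" "continuous_map (subtopology X N) Y f"
      using assms by blast
    then show "f x \<in> topspace Y"
      using x by (auto simp: continuous_map_def)
  qed
  fix U assume U: "openin Y U"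
  show "openin X {x \<in> topspace X. f x \<in> U}"
  proof (subst openin_subopen, intro ballI)
    fix x assume x: "x \<in> {x \<in> topspace X. f x \<in> U}"
    then obtain N where N: "openin X N" "x \<in> N" "continuous_map (subtopology X N) Y f"
      using assms by blast
    then have "openin (subtopology X N) {y \<in> topspace (subtopology X N). f y \<in> U}"
      using U openin_continuous_map_preimage by blast
    then have "openin X {y \<in> topspace (subtopology X N). f y \<in> U}"
      using N openin_trans_full by blast
    then show "\<exists>T. openin X T \<and> x \<in> T \<and> T \<subseteq> {x \<in> topspace X. f x \<in> U}"
      using N x by (intro exI[of _ "{y \<in> topspace (subtopology X N). f y \<in> U}"]) auto
  qed
qed

lemma homeomorphic_map_strict_mono_surj:
  fixes f :: "real \<Rightarrow> real"
  assumes f: "strict_mono f" "surj f"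
  shows "homeomorphic_map euclideanreal euclideanreal f"
proof -
  have "continuous_on UNIV g" if "mono g" "surj g" for g :: "real \<Rightarrow> real"
    using that by (intro continuous_onI_mono) (auto simp: monoD)
  note cont = this
  have inj: "inj f" using f(1) by (simp add: strict_mono_imp_inj_on)
  have m: "mono (inv f)"
    by (rule monoI) (metis f surj_f_inv_f strict_mono_less_eq)
  have s: "surj (inv f)" using inj by (simp add: inj_imp_surj_inv)
  have "homeomorphic_maps euclideanreal euclideanreal f (inv f)"
    unfolding homeomorphic_maps_def
    using cont[OF strict_mono_mono[OF f(1)] f(2)] cont[OF m s] inj f(2)
    by (auto simp: surj_f_inv_f)
  then show ?thesis using homeomorphic_maps_imp_map by blast
qed

section \<open>Flows with a closed section that is crossed by every orbit\<close>

text \<open>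
  The assumptions \<open>isolated\<close> and \<open>crossing\<close> are the content of topological transversality that
  survives without charts and connected components. They are symmetric in the direction of time, so
  that each statement about forward hits yields its mirror image through \<open>time_reversed\<close>.
\<close>
locale section_flow =
  fixes \<Phi> :: "'a \<times> real \<Rightarrow> 'a" and X :: "'a topology" and S :: "'a set"
  assumes cont: "continuous_map (prod_topology X euclideanreal) X \<Phi>"
    and flow_0: "x \<in> topspace X \<Longrightarrow> \<Phi> (x, 0) = x"
    and flow_add: "x \<in> topspace X \<Longrightarrow> \<Phi> (\<Phi> (x, t), s) = \<Phi> (x, t + s)"
    and closed: "closedin X S"
    and isolated: "x \<in> S \<Longrightarrow> \<exists>V \<delta>. openin X V \<and> x \<in> V \<and> 0 < \<delta> \<and>
          (\<forall>y\<in>V \<inter> S. \<forall>t. 0 < \<bar>t\<bar> \<and> \<bar>t\<bar> \<le> \<delta> \<longrightarrow> \<Phi> (y, t) \<notin> S)"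
    and crossing: "x \<in> S \<Longrightarrow> \<exists>W g \<delta>. openin X W \<and> x \<in> W \<and>
          continuous_map (subtopology X W) euclideanreal g \<and> (\<forall>y\<in>W. g y = 0 \<longrightarrow> y \<in> S) \<and>
          (0::real) < \<delta> \<and> (\<forall>t. 0 < t \<and> t \<le> \<delta> \<longrightarrow>
             \<Phi> (x, t) \<in> W \<and> \<Phi> (x, - t) \<in> W \<and> g (\<Phi> (x, t)) * g (\<Phi> (x, - t)) < 0)"
    and hits_forward: "x \<in> topspace X \<Longrightarrow> \<exists>t>0. \<Phi> (x, t) \<in> S"
    and hits_backward: "x \<in> topspace X \<Longrightarrow> \<exists>t<0. \<Phi> (x, t) \<in> S"
begin

lemma flow_in: "x \<in> topspace X \<Longrightarrow> \<Phi> (x, t) \<in> topspace X"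
  using continuous_map_funspace[OF cont] by (auto simp: Pi_iff)

lemma S_subset: "S \<subseteq> topspace X"
  using closed closedin_subset by blast

lemma flow_continuous:
  assumes "continuous_map Z X f" "continuous_map Z euclideanreal r"
  shows "continuous_map Z X (\<lambda>z. \<Phi> (f z, r z))"
proof -
  have "continuous_map Z (prod_topology X euclideanreal) (\<lambda>z. (f z, r z))"
    using assms by (simp add: continuous_map_pairedI)
  then show ?thesis
    using continuous_map_compose[OF _ cont] by (auto simp: o_def)
qed

lemma flow_back: "x \<in> topspace X \<Longrightarrow> \<Phi> (\<Phi> (x, t), - t) = x"
  by (simp add: flow_add flow_0)

lemma time_reversed: "section_flow (\<lambda>(x, t). \<Phi> (x, - t)) X S"
proof
  show "continuous_map (prod_topology X euclideanreal) X (\<lambda>(x, t). \<Phi> (x, - t))"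
    unfolding case_prod_unfold
    by (intro flow_continuous continuous_map_fst continuous_map_minus continuous_map_snd)
  fix x
  show "\<exists>V \<delta>. openin X V \<and> x \<in> V \<and> 0 < \<delta> \<and>
          (\<forall>y\<in>V \<inter> S. \<forall>t. 0 < \<bar>t\<bar> \<and> \<bar>t\<bar> \<le> \<delta> \<longrightarrow> (case (y, t) of (x, t) \<Rightarrow> \<Phi> (x, - t)) \<notin> S)"
    if x: "x \<in> S"
  proof -
    obtain V \<delta> where V: "openin X V" "x \<in> V" "0 < \<delta>"
      "\<forall>y\<in>V \<inter> S. \<forall>t. 0 < \<bar>t\<bar> \<and> \<bar>t\<bar> \<le> \<delta> \<longrightarrow> \<Phi> (y, t) \<notin> S"
      using isolated[OF x] by blast
    have "\<forall>y\<in>V \<inter> S. \<forall>t. 0 < \<bar>t\<bar> \<and> \<bar>t\<bar> \<le> \<delta> \<longrightarrow> \<Phi> (y, -t) \<notin> S"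
      using V(4) by (metis abs_minus_cancel)
    then show ?thesis using V(1-3) by auto
  qed
  show "\<exists>W g \<delta>. openin X W \<and> x \<in> W \<and>
          continuous_map (subtopology X W) euclideanreal g \<and> (\<forall>y\<in>W. g y = 0 \<longrightarrow> y \<in> S) \<and>
          (0::real) < \<delta> \<and> (\<forall>t. 0 < t \<and> t \<le> \<delta> \<longrightarrow>
             (case (x, t) of (x, t) \<Rightarrow> \<Phi> (x, - t)) \<in> W \<and> (case (x, - t) of (x, t) \<Rightarrow> \<Phi> (x, - t)) \<in> W \<and>
             g (case (x, t) of (x, t) \<Rightarrow> \<Phi> (x, - t)) * g (case (x, - t) of (x, t) \<Rightarrow> \<Phi> (x, - t)) < 0)"
    if x: "x \<in> S"
    using crossing[OF x] by (simp add: mult.commute conj_ac)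
  show "\<exists>t>0. (case (x, t) of (x, t) \<Rightarrow> \<Phi> (x, - t)) \<in> S" if "x \<in> topspace X"
    using hits_backward[OF that] by (metis case_prod_conv minus_minus neg_0_less_iff_less)
  show "\<exists>t<0. (case (x, t) of (x, t) \<Rightarrow> \<Phi> (x, - t)) \<in> S" if "x \<in> topspace X"
    using hits_forward[OF that] by (metis case_prod_conv minus_minus neg_less_0_iff_less)
qed (simp_all add: flow_0 flow_add closed)

text \<open>
  Compactness of a finite orbit segment: if it lies in an open set, so do the segments that start
  nearby.
\<close>
lemma tube:
  assumes z: "z \<in> topspace X" and G: "openin X G" and "\<And>s. s \<in> {a..b} \<Longrightarrow> \<Phi> (z, s) \<in> G"
  obtains N where "openin X N" "z \<in> N" "\<forall>y\<in>N. \<forall>s\<in>{a..b}. \<Phi> (y, s) \<in> G"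
proof -
  let ?W = "{p \<in> topspace (prod_topology X euclideanreal). \<Phi> p \<in> G}"
  have W: "openin (prod_topology X euclideanreal) ?W"
    using cont G openin_continuous_map_preimage by blast
  have "compactin X {z}" "compactin euclideanreal {a..b}" using z by simp_all
  moreover have "{z} \<times> {a..b} \<subseteq> ?W" using assms by auto
  ultimately obtain U V where "openin X U" "openin euclideanreal V" "{z} \<subseteq> U" "{a..b} \<subseteq> V" "U \<times> V \<subseteq> ?W"
    by (rule Wallace_theorem_prod_topology[OF _ _ W])
  then show ?thesis by (intro that[of U]) auto
qed

text \<open>
  The function that witnesses the crossing has opposite signs shortly before and shortly after time
  \<open>t\<close>. This persists for nearby starting points, and the intermediate value theorem returns a hit.
\<close>
lemma local_hit:
  assumes z: "z \<in> topspace X" and hit: "\<Phi> (z, t) \<in> S" and e: "0 < e"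
  obtains N where "openin X N" "z \<in> N" "\<forall>y\<in>N. \<exists>s. \<bar>s - t\<bar> < e \<and> \<Phi> (y, s) \<in> S"
proof -
  obtain W g \<delta> where W: "openin X W" "\<Phi> (z, t) \<in> W"
    and g: "continuous_map (subtopology X W) euclideanreal g" "\<forall>y\<in>W. g y = 0 \<longrightarrow> y \<in> S"
    and \<delta>: "0 < \<delta>" "\<forall>s. 0 < s \<and> s \<le> \<delta> \<longrightarrow>
             \<Phi> (\<Phi> (z, t), s) \<in> W \<and> \<Phi> (\<Phi> (z, t), - s) \<in> W \<and> g (\<Phi> (\<Phi> (z, t), s)) * g (\<Phi> (\<Phi> (z, t), - s)) < 0"
    using crossing[OF hit] by (elim exE conjE)
  define d where "d = min \<delta> (e / 2)"
  have d: "0 < d" "d \<le> \<delta>" "d < e" using \<delta> e by (auto simp: d_def)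
  have inW: "\<Phi> (z, s) \<in> W" if s: "s \<in> {t - d..t + d}" for s
  proof (cases "s = t")
    case False
    then consider "0 < s - t" "s - t \<le> \<delta>" | "0 < t - s" "t - s \<le> \<delta>"
      using s d unfolding atLeastAtMost_iff by linarith
    then show ?thesis
      using \<delta>(2)[rule_format, of "s - t"] \<delta>(2)[rule_format, of "t - s"] z by cases (auto simp: flow_add)
  qed (use W in simp)
  obtain N where N: "openin X N" "z \<in> N" "\<forall>y\<in>N. \<forall>s\<in>{t - d..t + d}. \<Phi> (y, s) \<in> W"
    by (rule tube[OF z W(1) inW])
  have NX: "N \<subseteq> topspace X" using N openin_subset by blast
  have gN: "continuous_map (subtopology X N) euclideanreal (\<lambda>y. g (\<Phi> (y, s)))" if "s \<in> {t - d..t + d}" for s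
  proof -
    have "continuous_map (subtopology X N) (subtopology X W) (\<lambda>y. \<Phi> (y, s))"
      using N(3) that by (auto simp: continuous_map_in_subtopology intro!: flow_continuous continuous_map_from_subtopology)
    then show ?thesis using continuous_map_compose[OF _ g(1)] by (auto simp: o_def)
  qed
  let ?M = "{y \<in> topspace (subtopology X N). g (\<Phi> (y, t + d)) * g (\<Phi> (y, t - d)) \<in> {..<0}}"
  have "openin (subtopology X N) ?M"
    using d by (intro openin_continuous_map_preimage[of _ euclideanreal] continuous_map_real_mult gN) auto
  then have M: "openin X ?M" using N(1) openin_trans_full by blast
  have "g (\<Phi> (z, t + d)) * g (\<Phi> (z, t - d)) < 0"
    using \<delta>(2)[rule_format, of d] d z by (simp add: flow_add)
  then have zM: "z \<in> ?M" using z N by auto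
  have "\<exists>s. \<bar>s - t\<bar> < e \<and> \<Phi> (y, s) \<in> S" if y: "y \<in> ?M" for y
  proof -
    have yN: "y \<in> N" "y \<in> topspace X" using y by auto
    let ?k = "\<lambda>s. g (\<Phi> (y, s))"
    have "continuous_map (top_of_set {t - d..t + d}) (subtopology X W) (\<lambda>s. \<Phi> (y, s))"
      using N(3) yN by (auto simp: continuous_map_in_subtopology intro!: flow_continuous continuous_map_from_subtopology)
    then have "continuous_map (top_of_set {t - d..t + d}) euclideanreal (g \<circ> (\<lambda>s. \<Phi> (y, s)))"
      by (rule continuous_map_compose[OF _ g(1)])
    then have k: "continuous_on {t - d..t + d} ?k" by (simp add: o_def)
    have "?k (t - d) * ?k (t + d) < 0" using y by (simp add: mult.commute)
    then consider "?k (t - d) \<le> 0" "0 \<le> ?k (t + d)" | "?k (t + d) \<le> 0" "0 \<le> ?k (t - d)"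
      by (auto simp: mult_less_0_iff)
    then obtain s where s: "t - d \<le> s" "s \<le> t + d" "?k s = 0"
      using IVT'[of ?k "t - d" 0 "t + d"] IVT2'[of ?k "t + d" 0 "t - d"] k d by cases auto
    then show ?thesis using g(2)[rule_format, of "\<Phi> (y, s)"] N(3)[rule_format, of y s] yN d by (intro exI[of _ s]) auto
  qed
  then show ?thesis by (intro that[OF M zM]) blast
qed

lemma no_hit_open:
  assumes z: "z \<in> topspace X" and "\<And>s. s \<in> {a..b} \<Longrightarrow> \<Phi> (z, s) \<notin> S"
  obtains N where "openin X N" "z \<in> N" "\<forall>y\<in>N. \<forall>s\<in>{a..b}. \<Phi> (y, s) \<notin> S"
proof -
  have "openin X (topspace X - S)" using closed by blast
  moreover have "\<Phi> (z, s) \<in> topspace X - S" if "s \<in> {a..b}" for s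
    using assms(1,2) that flow_in by blast
  ultimately obtain N where N: "openin X N" "z \<in> N"
    "\<forall>y\<in>N. \<forall>s\<in>{a..b}. \<Phi> (y, s) \<in> topspace X - S"
    by (rule tube[OF z])
  show ?thesis by (rule that[OF N(1,2)]) (use N(3) in blast)
qed

text \<open>
  Near \<open>z\<close> there is a hit close to time \<open>t\<close> by \<open>local_hit\<close>, and only one because the section points
  involved have no return within time \<open>\<delta>\<close>. Continuity of the hitting time is \<open>local_hit\<close> again, now at
  the neighbouring points and with smaller tolerances.
\<close>
lemma local_section:
  assumes z: "z \<in> topspace X" and hit: "\<Phi> (z, t) \<in> S"
  obtains N \<rho> where "openin X N" "z \<in> N" "continuous_map (subtopology X N) euclideanreal \<rho>" "\<rho> z = t"
    "\<forall>y\<in>N. \<Phi> (y, \<rho> y) \<in> S"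
proof -
  obtain V \<delta> where V: "openin X V" "\<Phi> (z, t) \<in> V" "0 < \<delta>"
    "\<forall>y\<in>V \<inter> S. \<forall>s. 0 < \<bar>s\<bar> \<and> \<bar>s\<bar> \<le> \<delta> \<longrightarrow> \<Phi> (y, s) \<notin> S"
    using isolated[OF hit] by (elim exE conjE)
  have "openin euclideanreal {s \<in> topspace euclideanreal. \<Phi> (z, s) \<in> V}"
    using V(1) z by (intro openin_continuous_map_preimage[of _ X] flow_continuous) auto
  then have "open {s. \<Phi> (z, s) \<in> V}" by simp
  then obtain d where d: "0 < d" "\<And>s. dist s t < d \<Longrightarrow> \<Phi> (z, s) \<in> V"
    using V(2) unfolding open_dist by blast
  \<comment> \<open>Two hits in a window of radius \<open>e\<close> differ by less than \<open>\<delta>\<close>; the bound by \<open>d\<close> keeps the orbit of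
     \<open>z\<close> inside \<open>V\<close> throughout the window.\<close>
  define e where "e = min (d / 2) (\<delta> / 2)"
  have e: "0 < e" "e < d" "2 * e \<le> \<delta>" using d V(3) by (auto simp: e_def)
  have inV: "\<Phi> (z, s) \<in> V" if "s \<in> {t - e..t + e}" for s
    using that e by (intro d) (auto simp: dist_real_def)
  obtain N1 where N1: "openin X N1" "z \<in> N1" "\<forall>y\<in>N1. \<forall>s\<in>{t - e..t + e}. \<Phi> (y, s) \<in> V"
    by (rule tube[OF z V(1) inV])
  obtain N2 where N2: "openin X N2" "z \<in> N2" "\<forall>y\<in>N2. \<exists>s. \<bar>s - t\<bar> < e \<and> \<Phi> (y, s) \<in> S"
    by (rule local_hit[OF z hit e(1)])
  let ?N = "N1 \<inter> N2"
  have N: "openin X ?N" "z \<in> ?N" using N1 N2 by auto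
  have NX: "?N \<subseteq> topspace X" using N openin_subset by blast
  have uniq: "s = s'" if y: "y \<in> ?N" and s: "\<bar>s - t\<bar> < e" "\<Phi> (y, s) \<in> S" and s': "\<bar>s' - t\<bar> < e" "\<Phi> (y, s') \<in> S"
    for y s s'
  proof (rule ccontr)
    assume "s \<noteq> s'"
    moreover have "\<Phi> (y, s) \<in> V"
      using y s(1) by (intro N1(3)[rule_format]) (auto simp: abs_less_iff)
    ultimately have "\<Phi> (\<Phi> (y, s), s' - s) \<notin> S"
      using s s' e by (intro V(4)[rule_format]) auto
    then show False using y NX s' by (auto simp: flow_add)
  qed
  define \<rho> where "\<rho> y = (SOME s. \<bar>s - t\<bar> < e \<and> \<Phi> (y, s) \<in> S)" for y
  have \<rho>: "\<bar>\<rho> y - t\<bar> < e \<and> \<Phi> (y, \<rho> y) \<in> S" if "y \<in> ?N" for y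
    unfolding \<rho>_def by (rule someI_ex) (use N2(3) that in blast)
  have "continuous_map (subtopology X ?N) euclideanreal \<rho>"
  proof (rule continuous_map_real_if_eps)
    fix x \<eta> :: real assume "0 < \<eta>"
    fix x assume "x \<in> topspace (subtopology X ?N)"
    then have x: "x \<in> ?N" "x \<in> topspace X" by auto
    \<comment> \<open>A hit within \<open>h\<close> of \<open>\<rho> x\<close> still lies in the window, where hits are unique.\<close>
    define h where "h = min \<eta> (e - \<bar>\<rho> x - t\<bar>)"
    have h: "0 < h" "h \<le> \<eta>" "h \<le> e - \<bar>\<rho> x - t\<bar>" using \<rho>[OF x(1)] \<open>0 < \<eta>\<close> by (auto simp: h_def)
    obtain M where M: "openin X M" "x \<in> M" "\<forall>y\<in>M. \<exists>s. \<bar>s - \<rho> x\<bar> < h \<and> \<Phi> (y, s) \<in> S"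
      by (rule local_hit[OF x(2) conjunct2[OF \<rho>[OF x(1)]] h(1)])
    have "\<bar>\<rho> y - \<rho> x\<bar> < \<eta>" if y: "y \<in> M \<inter> ?N" for y
    proof -
      obtain s where s: "\<bar>s - \<rho> x\<bar> < h" "\<Phi> (y, s) \<in> S" using bspec[OF M(3), of y] y by blast
      then have "\<bar>s - t\<bar> < e" using h by linarith
      then have "s = \<rho> y" using uniq[of y s "\<rho> y"] \<rho>[of y] y s by auto
      then show ?thesis using s h by simp
    qed
    moreover have "openin (subtopology X ?N) (M \<inter> ?N)"
      using M(1) by (auto simp: openin_subtopology)
    ultimately show "\<exists>M. openin (subtopology X ?N) M \<and> x \<in> M \<and> (\<forall>y\<in>M. \<bar>\<rho> y - \<rho> x\<bar> < \<eta>)"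
      using x M(2) by blast
  qed
  moreover have "\<rho> z = t" using uniq[of z "\<rho> z" t] \<rho>[of z] N(2) hit e by auto
  ultimately show ?thesis using \<rho> by (intro that[of ?N \<rho>, OF N]) auto
qed

end

section \<open>Integrals of step functions\<close>

lemma step_function_integrable:
  fixes c :: "int \<Rightarrow> real" and a b :: real
  shows "interval_lebesgue_integrable lborel (ereal a) (ereal b) (\<lambda>u. c \<lfloor>u\<rfloor>)"
proof -
  have meas: "(\<lambda>u::real. c \<lfloor>u\<rfloor>) \<in> borel_measurable lborel"
    by measurable
  have int: "set_integrable lborel (einterval (ereal a) (ereal b)) (\<lambda>u. c \<lfloor>u\<rfloor>)" for a b :: real
    unfolding set_integrable_def
  proof (rule integrableI_bounded_set_indicator[OF _ meas])
    have "norm (c \<lfloor>u\<rfloor>) \<le> (\<Sum>i\<in>{\<lfloor>a\<rfloor>..\<lfloor>b\<rfloor>}. norm (c i))" if "a < u" "u < b" for u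
      using that by (intro member_le_sum) (auto intro: floor_mono)
    then show "AE u in lborel. u \<in> einterval (ereal a) (ereal b) \<longrightarrow> norm (c \<lfloor>u\<rfloor>) \<le> (\<Sum>i\<in>{\<lfloor>a\<rfloor>..\<lfloor>b\<rfloor>}. norm (c i))"
      by (auto simp: einterval_iff)
    have "emeasure lborel (einterval (ereal a) (ereal b)) \<le> emeasure lborel {a..b}"
      by (intro emeasure_mono) (auto simp: einterval_iff)
    also have "\<dots> < \<infinity>" by (cases "a \<le> b") auto
    finally show "emeasure lborel (einterval (ereal a) (ereal b)) < \<infinity>" .
  qed simp
  show ?thesis
    unfolding interval_lebesgue_integrable_def using int by simp
qed

lemma step_function_integral:
  fixes c :: "int \<Rightarrow> real" and i :: int and r :: real
  assumes "0 \<le> r" "r \<le> 1"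
  shows "(LBINT u = ereal 0..ereal (of_int i + r). c \<lfloor>u\<rfloor>) = (LBINT u = ereal 0..ereal (of_int i). c \<lfloor>u\<rfloor>) + r * c i"
proof -
  have "(LBINT u = ereal 0..ereal (of_int i). c \<lfloor>u\<rfloor>) + (LBINT u = ereal (of_int i)..ereal (of_int i + r). c \<lfloor>u\<rfloor>)
      = (LBINT u = ereal 0..ereal (of_int i + r). c \<lfloor>u\<rfloor>)"
  proof (rule interval_integral_sum)
    show "interval_lebesgue_integrable lborel (min (ereal 0) (min (ereal (real_of_int i)) (ereal (real_of_int i + r))))
     (max (ereal 0) (max (ereal (real_of_int i)) (ereal (real_of_int i + r)))) (\<lambda>u. c \<lfloor>u\<rfloor>)"
      unfolding ereal_min[symmetric] ereal_max[symmetric] by (rule step_function_integrable)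
  qed
  moreover have "(LBINT u = ereal (of_int i)..ereal (of_int i + r). c \<lfloor>u\<rfloor>) = (LBINT u = ereal (of_int i)..ereal (of_int i + r). c i)"
  proof (rule interval_integral_cong)
    fix u assume "u \<in> einterval (min (ereal (of_int i)) (ereal (of_int i + r))) (max (ereal (of_int i)) (ereal (of_int i + r)))"
    then have "of_int i < u" "u < of_int i + 1" using assms by (auto simp: einterval_iff min_def max_def split: if_splits)
    then have "\<lfloor>u\<rfloor> = i" by linarith
    then show "c \<lfloor>u\<rfloor> = c i" by simp
  qed
  ultimately show ?thesis by (simp add: mult.commute)
qed

text \<open>
  A function that is affine with positive slope \<open>c i\<close> on each interval \<open>[i, i + 1]\<close>.
\<close>
locale piecewise_linear =
  fixes I :: "real \<Rightarrow> real" and c :: "int \<Rightarrow> real"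
  assumes linear: "0 \<le> r \<Longrightarrow> r \<le> 1 \<Longrightarrow> I (of_int i + r) = I (of_int i) + r * c i"
    and pos: "0 < c i"
begin

lemma mono_int: "i < j \<Longrightarrow> I (of_int i) < I (of_int j)"
proof (induction j rule: int_gr_induct)
  case base
  then show ?case using linear[of 1 i] pos[of i] by simp
next
  case (step j)
  then show ?case using linear[of 1 j] pos[of j] by simp
qed

lemma mono: "strict_mono I"
proof (rule strict_monoI)
  fix a b :: real assume "a < b"
  have a: "I a = I (of_int \<lfloor>a\<rfloor>) + frac a * c \<lfloor>a\<rfloor>"
    using linear[of "frac a" "\<lfloor>a\<rfloor>"] frac_lt_1[of a] frac_ge_0[of a] by (simp add: frac_def)
  have b: "I b = I (of_int \<lfloor>b\<rfloor>) + frac b * c \<lfloor>b\<rfloor>"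
    using linear[of "frac b" "\<lfloor>b\<rfloor>"] frac_lt_1[of b] frac_ge_0[of b] by (simp add: frac_def)
  show "I a < I b"
  proof (cases "\<lfloor>a\<rfloor> = \<lfloor>b\<rfloor>")
    case True
    then have "frac a < frac b" using \<open>a < b\<close> by (simp add: frac_def)
    then show ?thesis using a b pos[of "\<lfloor>b\<rfloor>"] True by simp
  next
    case False
    then have "\<lfloor>a\<rfloor> < \<lfloor>b\<rfloor>" using \<open>a < b\<close> by linarith
    have "I a < I (of_int \<lfloor>a\<rfloor>) + 1 * c \<lfloor>a\<rfloor>"
      using a pos[of "\<lfloor>a\<rfloor>"] frac_lt_1[of a] by simp
    also have "\<dots> = I (of_int (\<lfloor>a\<rfloor> + 1))" using linear[of 1 "\<lfloor>a\<rfloor>"] by simp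
    also have "\<dots> \<le> I (of_int \<lfloor>b\<rfloor>)"
      using \<open>\<lfloor>a\<rfloor> < \<lfloor>b\<rfloor>\<close> mono_int[of "\<lfloor>a\<rfloor> + 1" "\<lfloor>b\<rfloor>"] by (cases "\<lfloor>a\<rfloor> + 1 = \<lfloor>b\<rfloor>") auto
    also have "\<dots> \<le> I b" using b pos[of "\<lfloor>b\<rfloor>"] frac_ge_0[of b] by simp
    finally show ?thesis .
  qed
qed

lemma surj:
  assumes lower: "\<And>y. \<exists>m. I (of_int m) \<le> y" and upper: "\<And>y. \<exists>n. y < I (of_int n)"
  shows "surj I"
unfolding surj_def
proof
  fix y
  obtain m where m: "I (of_int m) \<le> y" using lower by blast
  obtain n where n: "y < I (of_int n)" using upper by blast
  define k where "k = (LEAST k. y < I (of_int (m + int k)))"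
  have "m < n" using m n mono_int[of n m] by (metis linorder_neqE not_less order_less_le_trans order_less_trans)
  then have "y < I (of_int (m + int (nat (n - m))))" using n by simp
  then have k: "y < I (of_int (m + int k))" unfolding k_def by (rule LeastI)
  then have "k \<noteq> 0" using m by (intro notI) simp
  then obtain l where l: "k = Suc l" using not0_implies_Suc by blast
  have ge: "I (of_int (m + int l)) \<le> y"
    using not_less_Least[of l "\<lambda>k. y < I (of_int (m + int k))"] l unfolding k_def by auto
  let ?i = "m + int l"
  have lt: "y < I (of_int ?i) + c ?i"
    using k linear[of 1 ?i] l by (simp add: algebra_simps)
  define r where "r = (y - I (of_int ?i)) / c ?i"
  have "0 \<le> r" "r \<le> 1" using ge lt pos[of ?i] by (auto simp: r_def field_simps)
  then have "I (of_int ?i + r) = y" using linear[of r ?i] pos[of ?i] by (simp add: r_def)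
  then show "\<exists>x. y = I x" by blast
qed

end

section \<open>Return times, Poincare map and clock\<close>

text \<open>
  The common shape of the iterates of the Poincare map and of the homeomorphism that is suspended.
\<close>
definition int_iterate :: "('a \<Rightarrow> 'a) \<Rightarrow> 'a set \<Rightarrow> int \<Rightarrow> 'a \<Rightarrow> 'a" where
  "int_iterate f A i x = (if 0 \<le> i then (f ^^ nat i) x else (inv_into A f ^^ nat (- i)) x)"

lemma int_iterate_0 [simp]: "int_iterate f A 0 x = x"
  by (simp add: int_iterate_def)

lemma int_iterate_in:
  assumes f: "bij_betw f A A" and x: "x \<in> A"
  shows "int_iterate f A i x \<in> A"
proof -
  have "f y \<in> A" "inv_into A f y \<in> A" if "y \<in> A" for y
    using f that by (auto simp: bij_betw_def inv_into_into)
  then have "(f ^^ m) x \<in> A" "(inv_into A f ^^ m) x \<in> A" for m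
    using x by (induction m) auto
  then show ?thesis by (simp add: int_iterate_def)
qed

lemma int_iterate_Suc:
  assumes f: "bij_betw f A A" and x: "x \<in> A"
  shows "int_iterate f A (i + 1) x = f (int_iterate f A i x)"
proof (cases "0 \<le> i")
  case True
  then have "nat (i + 1) = Suc (nat i)" by simp
  then show ?thesis using True by (simp add: int_iterate_def)
next
  case False
  define m where "m = nat (- (i + 1))"
  have i: "i = - int m - 1" and m: "nat (- i) = Suc m" using False by (auto simp: m_def)
  have inv: "inv_into A f y \<in> A" "f (inv_into A f y) = y" if "y \<in> A" for y
    using f that by (auto simp: bij_betw_def f_inv_into_f inv_into_into)
  then have mA: "(inv_into A f ^^ m) x \<in> A" using x by (induction m) auto
  have "int_iterate f A (i + 1) x = (inv_into A f ^^ m) x"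
    by (cases "m = 0") (auto simp: int_iterate_def i)
  also have "\<dots> = f ((inv_into A f ^^ Suc m) x)" using mA inv by simp
  also have "(inv_into A f ^^ Suc m) x = int_iterate f A i x" unfolding int_iterate_def m using False by simp
  finally show ?thesis .
qed

lemma poincare_iterate_eq: "poincare_iterate \<Phi> S = int_iterate (poincare_map \<Phi> S) S"
  by (simp add: fun_eq_iff poincare_iterate_def int_iterate_def)

text \<open>
  For \<open>x\<close> in the section, the clock sends \<open>i + r\<close> with \<open>0 \<le> r < 1\<close> to the moment at which the orbit
  of \<open>x\<close> has completed the fraction \<open>r\<close> of the excursion that follows its \<open>i\<close>-th return.
\<close>
definition flow_clock :: "('a \<times> real \<Rightarrow> 'a) \<Rightarrow> 'a set \<Rightarrow> 'a \<Rightarrow> real \<Rightarrow> real" where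
  "flow_clock \<Phi> S x v = (LBINT u = ereal 0..ereal v. rate \<Phi> S x u)"

lemma return_time_eqI:
  assumes "0 < t" "\<Phi> (x, t) \<in> S" "\<And>s. 0 < s \<Longrightarrow> s < t \<Longrightarrow> \<Phi> (x, s) \<notin> S"
  shows "return_time \<Phi> S x = t"
  unfolding return_time_def
proof (rule Least_equality)
  show "0 < t \<and> \<Phi> (x, t) \<in> S" using assms by simp
  show "t \<le> s" if "0 < s \<and> \<Phi> (x, s) \<in> S" for s
    using assms(3)[of s] that by (meson not_le)
qed

lemma rate_eq: "rate \<Phi> S x u = return_time \<Phi> S (poincare_iterate \<Phi> S \<lfloor>u\<rfloor> x)"
proof -
  have "rate \<Phi> S x u = (\<Sum>\<^sub>\<infinity>i\<in>{\<lfloor>u\<rfloor>}. return_time \<Phi> S (poincare_iterate \<Phi> S \<lfloor>u\<rfloor> x))"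
    unfolding rate_def
  proof (rule infsum_cong_neutral)
    fix i assume "i \<in> UNIV - {\<lfloor>u\<rfloor>}"
    then have "\<not> (of_int i \<le> u \<and> u < of_int i + 1)" by (auto simp: floor_unique)
    then show "return_time \<Phi> S (poincare_iterate \<Phi> S i x) * indicator {real_of_int i..<real_of_int i + 1} u = 0"
      by (auto simp: indicator_def)
  qed (auto simp: indicator_def)
  then show ?thesis by simp
qed

lemma flow_clock_0 [simp]: "flow_clock \<Phi> S x 0 = 0"
  by (simp add: flow_clock_def interval_integral_endpoints_same)

lemma flow_clock_linear:
  assumes "0 \<le> r" "r \<le> 1"
  shows "flow_clock \<Phi> S x (of_int i + r) = flow_clock \<Phi> S x (of_int i) + r * return_time \<Phi> S (poincare_iterate \<Phi> S i x)"
  using step_function_integral[OF assms, where c = "\<lambda>i. return_time \<Phi> S (poincare_iterate \<Phi> S i x)" and i = i]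
  by (simp add: flow_clock_def rate_eq)

context section_flow
begin

abbreviation T :: "'a \<Rightarrow> real" where "T \<equiv> return_time \<Phi> S"
abbreviation P :: "'a \<Rightarrow> 'a" where "P \<equiv> poincare_map \<Phi> S"
abbreviation iter :: "int \<Rightarrow> 'a \<Rightarrow> 'a" where "iter \<equiv> poincare_iterate \<Phi> S"
abbreviation clock :: "'a \<Rightarrow> real \<Rightarrow> real" where "clock \<equiv> flow_clock \<Phi> S"

lemma topspace_S [simp]: "topspace (subtopology X S) = S"
  using S_subset by auto

lemma in_X: "x \<in> S \<Longrightarrow> x \<in> topspace X"
  using S_subset by blast

lemma hit_times_closed: "z \<in> topspace X \<Longrightarrow> Topological_Spaces.closed {t. \<Phi> (z, t) \<in> S}"
  using closedin_continuous_map_preimage[OF flow_continuous closed, of euclideanreal "\<lambda>_. z" "\<lambda>t. t"]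
  by simp

text \<open>
  Time \<open>a\<close> itself may be a hit: then the gap comes from \<open>isolated\<close>, otherwise from closedness of the
  section.
\<close>
lemma hit_times_discrete:
  assumes z: "z \<in> topspace X"
  obtains d where "0 < d" "\<forall>s. 0 < \<bar>s - a\<bar> \<and> \<bar>s - a\<bar> \<le> d \<longrightarrow> \<Phi> (z, s) \<notin> S"
proof (cases "\<Phi> (z, a) \<in> S")
  case True
  obtain V d where V: "openin X V" "\<Phi> (z, a) \<in> V" "0 < d"
    "\<forall>y\<in>V \<inter> S. \<forall>t. 0 < \<bar>t\<bar> \<and> \<bar>t\<bar> \<le> d \<longrightarrow> \<Phi> (y, t) \<notin> S"
    using isolated[OF True] by (elim exE conjE)
  have "\<Phi> (z, s) \<notin> S" if "0 < \<bar>s - a\<bar> \<and> \<bar>s - a\<bar> \<le> d" for s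
    using V(4)[rule_format, of "\<Phi> (z, a)" "s - a"] V(2) True that z by (simp add: flow_add)
  then show ?thesis using that V(3) by blast
next
  case False
  have "open (- {t. \<Phi> (z, t) \<in> S})" using hit_times_closed[OF z] by (simp add: open_Compl)
  then obtain e where e: "0 < e" "\<forall>s. dist s a < e \<longrightarrow> s \<in> - {t. \<Phi> (z, t) \<in> S}"
    unfolding open_dist using False by blast
  have "\<Phi> (z, s) \<notin> S" if "0 < \<bar>s - a\<bar> \<and> \<bar>s - a\<bar> \<le> e / 2" for s
    using e(1) e(2)[rule_format, of s] that by (auto simp: dist_real_def)
  then show ?thesis using that[of "e / 2"] e(1) by simp
qed

lemma next_hit:
  assumes z: "z \<in> topspace X"
  obtains t where "a < t" "\<Phi> (z, t) \<in> S" "\<forall>s. a < s \<and> s < t \<longrightarrow> \<Phi> (z, s) \<notin> S"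
proof -
  obtain d where d: "0 < d" "\<forall>s. 0 < \<bar>s - a\<bar> \<and> \<bar>s - a\<bar> \<le> d \<longrightarrow> \<Phi> (z, s) \<notin> S"
    by (rule hit_times_discrete[OF z])
  obtain t0 where t0: "0 < t0" "\<Phi> (\<Phi> (z, a), t0) \<in> S"
    using hits_forward[OF flow_in[OF z]] by blast
  have far: "a + d < s" if "a < s" "\<Phi> (z, s) \<in> S" for s
    using d that by (metis abs_of_pos diff_gt_0_iff_gt not_less diff_le_eq add.commute)
  let ?K = "{t. \<Phi> (z, t) \<in> S} \<inter> {a + d..a + t0}"
  have "compact ?K"
    by (intro closed_Int_compact hit_times_closed z) simp
  moreover have t0K: "a + t0 \<in> ?K" using t0 far[of "a + t0"] z by (simp add: flow_add)
  ultimately obtain t where t: "t \<in> ?K" "\<forall>s\<in>?K. t \<le> s"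
    using compact_attains_inf[of ?K] by blast
  have "\<Phi> (z, s) \<notin> S" if "a < s \<and> s < t" for s
  proof
    assume "\<Phi> (z, s) \<in> S"
    moreover have "t \<le> a + t0" using t by simp
    ultimately have "s \<in> ?K" using far[of s] that by simp
    then have "t \<le> s" using t(2) by blast
    then show False using that by simp
  qed
  then show ?thesis using that[of t] t d by auto
qed

lemma return_time:
  assumes z: "z \<in> topspace X"
  shows "0 < T z" "\<Phi> (z, T z) \<in> S" "\<And>s. 0 < s \<Longrightarrow> s < T z \<Longrightarrow> \<Phi> (z, s) \<notin> S"
proof -
  obtain t where t: "0 < t" "\<Phi> (z, t) \<in> S" "\<forall>s. 0 < s \<and> s < t \<longrightarrow> \<Phi> (z, s) \<notin> S"
    by (rule next_hit[OF z])
  then have "T z = t" using return_time_eqI[of t \<Phi> z S] by blast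
  then show "0 < T z" "\<Phi> (z, T z) \<in> S" "\<And>s. 0 < s \<Longrightarrow> s < T z \<Longrightarrow> \<Phi> (z, s) \<notin> S"
    using t by auto
qed

lemma return_time_le: "z \<in> topspace X \<Longrightarrow> 0 < s \<Longrightarrow> \<Phi> (z, s) \<in> S \<Longrightarrow> T z \<le> s"
  using return_time(3)[of z s] by (meson not_le)

text \<open>
  Upper semicontinuity is persistence of the hit at time \<open>T x\<close>. For lower semicontinuity a return of a
  nearby point before \<open>T x - e\<close> must be excluded: up to time \<open>d\<close> by the uniform gap near \<open>x\<close>, and from
  \<open>d\<close> to \<open>T x - e\<close> because the compact orbit segment of \<open>x\<close> over that interval misses the closed set
  \<open>S\<close>.
\<close>
lemma return_time_continuous: "continuous_map (subtopology X S) euclideanreal T"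
proof (rule continuous_map_real_if_eps)
  fix x and e :: real assume "x \<in> topspace (subtopology X S)" and e: "0 < e"
  then have x: "x \<in> S" "x \<in> topspace X" by auto
  note T = return_time[OF x(2)]
  obtain V d where V: "openin X V" "x \<in> V" "0 < d"
    "\<forall>y\<in>V \<inter> S. \<forall>t. 0 < \<bar>t\<bar> \<and> \<bar>t\<bar> \<le> d \<longrightarrow> \<Phi> (y, t) \<notin> S"
    using isolated[OF x(1)] by (elim exE conjE)
  have "0 < min e (T x)" using e T(1) by simp
  then obtain N1 where N1: "openin X N1" "x \<in> N1" "\<forall>y\<in>N1. \<exists>s. \<bar>s - T x\<bar> < min e (T x) \<and> \<Phi> (y, s) \<in> S"
    by (rule local_hit[OF x(2) T(2)])
  have no: "\<Phi> (x, s) \<notin> S" if "s \<in> {d..T x - e}" for s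
    using T(3)[of s] that V(3) e by simp
  obtain N2 where N2: "openin X N2" "x \<in> N2" "\<forall>y\<in>N2. \<forall>s\<in>{d..T x - e}. \<Phi> (y, s) \<notin> S"
    by (rule no_hit_open[OF x(2) no])
  have "\<bar>T y - T x\<bar> < e" if y: "y \<in> S" "y \<in> V" "y \<in> N1" "y \<in> N2" for y
  proof -
    have yX: "y \<in> topspace X" using y in_X by blast
    note Ty = return_time[OF yX]
    obtain s where s: "\<bar>s - T x\<bar> < min e (T x)" "\<Phi> (y, s) \<in> S" using N1(3) y by blast
    then have "T y \<le> s" by (intro return_time_le yX) auto
    moreover have "d < T y"
      using V(4)[rule_format, of y "T y"] y Ty(1,2) by (cases "T y \<le> d") auto
    then have "T x - e < T y" using N2(3)[rule_format, of y "T y"] y Ty(2) by (cases "T y \<le> T x - e") auto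
    ultimately show ?thesis using s by auto
  qed
  moreover have "openin (subtopology X S) ((V \<inter> N1 \<inter> N2) \<inter> S)"
    unfolding openin_subtopology using V N1 N2 by (intro exI[of _ "V \<inter> N1 \<inter> N2"]) auto
  ultimately show "\<exists>N. openin (subtopology X S) N \<and> x \<in> N \<and> (\<forall>y\<in>N. \<bar>T y - T x\<bar> < e)"
    using x V N1 N2 by (intro exI[of _ "(V \<inter> N1 \<inter> N2) \<inter> S"]) auto
qed

lemma poincare_in: "x \<in> S \<Longrightarrow> P x \<in> S"
  unfolding poincare_map_def using return_time in_X by blast

lemma poincare_continuous: "continuous_map (subtopology X S) (subtopology X S) P"
  unfolding continuous_map_in_subtopology poincare_map_def
  using poincare_in
  by (auto simp: poincare_map_def intro!: flow_continuous return_time_continuous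
      continuous_map_from_subtopology[OF continuous_map_id, unfolded id_def])

text \<open>
  The first return of the reversed flow undoes the first return of the flow, since the orbit meets the
  section only at the two ends of an excursion. Continuity of the inverse of a Poincare map is thus an
  instance of continuity of Poincare maps.
\<close>
lemma poincare_reversed:
  assumes x: "x \<in> S"
  shows "P (poincare_map (\<lambda>(x, t). \<Phi> (x, - t)) S x) = x"
    "poincare_map (\<lambda>(x, t). \<Phi> (x, - t)) S (P x) = x"
proof -
  interpret R: section_flow "\<lambda>(x, t). \<Phi> (x, - t)" X S by (rule time_reversed)
  have xX: "x \<in> topspace X" using x in_X by blast
  note RT = R.return_time[OF xX]
  let ?t = "R.T x" and ?y = "\<Phi> (x, - R.T x)"
  have "T ?y = ?t"
  proof (rule return_time_eqI)
    show "\<Phi> (?y, s) \<notin> S" if "0 < s" "s < ?t" for s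
      using RT(3)[of "?t - s"] that xX by (simp add: flow_add)
  qed (use RT x xX in \<open>simp_all add: flow_add flow_0\<close>)
  then show "P (R.P x) = x"
    using xX by (simp add: poincare_map_def flow_add flow_0)
  note Tx = return_time[OF xX]
  have "R.T (P x) = T x"
  proof (rule return_time_eqI)
    show "(case (P x, s) of (x, t) \<Rightarrow> \<Phi> (x, - t)) \<notin> S" if "0 < s" "s < T x" for s
      using Tx(3)[of "T x - s"] that xX by (simp add: flow_add poincare_map_def)
  qed (use Tx x xX in \<open>simp_all add: flow_add flow_0 poincare_map_def\<close>)
  then show "R.P (P x) = x"
    using xX by (simp add: poincare_map_def flow_add flow_0)
qed

lemma poincare_homeomorphic: "homeomorphic_map (subtopology X S) (subtopology X S) P"
proof -
  interpret R: section_flow "\<lambda>(x, t). \<Phi> (x, - t)" X S by (rule time_reversed)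
  have "homeomorphic_maps (subtopology X S) (subtopology X S) P R.P"
    unfolding homeomorphic_maps_def
    using poincare_continuous R.poincare_continuous poincare_reversed by simp
  then show ?thesis by (rule homeomorphic_maps_imp_map)
qed

lemma poincare_bij: "bij_betw P S S"
  using poincare_homeomorphic unfolding homeomorphic_eq_everything_map bij_betw_def topspace_S by blast

lemma iter_0 [simp]: "iter 0 x = x"
  by (simp add: poincare_iterate_eq)

lemma iter_in: "x \<in> S \<Longrightarrow> iter i x \<in> S"
  unfolding poincare_iterate_eq by (rule int_iterate_in[OF poincare_bij])

lemma iter_Suc: "x \<in> S \<Longrightarrow> iter (i + 1) x = P (iter i x)"
  unfolding poincare_iterate_eq by (rule int_iterate_Suc[OF poincare_bij])

lemma return_time_pos: "x \<in> S \<Longrightarrow> 0 < T x"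
  using return_time in_X by blast

lemma clock_piecewise_linear: "x \<in> S \<Longrightarrow> piecewise_linear (clock x) (\<lambda>i. T (iter i x))"
  by unfold_locales (auto simp: flow_clock_linear return_time_pos iter_in)

lemma flow_clock_int:
  assumes x: "x \<in> S"
  shows "\<Phi> (x, clock x (of_int i)) = iter i x"
proof (induction i rule: int_induct[where k = 0])
  case base
  then show ?case using x in_X by (simp add: flow_0)
next
  case (step1 i)
  have "\<Phi> (x, clock x (of_int (i + 1))) = \<Phi> (\<Phi> (x, clock x (of_int i)), T (iter i x))"
    using flow_clock_linear[of 1 \<Phi> S x i] x in_X by (simp add: flow_add)
  also have "\<dots> = iter (i + 1) x" using step1 x by (simp add: iter_Suc poincare_map_def)
  finally show ?case .
next
  case (step2 i)
  have "clock x (of_int i) = clock x (of_int (i - 1)) + T (iter (i - 1) x)"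
    using flow_clock_linear[of 1 \<Phi> S x "i - 1"] by simp
  then have "\<Phi> (x, clock x (of_int (i - 1))) = \<Phi> (\<Phi> (x, clock x (of_int i)), - T (iter (i - 1) x))"
    using x in_X by (simp add: flow_add)
  also have "\<Phi> (x, clock x (of_int i)) = P (iter (i - 1) x)"
    using step2 x iter_Suc[of x "i - 1"] by simp
  also have "\<Phi> (P (iter (i - 1) x), - T (iter (i - 1) x)) = iter (i - 1) x"
    using x by (simp add: poincare_map_def flow_back iter_in in_X)
  finally show ?case .
qed

lemma flow_clock:
  assumes x: "x \<in> S" and r: "0 \<le> r" "r \<le> 1"
  shows "\<Phi> (x, clock x (of_int i + r)) = \<Phi> (iter i x, r * T (iter i x))"
proof -
  have "\<Phi> (x, clock x (of_int i + r)) = \<Phi> (\<Phi> (x, clock x (of_int i)), r * T (iter i x))"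
    using flow_clock_linear[OF r, of \<Phi> S x i] x in_X by (simp add: flow_add)
  then show ?thesis using x by (simp add: flow_clock_int)
qed

text \<open>
  The limit of hits would be a time near which hits are isolated.
\<close>
lemma hit_times_no_limit:
  assumes z: "z \<in> topspace X" and s: "s \<longlonglongrightarrow> L" and hits: "\<And>n. \<Phi> (z, s n) \<in> S"
  shows "\<exists>n. s n = L"
proof (rule ccontr)
  assume "\<nexists>n. s n = L"
  obtain d where d: "0 < d" "\<forall>t. 0 < \<bar>t - L\<bar> \<and> \<bar>t - L\<bar> \<le> d \<longrightarrow> \<Phi> (z, t) \<notin> S"
    by (rule hit_times_discrete[OF z])
  obtain n where "\<bar>s n - L\<bar> < d"
    using s d(1) unfolding lim_sequentially dist_real_def by blast
  then show False using d(2)[rule_format, of "s n"] hits \<open>\<nexists>n. s n = L\<close> by auto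
qed

text \<open>
  The clock values at the integers are hits and strictly increasing, so a bound would make them
  converge without attaining the limit, contrary to \<open>hit_times_no_limit\<close>.
\<close>
lemma clock_unbounded:
  assumes x: "x \<in> S"
  shows "\<exists>n. y < clock x (of_int n)" "\<exists>n. clock x (of_int n) < y"
proof -
  interpret piecewise_linear "clock x" "\<lambda>i. T (iter i x)" by (rule clock_piecewise_linear[OF x])
  have xX: "x \<in> topspace X" using x in_X by blast
  show "\<exists>n. y < clock x (of_int n)"
  proof (rule ccontr)
    assume "\<nexists>n. y < clock x (of_int n)"
    then have bd: "clock x (of_int n) \<le> y" for n by (meson not_le)
    let ?s = "\<lambda>n. clock x (of_int (int n))"
    have inc: "incseq ?s"
      by (rule incseq_SucI) (intro less_imp_le mono_int, simp)
    obtain L where L: "?s \<longlonglongrightarrow> L" "\<forall>n. ?s n \<le> L"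
      using incseq_convergent[OF inc, of y] bd by blast
    have "\<Phi> (x, ?s n) \<in> S" for n using x by (simp only: flow_clock_int[OF x] iter_in)
    then obtain n where "?s n = L"
      using hit_times_no_limit[OF xX L(1)] by blast
    then show False using L(2)[rule_format, of "Suc n"] mono_int[of "int n" "int (Suc n)"] by simp
  qed
  show "\<exists>n. clock x (of_int n) < y"
  proof (rule ccontr)
    assume "\<nexists>n. clock x (of_int n) < y"
    then have bd: "y \<le> clock x (of_int n)" for n by (meson not_le)
    let ?s = "\<lambda>n. clock x (of_int (- int n))"
    have dec: "decseq ?s"
      by (rule decseq_SucI) (intro less_imp_le mono_int, simp)
    obtain L where L: "?s \<longlonglongrightarrow> L" "\<forall>n. L \<le> ?s n"
      using decseq_convergent[OF dec, of y] bd by blast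
    have "\<Phi> (x, ?s n) \<in> S" for n using x by (simp only: flow_clock_int[OF x] iter_in)
    then obtain n where "?s n = L"
      using hit_times_no_limit[OF xX L(1)] by blast
    then show False using L(2)[rule_format, of "Suc n"] mono_int[of "- int (Suc n)" "- int n"] by simp
  qed
qed

lemma clock_strict_mono: "x \<in> S \<Longrightarrow> strict_mono (clock x)"
  using piecewise_linear.mono[OF clock_piecewise_linear] .

lemma clock_surj:
  assumes x: "x \<in> S"
  shows "surj (clock x)"
  using piecewise_linear.surj[OF clock_piecewise_linear[OF x]] clock_unbounded[OF x] by (meson less_imp_le)

lemma clock_unit: "0 \<le> r \<Longrightarrow> r \<le> 1 \<Longrightarrow> clock x r = r * T x"
  using flow_clock_linear[of r \<Phi> S x 0] by simp

lemma base_exists: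
  assumes z: "z \<in> topspace X"
  obtains b r where "b \<in> S" "0 \<le> r" "r < T b" "z = \<Phi> (b, r)"
proof (cases "z \<in> S")
  case True
  then show ?thesis using that[of z 0] z return_time_pos by (simp add: flow_0)
next
  case False
  interpret R: section_flow "\<lambda>(x, t). \<Phi> (x, - t)" X S by (rule time_reversed)
  obtain t where t: "0 < t" "\<Phi> (z, - t) \<in> S" "\<forall>s. 0 < s \<and> s < t \<longrightarrow> \<Phi> (z, - s) \<notin> S"
    using R.next_hit[OF z, of 0] by auto
  let ?b = "\<Phi> (z, - t)"
  have "\<Phi> (?b, s) \<notin> S" if "0 < s" "s \<le> t" for s
    using t(3)[rule_format, of "t - s"] that z False
    by (cases "s = t") (auto simp: flow_add flow_0)
  then have "t < T ?b" using return_time[OF in_X[OF t(2)]] by (meson not_le)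
  then show ?thesis using that[of ?b t] t z by (simp add: flow_add flow_0)
qed

lemma base_unique:
  assumes "b \<in> S" "0 \<le> r" "r < T b" "b' \<in> S" "0 \<le> r'" "r' < T b'" "\<Phi> (b, r) = \<Phi> (b', r')"
  shows "b = b'" "r = r'"
proof -
  have *: "b = b' \<and> r = r'" if "b \<in> S" "0 \<le> r" "r < T b" "b' \<in> S" "0 \<le> r'" "r' < T b'" "\<Phi> (b, r) = \<Phi> (b', r')" "r \<le> r'"
    for b b' r r'
  proof -
    have X: "b \<in> topspace X" "b' \<in> topspace X" using that in_X by auto
    have b: "b = \<Phi> (b', r' - r)"
      using flow_back[OF X(1), of r] that(7) X by (simp add: flow_add)
    have "r = r'"
    proof (rule ccontr)
      assume "r \<noteq> r'"
      then have "\<Phi> (b', r' - r) \<notin> S" using that by (intro return_time(3) X) auto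
      then show False using b that by simp
    qed
    then show ?thesis using b X by (simp add: flow_0)
  qed
  show "b = b'" "r = r'" using *[of b r b' r'] *[of b' r' b r] assms by (metis linear)+
qed

end

section \<open>Transversality yields a sign change\<close>

lemma unit_ball_convex:
  assumes a: "a \<in> unit_ball n" and b: "b \<in> unit_ball n" and t: "0 \<le> t" "t \<le> 1"
  shows "(\<lambda>i. (1 - t) * a i + t * b i) \<in> unit_ball n"
proof -
  have "(\<Sum>i<n. ((1 - t) * a i + t * b i)\<^sup>2) \<le> (\<Sum>i<n. (1 - t) * (a i)\<^sup>2 + t * (b i)\<^sup>2)"
  proof (rule sum_mono)
    fix i
    have "(1 - t) * (a i)\<^sup>2 + t * (b i)\<^sup>2 - ((1 - t) * a i + t * b i)\<^sup>2 = t * (1 - t) * (a i - b i)\<^sup>2"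
      by (simp add: power2_eq_square algebra_simps)
    also have "\<dots> \<ge> 0" using t by simp
    finally show "((1 - t) * a i + t * b i)\<^sup>2 \<le> (1 - t) * (a i)\<^sup>2 + t * (b i)\<^sup>2" by simp
  qed
  also have "\<dots> = (1 - t) * (\<Sum>i<n. (a i)\<^sup>2) + t * (\<Sum>i<n. (b i)\<^sup>2)"
    by (simp add: sum.distrib sum_distrib_left)
  also have "\<dots> < 1"
  proof -
    have s: "(\<Sum>i<n. (a i)\<^sup>2) < 1" "(\<Sum>i<n. (b i)\<^sup>2) < 1" using a b by (auto simp: unit_ball_def)
    show ?thesis by (rule convex_bound_lt) (use s t in auto)
  qed
  finally show ?thesis
    using a b by (auto simp: unit_ball_def topspace_Euclidean_space)
qed

text \<open>
  Pull the straight segment between the chart coordinates of \<open>a\<close> and \<open>b\<close> back to \<open>U\<close>: its last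
  coordinate keeps its sign, so the segment avoids the section.
\<close>
lemma same_side_same_component:
  assumes \<phi>: "flat_chart n X S U \<phi>" and U: "U \<subseteq> topspace X"
    and a: "a \<in> U" "\<phi> a (n - 1) \<noteq> 0" and b: "b \<in> U" "0 < \<phi> a (n - 1) * \<phi> b (n - 1)"
  shows "\<exists>K. connectedin (subtopology X (U - S)) K \<and> a \<in> K \<and> b \<in> K"
proof -
  have hom: "homeomorphic_map (subtopology X U) (subtopology (Euclidean_space n) (unit_ball n)) \<phi>"
    and img: "\<phi> ` (U \<inter> S) = unit_ball n \<inter> {v. v (n - 1) = 0}"
    using \<phi> by (auto simp: flat_chart_def)
  have ball: "topspace (subtopology (Euclidean_space n) (unit_ball n)) = unit_ball n"
    by (auto simp: unit_ball_def)
  have tU: "topspace (subtopology X U) = U" using U by auto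
  obtain \<psi> where hm: "homeomorphic_maps (subtopology X U) (subtopology (Euclidean_space n) (unit_ball n)) \<phi> \<psi>"
    using hom homeomorphic_map_maps by blast
  then have \<phi>\<psi>: "\<And>x. x \<in> U \<Longrightarrow> \<psi> (\<phi> x) = x" "\<And>v. v \<in> unit_ball n \<Longrightarrow> \<phi> (\<psi> v) = v"
    and \<psi>: "continuous_map (subtopology (Euclidean_space n) (unit_ball n)) (subtopology X U) \<psi>"
    and \<phi>c: "continuous_map (subtopology X U) (subtopology (Euclidean_space n) (unit_ball n)) \<phi>"
    unfolding homeomorphic_maps_def ball tU by blast+
  have \<phi>b: "\<phi> x \<in> unit_ball n" if "x \<in> U" for x
    using continuous_map_funspace[OF \<phi>c] that unfolding ball tU by blast
  define p where "p = (\<lambda>t::real. \<lambda>i. (1 - t) * \<phi> a i + t * \<phi> b i)"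
  have p_ball: "p t \<in> unit_ball n" if "t \<in> {0..1}" for t
    unfolding p_def using that \<phi>b a b by (intro unit_ball_convex) auto
  have p_side: "p t (n - 1) \<noteq> 0" if t: "t \<in> {0..1}" for t
  proof -
    have "((1 - t) * \<phi> a (n - 1) + t * \<phi> b (n - 1)) * \<phi> a (n - 1) > 0"
    proof (cases "t = 1")
      case False
      then have "0 < (1 - t) * (\<phi> a (n - 1))\<^sup>2" using a t by simp
      moreover have "0 \<le> t * (\<phi> a (n - 1) * \<phi> b (n - 1))" using b t by simp
      ultimately show ?thesis by (simp add: power2_eq_square algebra_simps)
    qed (use b in \<open>simp add: mult.commute\<close>)
    then show ?thesis by (auto simp: p_def)
  qed
  have "continuous_map (top_of_set {0..1}) (subtopology (Euclidean_space n) (unit_ball n)) p"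
    using p_ball unfolding Euclidean_space_def p_def
    by (auto simp: continuous_map_in_subtopology continuous_map_componentwise_UNIV unit_ball_def topspace_Euclidean_space
        intro!: continuous_intros)
  then have "continuous_map (top_of_set {0..1}) (subtopology X U) (\<psi> \<circ> p)"
    using \<psi> by (rule continuous_map_compose)
  moreover have "\<psi> (p t) \<in> U - S" if t: "t \<in> {0..1}" for t
  proof
    show "\<psi> (p t) \<in> U" using continuous_map_funspace[OF \<psi>] p_ball[OF t] unfolding ball tU by blast
    show "\<psi> (p t) \<notin> S"
    proof
      assume "\<psi> (p t) \<in> S"
      then have "\<phi> (\<psi> (p t)) \<in> \<phi> ` (U \<inter> S)" using \<open>\<psi> (p t) \<in> U\<close> by blast
      then show False using img \<phi>\<psi>(2)[OF p_ball[OF t]] p_side[OF t] by auto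
    qed
  qed
  ultimately have "continuous_map (top_of_set {0..1}) (subtopology X (U - S)) (\<psi> \<circ> p)"
    by (auto simp: continuous_map_in_subtopology)
  moreover have "connectedin (top_of_set {0..1::real}) {0..1}"
    by (simp add: connectedin_subtopology)
  ultimately have "connectedin (subtopology X (U - S)) ((\<psi> \<circ> p) ` {0..1})"
    by (rule connectedin_continuous_map_image)
  moreover have "a = (\<psi> \<circ> p) 0" "b = (\<psi> \<circ> p) 1"
    using \<phi>\<psi>(1) a b by (auto simp: p_def)
  ultimately show ?thesis by (intro exI[of _ "(\<psi> \<circ> p) ` {0..1}"]) auto
qed

text \<open>
  The last chart coordinate serves as the crossing function. The arcs just before and just after a
  section point lie in different components of \<open>U - S\<close>, and points on the same side of the hyperplane
  lie in the same component; therefore the coordinate has opposite signs on the two arcs.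
\<close>
lemma section_flow_if_flow_object:
  assumes "(\<Phi>, X, S) \<in> flow_objects"
  shows "section_flow \<Phi> X S"
proof -
  have flow: "is_flow \<Phi> X" and sec: "global_section \<Phi> X S"
    using assms by (auto simp: flow_objects_def)
  obtain n where trans: "topologically_transversal n \<Phi> X S"
    using sec by (auto simp: global_section_def)
  then have clS: "closedin X S"
    by (auto simp: topologically_transversal_def codim_one_submanifold_def)
  obtain \<delta>p \<delta>m :: "'a \<Rightarrow> real" where local: "\<forall>x\<in>S. \<exists>U \<phi>.
        neighbourhood_in X x U \<and> flat_chart n X S U \<phi> \<and>
        0 < \<delta>p x \<and> \<delta>m x < 0 \<and>
        (\<exists>C D. C \<in> connected_components_of (subtopology X (U - S)) \<and>
               D \<in> connected_components_of (subtopology X (U - S)) \<and> C \<noteq> D \<and>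
               \<Phi> ` ({x} \<times> {\<delta>m x..<0}) \<subseteq> C \<and> \<Phi> ` ({x} \<times> {0<..\<delta>p x}) \<subseteq> D) \<and>
        \<Phi> ` ({x} \<times> {\<delta>m x..\<delta>p x}) \<inter> S = {x} \<and>
        (\<exists>V \<delta>. neighbourhood_in X x V \<and> V \<subseteq> U \<and> 0 < \<delta> \<and>
               (\<forall>y\<in>V \<inter> S. \<delta> < \<delta>p y \<and> \<delta>m y < - \<delta>))"
    using trans unfolding topologically_transversal_def by (elim exE conjE)
  have cont: "continuous_map (prod_topology X euclideanreal) X \<Phi>"
    and flow_0: "\<And>x. x \<in> topspace X \<Longrightarrow> \<Phi> (x, 0) = x"
    and flow_add: "\<And>x s t. x \<in> topspace X \<Longrightarrow> \<Phi> (\<Phi> (x, t), s) = \<Phi> (x, t + s)"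
    using flow unfolding is_flow_def by (elim conjE, blast)+
  have no_hit: "\<Phi> (y, t) \<notin> S" if y: "y \<in> S" and t: "\<delta>m y \<le> t" "t \<le> \<delta>p y" "t \<noteq> 0" for y t
  proof -
    obtain U C D where "C \<in> connected_components_of (subtopology X (U - S))"
      "D \<in> connected_components_of (subtopology X (U - S))"
      and CD: "\<Phi> ` ({y} \<times> {\<delta>m y..<0}) \<subseteq> C" "\<Phi> ` ({y} \<times> {0<..\<delta>p y}) \<subseteq> D"
      using bspec[OF local y] by (elim exE conjE)
    then have "C \<subseteq> topspace (subtopology X (U - S))" "D \<subseteq> topspace (subtopology X (U - S))"
      by (simp_all only: connected_components_of_subset)
    then have "C \<inter> S = {}" "D \<inter> S = {}" by auto
    moreover have "\<Phi> (y, t) \<in> C \<or> \<Phi> (y, t) \<in> D"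
    proof (cases "t < 0")
      case True
      then have "(y, t) \<in> {y} \<times> {\<delta>m y..<0}" using t by simp
      then show ?thesis using CD(1) by blast
    next
      case False
      then have "(y, t) \<in> {y} \<times> {0<..\<delta>p y}" using t by simp
      then show ?thesis using CD(2) by blast
    qed
    ultimately show ?thesis by blast
  qed
  show ?thesis
  proof
    show "continuous_map (prod_topology X euclideanreal) X \<Phi>" by (fact cont)
    show "closedin X S" by (fact clS)
    show "\<Phi> (x, 0) = x" if "x \<in> topspace X" for x using flow_0[OF that] .
    show "\<Phi> (\<Phi> (x, t), s) = \<Phi> (x, t + s)" if "x \<in> topspace X" for x t s using flow_add[OF that] .
    show "\<exists>t>0. \<Phi> (x, t) \<in> S" "\<exists>t<0. \<Phi> (x, t) \<in> S" if "x \<in> topspace X" for x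
      using sec that by (auto simp: global_section_def)
  next
    fix x assume x: "x \<in> S"
    obtain V \<delta> where V: "neighbourhood_in X x V" "0 < \<delta>" "\<forall>y\<in>V \<inter> S. \<delta> < \<delta>p y \<and> \<delta>m y < - \<delta>"
      using bspec[OF local x] by (elim exE conjE)
    obtain W where W: "openin X W" "x \<in> W" "W \<subseteq> V" using V(1) by (auto simp: neighbourhood_in_def)
    have "\<Phi> (y, t) \<notin> S" if y: "y \<in> W \<inter> S" and t: "0 < \<bar>t\<bar> \<and> \<bar>t\<bar> \<le> \<delta>" for y t
    proof -
      have "\<delta> < \<delta>p y \<and> \<delta>m y < - \<delta>" using V(3) W(3) y by blast
      then show ?thesis using t y by (intro no_hit) auto
    qed
    then show "\<exists>V \<delta>. openin X V \<and> x \<in> V \<and> 0 < \<delta> \<and>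
          (\<forall>y\<in>V \<inter> S. \<forall>t. 0 < \<bar>t\<bar> \<and> \<bar>t\<bar> \<le> \<delta> \<longrightarrow> \<Phi> (y, t) \<notin> S)"
      using W V(2) by blast
  next
    fix x assume x: "x \<in> S"
    have xX: "x \<in> topspace X" using x closedin_subset[OF clS] by blast
    obtain U \<phi> C D where U: "neighbourhood_in X x U" and chart: "flat_chart n X S U \<phi>"
      and \<delta>: "0 < \<delta>p x" "\<delta>m x < 0"
      and C: "C \<in> connected_components_of (subtopology X (U - S))"
      and D: "D \<in> connected_components_of (subtopology X (U - S))" and "C \<noteq> D"
      and arcs: "\<Phi> ` ({x} \<times> {\<delta>m x..<0}) \<subseteq> C" "\<Phi> ` ({x} \<times> {0<..\<delta>p x}) \<subseteq> D"
      using bspec[OF local x] by (elim exE conjE) 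
    obtain W where W: "openin X W" "x \<in> W" "W \<subseteq> U" and UX: "U \<subseteq> topspace X"
      using U by (auto simp: neighbourhood_in_def)
    define g where "g = (\<lambda>z. \<phi> z (n - 1))"
    have hom: "homeomorphic_map (subtopology X U) (subtopology (Euclidean_space n) (unit_ball n)) \<phi>"
      and img: "\<phi> ` (U \<inter> S) = unit_ball n \<inter> {v. v (n - 1) = 0}"
      using chart by (auto simp: flat_chart_def)
    have \<phi>c: "continuous_map (subtopology X U) (subtopology (Euclidean_space n) (unit_ball n)) \<phi>"
      using hom homeomorphic_imp_continuous_map by blast
    have tU: "topspace (subtopology X U) = U" using UX by auto
    have inj: "inj_on \<phi> U" using homeomorphic_imp_injective_map[OF hom] tU by simp
    have gS: "z \<in> S" if z: "z \<in> U" "g z = 0" for z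
    proof -
      have "\<phi> z \<in> unit_ball n"
        using continuous_map_funspace[OF \<phi>c] z unfolding tU by (auto simp: Pi_iff)
      then have "\<phi> z \<in> \<phi> ` (U \<inter> S)" using z img by (auto simp: g_def)
      then show ?thesis using inj z by (auto dest: inj_onD)
    qed
    have "continuous_map (subtopology X W) (powertop_real UNIV) \<phi>"
      using continuous_map_from_subtopology_mono[OF \<phi>c W(3)]
      by (auto simp: Euclidean_space_def continuous_map_in_subtopology)
    then have gc: "continuous_map (subtopology X W) euclideanreal g"
      by (simp add: g_def continuous_map_componentwise_UNIV)
    have "continuous_map euclideanreal X (\<lambda>t. \<Phi> (x, t))"
      using continuous_map_compose[OF _ cont, of euclideanreal "\<lambda>t. (x, t)"] xX
      by (auto simp: o_def continuous_map_pairedI)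
    then have "open {t. \<Phi> (x, t) \<in> W}"
      using openin_continuous_map_preimage[of euclideanreal X _ W] W(1) by auto
    then obtain e where e: "0 < e" "\<forall>t. dist t 0 < e \<longrightarrow> \<Phi> (x, t) \<in> W"
      using W(2) xX flow_0 unfolding open_dist by (metis mem_Collect_eq)
    \<comment> \<open>Short enough to stay in the open set \<open>W\<close> and on the two transversal arcs.\<close>
    define d where "d = min (e / 2) (min (\<delta>p x) (- \<delta>m x))"
    have d: "0 < d" "d < e" "d \<le> \<delta>p x" "\<delta>m x \<le> - d" using e \<delta> by (auto simp: d_def)
    have "\<Phi> (x, t) \<in> W \<and> \<Phi> (x, - t) \<in> W \<and> g (\<Phi> (x, t)) * g (\<Phi> (x, - t)) < 0" if t: "0 < t \<and> t \<le> d" for t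
    proof (intro conjI)
      show inW: "\<Phi> (x, t) \<in> W" "\<Phi> (x, - t) \<in> W" using e(2) t d by (auto simp: dist_real_def)
      have inC: "\<Phi> (x, - t) \<in> C" and inD: "\<Phi> (x, t) \<in> D"
        using arcs t d by (auto simp: image_subset_iff)
      have "\<Phi> (x, t) \<notin> S" "\<Phi> (x, - t) \<notin> S" 
        using no_hit[OF x, of t] no_hit[OF x, of "- t"] t d by auto
      then have nz: "g (\<Phi> (x, t)) \<noteq> 0" "g (\<Phi> (x, - t)) \<noteq> 0" using gS inW W(3) by blast+
      have "\<not> 0 < g (\<Phi> (x, t)) * g (\<Phi> (x, - t))"
      proof
        assume "0 < g (\<Phi> (x, t)) * g (\<Phi> (x, - t))"
        then obtain K where K: "connectedin (subtopology X (U - S)) K" "\<Phi> (x, t) \<in> K" "\<Phi> (x, - t) \<in> K"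
          using same_side_same_component[OF chart UX, of "\<Phi> (x, t)" "\<Phi> (x, - t)"] inW W(3) nz
          unfolding g_def by blast
        have "K \<subseteq> C" using connected_components_of_maximal[OF C K(1)] K inC by (auto simp: disjnt_iff)
        moreover have "K \<subseteq> D" using connected_components_of_maximal[OF D K(1)] K inD by (auto simp: disjnt_iff)
        ultimately have "C \<inter> D \<noteq> {}" using K by blast
        then show False using connected_components_of_overlap[OF C D] \<open>C \<noteq> D\<close> by blast
      qed
      then show "g (\<Phi> (x, t)) * g (\<Phi> (x, - t)) < 0" using nz by (simp add: not_less order_le_less)
    qed
    then show "\<exists>W g \<delta>. openin X W \<and> x \<in> W \<and>
          continuous_map (subtopology X W) euclideanreal g \<and> (\<forall>y\<in>W. g y = 0 \<longrightarrow> y \<in> S) \<and>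
          (0::real) < \<delta> \<and> (\<forall>t. 0 < t \<and> t \<le> \<delta> \<longrightarrow>
             \<Phi> (x, t) \<in> W \<and> \<Phi> (x, - t) \<in> W \<and> g (\<Phi> (x, t)) * g (\<Phi> (x, - t)) < 0)"
      using W(1,2) gc gS W(3) d(1)
      by (intro exI[of _ W] exI[of _ g] exI[of _ d] conjI ballI allI impI) auto
  qed
qed

section \<open>Extending maps between sections\<close>

context section_flow
begin

lemma iter_minus_one: "x \<in> S \<Longrightarrow> iter (- 1) x = poincare_map (\<lambda>(x, t). \<Phi> (x, - t)) S x"
  using poincare_reversed(2)[of "iter (- 1) x"] iter_Suc[of x "- 1"] iter_in[of x "- 1"] by simp

lemma iter_minus_one_continuous: "continuous_map (subtopology X S) (subtopology X S) (iter (- 1))"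
proof -
  interpret R: section_flow "\<lambda>(x, t). \<Phi> (x, - t)" X S by (rule time_reversed)
  show ?thesis
    by (rule continuous_map_eq[OF R.poincare_continuous]) (simp add: iter_minus_one)
qed

lemma base_phase_exists:
  assumes z: "z \<in> topspace X"
  obtains b p where "b \<in> S" "0 \<le> p" "p < 1" "z = \<Phi> (b, p * T b)"
proof -
  obtain b r where b: "b \<in> S" "0 \<le> r" "r < T b" "z = \<Phi> (b, r)"
    by (rule base_exists[OF z])
  have "0 < T b" using b return_time_pos by blast
  then show ?thesis using that[of b "r / T b"] b by simp
qed

lemma base_phase_unique:
  assumes "b \<in> S" "0 \<le> p" "p < 1" "b' \<in> S" "0 \<le> p'" "p' < 1" "\<Phi> (b, p * T b) = \<Phi> (b', p' * T b')"
  shows "b = b' \<and> p = p'"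
proof -
  have T: "0 < T b" "0 < T b'" using assms return_time_pos by auto
  then have "b = b'" "p * T b = p' * T b'"
    using base_unique[of b "p * T b" b' "p' * T b'"] assms by auto
  then show ?thesis using T by simp
qed

text \<open>
  A point \<open>z\<close> lies on the excursion that starts at the section point \<open>base z\<close>, of which it has completed
  the fraction \<open>phase z\<close>.
\<close>
definition base :: "'a \<Rightarrow> 'a" where
  "base z = (SOME b. \<exists>p. b \<in> S \<and> 0 \<le> p \<and> p < 1 \<and> z = \<Phi> (b, p * T b))"

definition phase :: "'a \<Rightarrow> real" where
  "phase z = (SOME p. 0 \<le> p \<and> p < 1 \<and> z = \<Phi> (base z, p * T (base z)))"

lemma base_phase:
  assumes z: "z \<in> topspace X"
  shows "base z \<in> S" "0 \<le> phase z" "phase z < 1" "\<Phi> (base z, phase z * T (base z)) = z"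
proof -
  have "\<exists>b p. b \<in> S \<and> 0 \<le> p \<and> p < 1 \<and> z = \<Phi> (b, p * T b)"
    using base_phase_exists[OF z] by metis
  then have b: "\<exists>p. base z \<in> S \<and> 0 \<le> p \<and> p < 1 \<and> z = \<Phi> (base z, p * T (base z))"
    unfolding base_def by (rule someI_ex)
  then have "\<exists>p. 0 \<le> p \<and> p < 1 \<and> z = \<Phi> (base z, p * T (base z))" by blast
  then have "0 \<le> phase z \<and> phase z < 1 \<and> z = \<Phi> (base z, phase z * T (base z))"
    unfolding phase_def by (rule someI_ex)
  then show "base z \<in> S" "0 \<le> phase z" "phase z < 1" "\<Phi> (base z, phase z * T (base z)) = z"
    using b by auto
qed

lemma base_phase_flow:
  assumes "b \<in> S" "0 \<le> p" "p < 1"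
  shows "base (\<Phi> (b, p * T b)) = b" "phase (\<Phi> (b, p * T b)) = p"
proof -
  have "\<Phi> (b, p * T b) \<in> topspace X" using assms in_X flow_in by blast
  note bp = base_phase[OF this]
  show "base (\<Phi> (b, p * T b)) = b" "phase (\<Phi> (b, p * T b)) = p"
    using base_phase_unique[OF bp(1-3) assms bp(4)] by auto
qed

lemma clock_minus_unit:
  assumes "- 1 \<le> r" "r \<le> 0"
  shows "clock x r = r * T (iter (- 1) x)"
  using flow_clock_linear[of "1 + r" \<Phi> S x "- 1"] flow_clock_linear[of 1 \<Phi> S x "- 1"] assms
  by (simp add: algebra_simps)

end

text \<open>
  The map \<open>k\<close> is a morphism between Poincare maps. Its extension sends the point with base \<open>b\<close> and
  phase \<open>p\<close> to the point with base \<open>k b\<close> and phase \<open>p\<close>.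
\<close>
locale section_conjugacy =
  A: section_flow \<Phi>1 X1 S1 + B: section_flow \<Phi>2 X2 S2
  for \<Phi>1 :: "'a \<times> real \<Rightarrow> 'a" and X1 S1 and \<Phi>2 :: "'a \<times> real \<Rightarrow> 'a" and X2 S2 +
  fixes k :: "'a \<Rightarrow> 'a"
  assumes k_cont: "continuous_map (subtopology X1 S1) (subtopology X2 S2) k"
    and k_poincare: "x \<in> S1 \<Longrightarrow> k (A.P x) = B.P (k x)"
begin

lemma k_in: "x \<in> S1 \<Longrightarrow> k x \<in> S2"
  using continuous_map_funspace[OF k_cont] unfolding A.topspace_S B.topspace_S by blast

lemma k_iter: "x \<in> S1 \<Longrightarrow> k (A.iter i x) = B.iter i (k x)"
proof (induction i rule: int_induct[where k = 0])
  case base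
  then show ?case by simp
next
  case (step1 i)
  then show ?case by (simp add: A.iter_Suc B.iter_Suc k_poincare k_in A.iter_in)
next
  case (step2 i)
  note x = \<open>x \<in> S1\<close>
  have "B.P (k (A.iter (i - 1) x)) = B.P (B.iter (i - 1) (k x))"
    using step2 A.iter_Suc[of x "i - 1"] B.iter_Suc[of "k x" "i - 1"] k_poincare[of "A.iter (i - 1) x"]
    by (simp add: k_in A.iter_in)
  then show ?case
    using B.poincare_bij x by (auto simp: bij_betw_def k_in A.iter_in B.iter_in dest: inj_onD)
qed

text \<open>
  The time change along the orbit of a section point: read the parameter off the clock of \<open>x\<close> and
  evaluate the clock of \<open>k x\<close> at it.
\<close>
definition reparam :: "'a \<Rightarrow> real \<Rightarrow> real" where
  "reparam x s = B.clock (k x) (inv (A.clock x) s)"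

lemma reparam_clock: "x \<in> S1 \<Longrightarrow> reparam x (A.clock x v) = B.clock (k x) v"
  unfolding reparam_def using A.clock_strict_mono strict_mono_imp_inj_on by (metis inv_f_f)

lemma reparam_strict_mono: "x \<in> S1 \<Longrightarrow> strict_mono (reparam x)"
proof (rule strict_monoI)
  fix a b :: real assume x: "x \<in> S1" and "a < b"
  obtain u v where "a = A.clock x u" "b = A.clock x v" using A.clock_surj[OF x] by (metis surjD)
  then show "reparam x a < reparam x b"
    using \<open>a < b\<close> x reparam_clock A.clock_strict_mono[OF x] B.clock_strict_mono[OF k_in[OF x]]
    by (simp add: strict_mono_less)
qed

lemma reparam_surj: "x \<in> S1 \<Longrightarrow> surj (reparam x)"
  unfolding surj_def
proof
  fix y assume x: "x \<in> S1"
  obtain v where "y = B.clock (k x) v" using B.clock_surj[OF k_in[OF x]] by (metis surjD)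
  then show "\<exists>s. y = reparam x s" using reparam_clock[OF x] by metis
qed

definition extend_map :: "'a \<Rightarrow> 'a" where
  "extend_map = restrict (\<lambda>z. \<Phi>2 (k (A.base z), A.phase z * B.T (k (A.base z)))) (topspace X1)"

text \<open>
  Time is measured from \<open>z\<close> instead of from its base point, whence the two offsets.
\<close>
definition extend_time :: "'a \<times> real \<Rightarrow> real" where
  "extend_time = restrict (\<lambda>(z, r). reparam (A.base z) (r + A.phase z * A.T (A.base z)) - A.phase z * B.T (k (A.base z)))
     (topspace X1 \<times> UNIV)"

lemma extend_map_base:
  assumes "b \<in> S1" "0 \<le> p" "p < 1"
  shows "extend_map (\<Phi>1 (b, p * A.T b)) = \<Phi>2 (k b, p * B.T (k b))"
  using assms A.in_X A.flow_in A.base_phase_flow[OF assms] by (simp add: extend_map_def)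

text \<open>
  The description of the extension by a base point and a phase in \<open>[0, 1)\<close> is valid along the entire
  orbit, because \<open>k\<close> commutes with all iterates of the Poincare maps. This makes the extension
  equivariant, and it allows continuity to be checked in coordinates that pass through the section.
\<close>
lemma extend_map_flow:
  assumes y: "y \<in> S1"
  shows "extend_map (\<Phi>1 (y, s)) = \<Phi>2 (k y, reparam y s)"
proof -
  obtain v where s: "s = A.clock y v" using A.clock_surj[OF y] by (metis surjD)
  have v: "v = of_int \<lfloor>v\<rfloor> + frac v" and f: "0 \<le> frac v" "frac v < 1"
    using frac_lt_1[of v] frac_ge_0[of v] by (simp_all add: frac_def)
  let ?w = "A.iter \<lfloor>v\<rfloor> y"
  have "\<Phi>1 (y, s) = \<Phi>1 (?w, frac v * A.T ?w)"
    using A.flow_clock[OF y, of "frac v" "\<lfloor>v\<rfloor>"] f v s by simp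
  then have "extend_map (\<Phi>1 (y, s)) = \<Phi>2 (k ?w, frac v * B.T (k ?w))"
    using extend_map_base[of ?w "frac v"] f y A.iter_in by simp
  also have "\<dots> = \<Phi>2 (k y, B.clock (k y) (of_int \<lfloor>v\<rfloor> + frac v))"
    using B.flow_clock[OF k_in[OF y], of "frac v" "\<lfloor>v\<rfloor>"] f k_iter[OF y] by simp
  also have "\<dots> = \<Phi>2 (k y, reparam y s)"
    using v reparam_clock[OF y] s by simp
  finally show ?thesis .
qed

lemma extend_map_on_section: "y \<in> S1 \<Longrightarrow> extend_map y = k y"
  using extend_map_base[of y 0] A.in_X B.in_X k_in by (simp add: A.flow_0 B.flow_0)

text \<open>
  From the previous return up to the next one the time change is linear on either side of \<open>0\<close>, with a
  corner at \<open>0\<close>. Writing it as one formula exhibits joint continuity in \<open>y\<close> and \<open>s\<close>.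
\<close>
lemma reparam_near_0:
  assumes y: "y \<in> S1" and s: "- A.T (A.iter (- 1) y) \<le> s" "s \<le> A.T y"
  shows "reparam y s = max s 0 * (B.T (k y) / A.T y)
     + min s 0 * (B.T (k (A.iter (- 1) y)) / A.T (A.iter (- 1) y))"
proof (cases "0 \<le> s")
  case True
  have T: "0 < A.T y" using y A.return_time_pos by blast
  then have "s = A.clock y (s / A.T y)" using True s by (simp add: A.clock_unit)
  then have "reparam y s = B.clock (k y) (s / A.T y)" using reparam_clock[OF y] by metis
  also have "\<dots> = s / A.T y * B.T (k y)" using True s T by (simp add: B.clock_unit)
  finally show ?thesis using True by simp
next
  case False
  let ?w = "A.iter (- 1) y"
  have T: "0 < A.T ?w" using y A.return_time_pos A.iter_in by blast
  then have r: "- 1 \<le> s / A.T ?w" "s / A.T ?w \<le> 0" using False s by (simp_all add: field_simps)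
  then have "s = A.clock y (s / A.T ?w)" using T by (simp add: A.clock_minus_unit)
  then have "reparam y s = B.clock (k y) (s / A.T ?w)" using reparam_clock[OF y] by metis
  also have "\<dots> = s / A.T ?w * B.T (k ?w)" using r y by (simp add: B.clock_minus_unit k_iter)
  finally show ?thesis using False by simp
qed

text \<open>
  A local hitting time writes each \<open>w\<close> near \<open>z\<close> as \<open>\<Phi>1 (y w, s w)\<close> with \<open>y w\<close> in the section and both
  \<open>y\<close> and \<open>s\<close> continuous. If \<open>z\<close> is itself on the section, \<open>s w\<close> takes both signs, so that the phase of
  \<open>w\<close> jumps; \<open>extend_map_flow\<close> and \<open>reparam_near_0\<close> express the extension in \<open>y w\<close> and \<open>s w\<close> without
  using the phase.
\<close>
lemma extend_map_continuous: "continuous_map X1 X2 extend_map"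
proof (rule continuous_map_if_locally)
  fix z assume z: "z \<in> topspace X1"
  note bp = A.base_phase[OF z]
  let ?b = "A.base z" and ?r = "A.phase z * A.T (A.base z)"
  have Tb: "0 < A.T ?b" "0 < A.T (A.iter (- 1) ?b)" using bp A.return_time_pos A.iter_in by auto
  then have r: "0 \<le> ?r" "?r < A.T ?b" using bp by auto
  have "\<Phi>1 (z, - ?r) = ?b"
    using A.flow_back[of ?b ?r] bp A.in_X by simp
  then have "\<Phi>1 (z, - ?r) \<in> S1" using bp by simp
  then obtain N \<rho> where N: "openin X1 N" "z \<in> N" "continuous_map (subtopology X1 N) euclideanreal \<rho>" "\<rho> z = - ?r"
    "\<forall>y\<in>N. \<Phi>1 (y, \<rho> y) \<in> S1"
    by (rule A.local_section[OF z])
  have NX: "N \<subseteq> topspace X1" using N(1) openin_subset by blast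
  define y where "y = (\<lambda>w. \<Phi>1 (w, \<rho> w))"
  define s where "s = (\<lambda>w. - \<rho> w)"
  have tN: "topspace (subtopology X1 N) = N" using NX by auto
  have yS: "y w \<in> S1" if "w \<in> N" for w using N(5) that by (simp add: y_def)
  have "continuous_map (subtopology X1 N) X1 y"
    unfolding y_def using N(3) by (intro A.flow_continuous continuous_map_from_subtopology[OF continuous_map_id, unfolded id_def])
  then have y: "continuous_map (subtopology X1 N) (subtopology X1 S1) y"
    using yS by (auto simp: continuous_map_in_subtopology tN)
  have s: "continuous_map (subtopology X1 N) euclideanreal s"
    unfolding s_def using N(3) by (rule continuous_map_minus)
  have yz: "y z = ?b" "s z = ?r" using \<open>\<Phi>1 (z, - ?r) = ?b\<close> N(4) by (simp_all add: y_def s_def)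
  note comp = continuous_map_compose[unfolded o_def]
  have y': "continuous_map (subtopology X1 N) (subtopology X1 S1) (\<lambda>w. A.iter (- 1) (y w))"
    by (rule comp[OF y A.iter_minus_one_continuous])
  have Ty: "continuous_map (subtopology X1 N) euclideanreal (\<lambda>w. A.T (y w))"
    by (rule comp[OF y A.return_time_continuous])
  have Ty': "continuous_map (subtopology X1 N) euclideanreal (\<lambda>w. A.T (A.iter (- 1) (y w)))"
    by (rule comp[OF y' A.return_time_continuous])
  have ky: "continuous_map (subtopology X1 N) (subtopology X2 S2) (\<lambda>w. k (y w))"
    by (rule comp[OF y k_cont])
  have Tky: "continuous_map (subtopology X1 N) euclideanreal (\<lambda>w. B.T (k (y w)))"
    by (rule comp[OF ky B.return_time_continuous])
  have Tky': "continuous_map (subtopology X1 N) euclideanreal (\<lambda>w. B.T (k (A.iter (- 1) (y w))))"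
    by (rule comp[OF comp[OF y' k_cont] B.return_time_continuous])
  have pos: "A.T (y w) \<noteq> 0" "A.T (A.iter (- 1) (y w)) \<noteq> 0" if "w \<in> N" for w
    using yS[OF that] A.return_time_pos A.iter_in by (metis less_irrefl)+
  \<comment> \<open>The points where \<open>s w\<close> stays between the previous and the next return of \<open>y w\<close>, as required by
     \<open>reparam_near_0\<close>.\<close>
  let ?M = "{w \<in> topspace (subtopology X1 N). A.T (A.iter (- 1) (y w)) + s w \<in> {0<..} \<and> A.T (y w) - s w \<in> {0<..}}"
  have "openin (subtopology X1 N) {w \<in> topspace (subtopology X1 N). A.T (A.iter (- 1) (y w)) + s w \<in> {0<..}}"
    by (rule openin_continuous_map_preimage[of _ euclideanreal]) (auto intro!: continuous_map_add Ty' s)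
  moreover have "openin (subtopology X1 N) {w \<in> topspace (subtopology X1 N). A.T (y w) - s w \<in> {0<..}}"
    by (rule openin_continuous_map_preimage[of _ euclideanreal]) (auto intro!: continuous_map_diff Ty s)
  ultimately have "openin (subtopology X1 N) ({w \<in> topspace (subtopology X1 N). A.T (A.iter (- 1) (y w)) + s w \<in> {0<..}}
      \<inter> {w \<in> topspace (subtopology X1 N). A.T (y w) - s w \<in> {0<..}})" by (rule openin_Int)
  also have "\<dots> = ?M" by auto
  finally have M: "openin X1 ?M" using N(1) openin_trans_full by blast
  have zM: "z \<in> ?M" using N(2) z yz r Tb by simp
  let ?f = "\<lambda>w. max (s w) 0 * (B.T (k (y w)) / A.T (y w))
     + min (s w) 0 * (B.T (k (A.iter (- 1) (y w))) / A.T (A.iter (- 1) (y w)))"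
  have "continuous_map (subtopology X1 N) euclideanreal ?f"
    by (intro continuous_map_add continuous_map_real_mult continuous_map_real_divide
        continuous_map_real_max continuous_map_real_min s Ty Ty' Tky Tky') (auto simp: pos tN)
  moreover have "continuous_map (subtopology X1 N) X2 (\<lambda>w. k (y w))"
    using ky by (simp add: continuous_map_in_subtopology)
  ultimately have "continuous_map (subtopology X1 N) X2 (\<lambda>w. \<Phi>2 (k (y w), ?f w))"
    by (intro B.flow_continuous)
  then have "continuous_map (subtopology X1 ?M) X2 (\<lambda>w. \<Phi>2 (k (y w), ?f w))"
    by (rule continuous_map_from_subtopology_mono) auto
  moreover have "\<Phi>2 (k (y w), ?f w) = extend_map w" if "w \<in> topspace (subtopology X1 ?M)" for w
  proof -
    have w: "w \<in> N" "w \<in> topspace X1" "- A.T (A.iter (- 1) (y w)) \<le> s w" "s w \<le> A.T (y w)" using that by auto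
    have "extend_map (\<Phi>1 (y w, s w)) = \<Phi>2 (k (y w), ?f w)"
      using extend_map_flow[OF yS[OF w(1)]] reparam_near_0[OF yS[OF w(1)] w(3,4)] by simp
    moreover have "\<Phi>1 (y w, s w) = w" unfolding y_def s_def using w A.flow_back by simp
    ultimately show ?thesis by simp
  qed
  ultimately have "continuous_map (subtopology X1 ?M) X2 extend_map"
    by (rule continuous_map_eq)
  then show "\<exists>N. openin X1 N \<and> z \<in> N \<and> continuous_map (subtopology X1 N) X2 extend_map"
    using M zM by blast
qed

lemma extend_time_base:
  assumes "b \<in> S1" "0 \<le> p" "p < 1"
  shows "extend_time (\<Phi>1 (b, p * A.T b), r) = reparam b (r + p * A.T b) - p * B.T (k b)"
  using assms A.in_X A.flow_in A.base_phase_flow[OF assms] by (simp add: extend_time_def)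

lemma extend_weak_morphism: "weak_morphism (\<Phi>1, X1) (\<Phi>2, X2) (extend_map, extend_time)"
  unfolding weak_morphism_def prod.case
proof (intro conjI ballI allI)
  show "extend_map \<in> extensional (topspace X1)" by (simp add: extend_map_def)
  show "extend_time \<in> extensional (topspace X1 \<times> UNIV)" by (simp add: extend_time_def)
  show "continuous_map X1 X2 extend_map" by (rule extend_map_continuous)
  fix z assume z: "z \<in> topspace X1"
  note bp = A.base_phase[OF z]
  let ?b = "A.base z" and ?r = "A.phase z * A.T (A.base z)"
  have time: "extend_time (z, t) = reparam ?b (t + ?r) - A.phase z * B.T (k ?b)" for t
    using z by (simp add: extend_time_def)
  have bX: "?b \<in> topspace X1" "k ?b \<in> topspace X2" using bp(1) A.in_X B.in_X k_in by auto
  have "extend_map (\<Phi>1 (z, t)) = \<Phi>2 (extend_map z, extend_time (z, t))" for t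
  proof -
    have "\<Phi>1 (z, t) = \<Phi>1 (?b, t + ?r)"
      using bp(4) A.flow_add[OF bX(1), of ?r t] by (simp add: add.commute)
    then have "extend_map (\<Phi>1 (z, t)) = \<Phi>2 (k ?b, reparam ?b (t + ?r))"
      using extend_map_flow[OF bp(1)] by simp
    also have "\<dots> = \<Phi>2 (\<Phi>2 (k ?b, A.phase z * B.T (k ?b)), extend_time (z, t))"
      using bX by (simp add: B.flow_add time)
    also have "\<Phi>2 (k ?b, A.phase z * B.T (k ?b)) = extend_map z"
      using z by (simp add: extend_map_def)
    finally show ?thesis .
  qed
  then show "extend_map (\<Phi>1 (z, t)) = \<Phi>2 (extend_map z, extend_time (z, t))" for t .
  have mono: "strict_mono (\<lambda>t. extend_time (z, t))"
    unfolding time using reparam_strict_mono[OF bp(1)] by (auto simp: strict_mono_def)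
  then show "strict_mono (\<lambda>t. extend_time (z, t))" .
  have "surj (\<lambda>t. extend_time (z, t))"
    unfolding surj_def
  proof
    fix y
    obtain s where "y + A.phase z * B.T (k ?b) = reparam ?b s"
      using reparam_surj[OF bp(1)] by (metis surjD)
    then have "y = extend_time (z, s - ?r)" by (simp add: time)
    then show "\<exists>t. y = extend_time (z, t)" by blast
  qed
  with mono show "homeomorphic_map euclideanreal euclideanreal (\<lambda>t. extend_time (z, t))"
    by (rule homeomorphic_map_strict_mono_surj)
  have "reparam ?b ?r = A.phase z * B.T (k ?b)"
    using reparam_clock[OF bp(1), of "A.phase z"] bp by (simp add: A.clock_unit B.clock_unit)
  then show "extend_time (z, 0) = 0" by (simp add: time)
qed

text \<open>
  A point of positive phase \<open>p < 1\<close> is mapped strictly between two consecutive hits.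
\<close>
lemma extend_map_preimage: "S1 = {z \<in> topspace X1. extend_map z \<in> S2}"
proof (intro equalityI subsetI)
  fix z assume "z \<in> S1"
  then show "z \<in> {z \<in> topspace X1. extend_map z \<in> S2}"
    using A.in_X extend_map_on_section k_in by simp
next
  fix z assume "z \<in> {z \<in> topspace X1. extend_map z \<in> S2}"
  then have z: "z \<in> topspace X1" and hit: "extend_map z \<in> S2" by auto
  note bp = A.base_phase[OF z]
  let ?c = "k (A.base z)"
  have c: "?c \<in> S2" using bp(1) k_in by simp
  have T: "0 < B.T ?c" using B.return_time_pos[OF c] .
  have "A.phase z = 0"
  proof (rule ccontr)
    assume "A.phase z \<noteq> 0"
    then have "0 < A.phase z * B.T ?c" "A.phase z * B.T ?c < B.T ?c" using bp T by auto
    then have "\<Phi>2 (?c, A.phase z * B.T ?c) \<notin> S2" using c by (intro B.return_time(3) B.in_X)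
    then show False using hit z by (simp add: extend_map_def)
  qed
  then have "z = A.base z" using bp(1,4) A.in_X by (simp add: A.flow_0)
  then show "z \<in> S1" using bp(1) by simp
qed

lemma extend_rate_preserving: "rate_preserving (\<Phi>1, X1, S1) (\<Phi>2, X2, S2) (extend_map, extend_time)"
  unfolding rate_preserving_def prod.case flow_clock_def[symmetric]
  by (auto simp: extend_time_base reparam_clock extend_map_on_section)

lemma extend_hom: "(extend_map, extend_time) \<in> flow_hom (\<Phi>1, X1, S1) (\<Phi>2, X2, S2)"
  using extend_weak_morphism extend_map_preimage extend_rate_preserving by (simp add: flow_hom_def)

end

section \<open>Morphisms are determined on the section\<close>

locale flow_morphism =
  A: section_flow \<Phi>1 X1 S1 + B: section_flow \<Phi>2 X2 S2
  for \<Phi>1 :: "'a \<times> real \<Rightarrow> 'a" and X1 S1 and \<Phi>2 :: "'a \<times> real \<Rightarrow> 'a" and X2 S2 +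
  fixes h :: "'a \<Rightarrow> 'a" and \<sigma> :: "'a \<times> real \<Rightarrow> real"
  assumes hom: "(h, \<sigma>) \<in> flow_hom (\<Phi>1, X1, S1) (\<Phi>2, X2, S2)"
begin

lemma weak: "weak_morphism (\<Phi>1, X1) (\<Phi>2, X2) (h, \<sigma>)"
  using hom by (simp add: flow_hom_def)

lemma h_ext: "h \<in> extensional (topspace X1)"
  and h_cont: "continuous_map X1 X2 h"
  and \<sigma>_ext: "\<sigma> \<in> extensional (topspace X1 \<times> UNIV)"
  using weak by (auto simp: weak_morphism_def)

lemma equivariant: "x \<in> topspace X1 \<Longrightarrow> h (\<Phi>1 (x, t)) = \<Phi>2 (h x, \<sigma> (x, t))"
  using weak by (auto simp: weak_morphism_def)

lemma time_change: "x \<in> topspace X1 \<Longrightarrow> strict_mono (\<lambda>t. \<sigma> (x, t))"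
  "x \<in> topspace X1 \<Longrightarrow> homeomorphic_map euclideanreal euclideanreal (\<lambda>t. \<sigma> (x, t))"
  "x \<in> topspace X1 \<Longrightarrow> \<sigma> (x, 0) = 0"
  using weak by (auto simp: weak_morphism_def)

lemma preimage: "S1 = {x \<in> topspace X1. h x \<in> S2}"
  using hom by (simp add: flow_hom_def)

lemma h_in: "x \<in> topspace X1 \<Longrightarrow> h x \<in> topspace X2"
  using continuous_map_funspace[OF h_cont] by auto

lemma h_section: "x \<in> S1 \<Longrightarrow> h x \<in> S2"
  using preimage by blast

lemma rate: "x \<in> S1 \<Longrightarrow> 0 \<le> t \<Longrightarrow> t < 1 \<Longrightarrow>
    \<sigma> (\<Phi>1 (x, t * A.T x), A.clock x (s + t) - t * A.T x) = B.clock (h x) (s + t) - t * B.T (h x)"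
proof -
  have "rate_preserving (\<Phi>1, X1, S1) (\<Phi>2, X2, S2) (h, \<sigma>)"
    using hom unfolding flow_hom_def prod.case mem_Collect_eq by (elim conjE)
  then show "x \<in> S1 \<Longrightarrow> 0 \<le> t \<Longrightarrow> t < 1 \<Longrightarrow>
    \<sigma> (\<Phi>1 (x, t * A.T x), A.clock x (s + t) - t * A.T x) = B.clock (h x) (s + t) - t * B.T (h x)"
    unfolding rate_preserving_def prod.case flow_clock_def[symmetric] by blast
qed

text \<open>
  The rate condition at phase \<open>0\<close>.
\<close>
lemma time_change_clock: "x \<in> S1 \<Longrightarrow> \<sigma> (x, A.clock x v) = B.clock (h x) v"
  using rate[of x 0 v] A.in_X by (simp add: A.flow_0)

lemma time_change_unit: "x \<in> S1 \<Longrightarrow> 0 \<le> p \<Longrightarrow> p \<le> 1 \<Longrightarrow> \<sigma> (x, p * A.T x) = p * B.T (h x)"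
  using time_change_clock[of x p] by (simp add: A.clock_unit B.clock_unit)

lemma h_base: "x \<in> S1 \<Longrightarrow> 0 \<le> p \<Longrightarrow> p \<le> 1 \<Longrightarrow> h (\<Phi>1 (x, p * A.T x)) = \<Phi>2 (h x, p * B.T (h x))"
  using equivariant[of x] A.in_X time_change_unit by simp

lemma h_poincare: "x \<in> S1 \<Longrightarrow> h (A.P x) = B.P (h x)"
  using h_base[of x 1] by (simp add: poincare_map_def)

lemma h_section_continuous: "continuous_map (subtopology X1 S1) (subtopology X2 S2) h"
  using h_cont h_section by (auto simp: continuous_map_in_subtopology continuous_map_from_subtopology)

end

text \<open>
  Every point is \<open>\<Phi>1 (b, p * T b)\<close> with \<open>b\<close> in the section, which settles \<open>h\<close>. As the clock of \<open>b\<close> is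
  surjective, each time \<open>r\<close> has the form that occurs in the rate condition at \<open>b\<close> and \<open>p\<close>, which
  settles \<open>\<sigma>\<close>.
\<close>
lemma flow_morphism_unique:
  assumes "flow_morphism \<Phi>1 X1 S1 \<Phi>2 X2 S2 h \<sigma>" "flow_morphism \<Phi>1 X1 S1 \<Phi>2 X2 S2 h' \<sigma>'"
    and eq: "\<And>x. x \<in> S1 \<Longrightarrow> h x = h' x"
  shows "h = h' \<and> \<sigma> = \<sigma>'"
proof
  interpret M: flow_morphism \<Phi>1 X1 S1 \<Phi>2 X2 S2 h \<sigma> by fact
  interpret N: flow_morphism \<Phi>1 X1 S1 \<Phi>2 X2 S2 h' \<sigma>' by fact
  show "h = h'"
  proof (rule extensionalityI[OF M.h_ext N.h_ext])
    fix z assume "z \<in> topspace X1"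
    note bp = M.A.base_phase[OF this]
    have "h (\<Phi>1 (M.A.base z, M.A.phase z * M.A.T (M.A.base z))) = h' (\<Phi>1 (M.A.base z, M.A.phase z * M.A.T (M.A.base z)))"
      using M.h_base N.h_base bp(1-3) eq by simp
    then show "h z = h' z" using bp(4) by simp
  qed
  show "\<sigma> = \<sigma>'"
  proof (rule extensionalityI[OF M.\<sigma>_ext N.\<sigma>_ext])
    fix w assume "w \<in> topspace X1 \<times> (UNIV :: real set)"
    then obtain z r where w: "w = (z, r)" and z: "z \<in> topspace X1" by auto
    note bp = M.A.base_phase[OF z]
    let ?b = "M.A.base z" and ?p = "M.A.phase z"
    obtain v where v: "r + ?p * M.A.T ?b = M.A.clock ?b v" using M.A.clock_surj[OF bp(1)] by (metis surjD)
    then have r: "r = M.A.clock ?b v - ?p * M.A.T ?b" by simp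
    have "\<sigma> (z, r) = M.B.clock (h ?b) v - ?p * M.B.T (h ?b)"
      using M.rate[OF bp(1-3), of "v - ?p"] bp(4) r by simp
    also have "\<dots> = \<sigma>' (z, r)"
      using N.rate[OF bp(1-3), of "v - ?p"] bp(1,4) r eq by simp
    finally show "\<sigma> w = \<sigma>' w" using w by simp
  qed
qed

section \<open>The two categories and the first return functor\<close>

lemma Map_simps [simp]:
  "Obj Map = map_objects" "Hom Map = map_hom"
  "Comp Map (f, X) B D k h = restrict (k \<circ> h) (topspace X)"
  "Ident Map (f, X) = restrict id (topspace X)"
  by (simp_all add: Map_def)

lemma RWFlowGS_simps [simp]:
  "Obj RWFlowGS = flow_objects" "Hom RWFlowGS = flow_hom"
  "Comp RWFlowGS (\<Phi>, X, S) B D (h2, \<tau>2) (h1, \<tau>1) =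
     (restrict (h2 \<circ> h1) (topspace X), restrict (\<lambda>(x, t). \<tau>2 (h1 x, \<tau>1 (x, t))) (topspace X \<times> UNIV))"
  "Ident RWFlowGS (\<Phi>, X, S) = (restrict id (topspace X), restrict snd (topspace X \<times> UNIV))"
  by (simp_all add: RWFlowGS_def)

lemma map_homD:
  assumes "h \<in> map_hom (f, X) (g, Y)"
  shows "h \<in> extensional (topspace X)" "continuous_map X Y h"
    "\<And>x. x \<in> topspace X \<Longrightarrow> h x \<in> topspace Y" "\<And>x. x \<in> topspace X \<Longrightarrow> h (f x) = g (h x)"
  using assms continuous_map_funspace[of X Y h] by (auto simp: map_hom_def)

lemma map_objectsD:
  assumes "(f, X) \<in> map_objects"
  shows "homeomorphic_map X X f" "\<And>x. x \<in> topspace X \<Longrightarrow> f x \<in> topspace X"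
proof -
  show f: "homeomorphic_map X X f" using assms by (simp add: map_objects_def)
  show "f x \<in> topspace X" if "x \<in> topspace X" for x
    using homeomorphic_imp_surjective_map[OF f] that by blast
qed

lemma Map_category: "is_category Map"
  unfolding is_category_def Map_simps
proof (intro conjI ballI)
  fix A :: "'a map_obj" assume A: "A \<in> map_objects"
  obtain f X where [simp]: "A = (f, X)" by (cases A)
  show "Ident Map A \<in> map_hom A A"
    using map_objectsD[of f X] A
    by (auto simp: map_hom_def intro: continuous_map_eq[OF continuous_map_id])
next
  fix A B D :: "'a map_obj" and h k assume ob: "A \<in> map_objects" and h: "h \<in> map_hom A B" and k: "k \<in> map_hom B D"
  obtain f X g Y l Z where [simp]: "A = (f, X)" "B = (g, Y)" "D = (l, Z)" by (cases A, cases B, cases D)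
  note H = map_homD[OF h[simplified]] and K = map_homD[OF k[simplified]]
  have "continuous_map X Z (restrict (k \<circ> h) (topspace X))"
    by (rule continuous_map_eq[OF continuous_map_compose[OF H(2) K(2)]]) simp
  then show "Comp Map A B D k h \<in> map_hom A D"
    using H K map_objectsD[of f X] ob by (auto simp: map_hom_def)
next
  fix A B :: "'a map_obj" and h assume h: "h \<in> map_hom A B"
  obtain f X g Y where [simp]: "A = (f, X)" "B = (g, Y)" by (cases A, cases B)
  note H = map_homD[OF h[simplified]]
  show "Comp Map A A B h (Ident Map A) = h" "Comp Map A B B (Ident Map B) h = h"
    using H by (auto simp: fun_eq_iff extensional_def)
next
  fix A B D E :: "'a map_obj" and h k l assume h: "h \<in> map_hom A B"
  obtain f X g Y where [simp]: "A = (f, X)" "B = (g, Y)" by (cases A, cases B)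
  obtain u V where [simp]: "D = (u, V)" by (cases D)
  note H = map_homD[OF h[simplified]]
  show "Comp Map A D E l (Comp Map A B D k h) = Comp Map A B E (Comp Map B D E l k) h"
    using H by (auto simp: fun_eq_iff)
qed

lemma flow_morphismI:
  assumes "(\<Phi>1, X1, S1) \<in> flow_objects" "(\<Phi>2, X2, S2) \<in> flow_objects"
    and "(h, \<sigma>) \<in> flow_hom (\<Phi>1, X1, S1) (\<Phi>2, X2, S2)"
  shows "flow_morphism \<Phi>1 X1 S1 \<Phi>2 X2 S2 h \<sigma>"
  using assms section_flow_if_flow_object
  by (blast intro: flow_morphism.intro flow_morphism_axioms.intro)

lemma flow_ident_hom:
  assumes "(\<Phi>, X, S) \<in> flow_objects"
  shows "(restrict id (topspace X), restrict snd (topspace X \<times> UNIV)) \<in> flow_hom (\<Phi>, X, S) (\<Phi>, X, S)"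
proof -
  interpret section_flow \<Phi> X S using section_flow_if_flow_object[OF assms] .
  have "homeomorphic_map euclideanreal euclideanreal (\<lambda>t. t)"
    using homeomorphic_map_id[of euclideanreal euclideanreal] by (simp add: id_def)
  then show ?thesis
    using S_subset
    by (auto simp: flow_hom_def weak_morphism_def rate_preserving_def flow_in strict_mono_def
        in_X intro: continuous_map_eq[OF continuous_map_id])
qed

text \<open>
  The rate condition composes because \<open>h1\<close> preserves base points and phases: it moves the point with
  base \<open>x\<close> and phase \<open>t\<close> to the one with base \<open>h1 x\<close> and phase \<open>t\<close>, where the rate condition of the
  second morphism applies.
\<close>
lemma flow_comp_hom:
  assumes "flow_morphism \<Phi>1 X1 S1 \<Phi>2 X2 S2 h1 \<sigma>1" "flow_morphism \<Phi>2 X2 S2 \<Phi>3 X3 S3 h2 \<sigma>2"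
  shows "(restrict (h2 \<circ> h1) (topspace X1), restrict (\<lambda>(x, t). \<sigma>2 (h1 x, \<sigma>1 (x, t))) (topspace X1 \<times> UNIV))
    \<in> flow_hom (\<Phi>1, X1, S1) (\<Phi>3, X3, S3)"
proof -
  interpret M: flow_morphism \<Phi>1 X1 S1 \<Phi>2 X2 S2 h1 \<sigma>1 by fact
  interpret N: flow_morphism \<Phi>2 X2 S2 \<Phi>3 X3 S3 h2 \<sigma>2 by fact
  let ?h = "restrict (h2 \<circ> h1) (topspace X1)"
  let ?\<sigma> = "restrict (\<lambda>(x, t). \<sigma>2 (h1 x, \<sigma>1 (x, t))) (topspace X1 \<times> (UNIV :: real set))"
  have "continuous_map X1 X3 ?h"
    by (rule continuous_map_eq[OF continuous_map_compose[OF M.h_cont N.h_cont]]) simp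
  moreover have "strict_mono (\<lambda>t. \<sigma>2 (h1 x, \<sigma>1 (x, t)))" if "x \<in> topspace X1" for x
    using M.time_change(1)[OF that] N.time_change(1)[OF M.h_in[OF that]] by (auto simp: strict_mono_def)
  moreover have "homeomorphic_map euclideanreal euclideanreal (\<lambda>t. \<sigma>2 (h1 x, \<sigma>1 (x, t)))" if "x \<in> topspace X1" for x
    using homeomorphic_map_compose[OF M.time_change(2)[OF that] N.time_change(2)[OF M.h_in[OF that]]] by (simp add: o_def)
  ultimately have "weak_morphism (\<Phi>1, X1) (\<Phi>3, X3) (?h, ?\<sigma>)"
    by (simp add: weak_morphism_def M.A.flow_in M.h_in M.equivariant N.equivariant M.time_change(3) N.time_change(3))
  moreover have "S1 = {x \<in> topspace X1. ?h x \<in> S3}"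
    using M.preimage N.preimage M.h_in by auto
  moreover have "rate_preserving (\<Phi>1, X1, S1) (\<Phi>3, X3, S3) (?h, ?\<sigma>)"
    unfolding rate_preserving_def prod.case flow_clock_def[symmetric]
  proof (intro ballI allI impI)
    fix x s and t :: real assume x: "x \<in> S1" and t: "0 \<le> t \<and> t < 1"
    let ?z = "\<Phi>1 (x, t * M.A.T x)"
    have xX: "x \<in> topspace X1" and z: "?z \<in> topspace X1" using x M.A.in_X M.A.flow_in by auto
    have "?\<sigma> (?z, M.A.clock x (s + t) - t * M.A.T x)
        = \<sigma>2 (h1 ?z, \<sigma>1 (?z, M.A.clock x (s + t) - t * M.A.T x))"
      using z by simp
    also have "\<dots> = \<sigma>2 (\<Phi>2 (h1 x, t * M.B.T (h1 x)), M.B.clock (h1 x) (s + t) - t * M.B.T (h1 x))"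
      using x t by (simp add: M.rate M.h_base)
    also have "\<dots> = N.B.clock (h2 (h1 x)) (s + t) - t * N.B.T (h2 (h1 x))"
      using x t by (simp add: N.rate M.h_section)
    finally show "?\<sigma> (?z, M.A.clock x (s + t) - t * M.A.T x) = N.B.clock (?h x) (s + t) - t * N.B.T (?h x)"
      using xX by simp
  qed
  ultimately show ?thesis by (simp add: flow_hom_def)
qed

lemma RWFlowGS_category: "is_category RWFlowGS"
  unfolding is_category_def RWFlowGS_simps
proof (intro conjI ballI)
  fix A :: "'a flow_obj" assume A: "A \<in> flow_objects"
  obtain \<Phi> X S where [simp]: "A = (\<Phi>, X, S)" by (cases A)
  show "Ident RWFlowGS A \<in> flow_hom A A" using flow_ident_hom[of \<Phi> X S] A by simp
next
  fix A B D :: "'a flow_obj" and m n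
  assume ob: "A \<in> flow_objects" "B \<in> flow_objects" "D \<in> flow_objects" and m: "m \<in> flow_hom A B" and n: "n \<in> flow_hom B D"
  obtain \<Phi>1 X1 S1 \<Phi>2 X2 S2 \<Phi>3 X3 S3 h1 \<sigma>1 h2 \<sigma>2 where
    [simp]: "A = (\<Phi>1, X1, S1)" "B = (\<Phi>2, X2, S2)" "D = (\<Phi>3, X3, S3)" "m = (h1, \<sigma>1)" "n = (h2, \<sigma>2)"
    by (metis surj_pair)
  show "Comp RWFlowGS A B D n m \<in> flow_hom A D"
    using flow_comp_hom[OF flow_morphismI flow_morphismI] ob m n by simp
next
  fix A B :: "'a flow_obj" and m
  assume ob: "A \<in> flow_objects" "B \<in> flow_objects" and m: "m \<in> flow_hom A B"
  obtain \<Phi>1 X1 S1 \<Phi>2 X2 S2 h \<sigma> where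
    [simp]: "A = (\<Phi>1, X1, S1)" "B = (\<Phi>2, X2, S2)" "m = (h, \<sigma>)"
    by (metis surj_pair)
  interpret M: flow_morphism \<Phi>1 X1 S1 \<Phi>2 X2 S2 h \<sigma> using flow_morphismI ob m by simp
  show "Comp RWFlowGS A A B m (Ident RWFlowGS A) = m" "Comp RWFlowGS A B B (Ident RWFlowGS B) m = m"
    using M.h_ext M.\<sigma>_ext M.h_in by (auto simp: fun_eq_iff extensional_def)
next
  fix A B D E :: "'a flow_obj" and m n l :: "'a flow_mor"
  assume ob: "A \<in> flow_objects" "B \<in> flow_objects" and m: "m \<in> flow_hom A B"
  obtain \<Phi>1 X1 S1 \<Phi>2 X2 S2 \<Phi>3 X3 S3 h \<sigma> h' \<sigma>' h'' \<sigma>'' where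
    [simp]: "A = (\<Phi>1, X1, S1)" "B = (\<Phi>2, X2, S2)" "D = (\<Phi>3, X3, S3)" "m = (h, \<sigma>)" "n = (h', \<sigma>')" "l = (h'', \<sigma>'')"
    by (metis surj_pair)
  interpret M: flow_morphism \<Phi>1 X1 S1 \<Phi>2 X2 S2 h \<sigma> using flow_morphismI ob m by simp
  show "Comp RWFlowGS A D E l (Comp RWFlowGS A B D n m) = Comp RWFlowGS A B E (Comp RWFlowGS B D E l n) m"
    using M.h_in by (auto simp: fun_eq_iff)
qed

definition return_functor :: "('a flow_obj, 'a flow_mor, 'a map_obj, 'a \<Rightarrow> 'a) funct" where
  "return_functor =
     \<lparr> omap = (\<lambda>(\<Phi>, X, S). (restrict (poincare_map \<Phi> S) S, subtopology X S)),
       amap = (\<lambda>(\<Phi>, X, S) B m. restrict (fst m) S) \<rparr>"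

lemma return_functor_simps [simp]:
  "omap return_functor (\<Phi>, X, S) = (restrict (poincare_map \<Phi> S) S, subtopology X S)"
  "amap return_functor (\<Phi>, X, S) B m = restrict (fst m) S"
  by (simp_all add: return_functor_def)

lemma return_functor_object:
  assumes "(\<Phi>, X, S) \<in> flow_objects"
  shows "(restrict (poincare_map \<Phi> S) S, subtopology X S) \<in> map_objects"
proof -
  interpret section_flow \<Phi> X S using section_flow_if_flow_object[OF assms] .
  obtain n where "topological_manifold (n - 1) (subtopology X S)"
    using assms by (auto simp: flow_objects_def global_section_def topologically_transversal_def codim_one_submanifold_def)
  moreover have "homeomorphic_map (subtopology X S) (subtopology X S) (restrict (poincare_map \<Phi> S) S)"
    by (rule homeomorphic_map_eq[OF poincare_homeomorphic]) auto
  ultimately show ?thesis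
    by (auto simp: map_objects_def simp del: topspace_subtopology simp add: topspace_S)
qed

lemma return_functor: "is_functor RWFlowGS Map return_functor"
  unfolding is_functor_def RWFlowGS_simps Map_simps
proof (intro conjI ballI)
  fix A :: "'a flow_obj" assume A: "A \<in> flow_objects"
  obtain \<Phi> X S where [simp]: "A = (\<Phi>, X, S)" by (cases A)
  show "omap return_functor A \<in> map_objects" using return_functor_object A by simp
  interpret section_flow \<Phi> X S using section_flow_if_flow_object A by simp
  show "amap return_functor A A (Ident RWFlowGS A) = Ident Map (omap return_functor A)"
    using in_X by (auto simp: fun_eq_iff)
next
  fix A B :: "'a flow_obj" and m
  assume ob: "A \<in> flow_objects" "B \<in> flow_objects" and m: "m \<in> flow_hom A B"
  obtain \<Phi>1 X1 S1 \<Phi>2 X2 S2 h \<sigma> where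
    [simp]: "A = (\<Phi>1, X1, S1)" "B = (\<Phi>2, X2, S2)" "m = (h, \<sigma>)"
    by (metis surj_pair)
  interpret M: flow_morphism \<Phi>1 X1 S1 \<Phi>2 X2 S2 h \<sigma> using flow_morphismI ob m by simp
  have "continuous_map (subtopology X1 S1) (subtopology X2 S2) (restrict h S1)"
    by (rule continuous_map_eq[OF M.h_section_continuous]) (simp add: M.A.in_X)
  then show "amap return_functor A B m \<in> map_hom (omap return_functor A) (omap return_functor B)"
    using M.A.topspace_S M.A.poincare_in M.h_poincare M.h_section
    by (simp add: map_hom_def)
next
  fix A B E :: "'a flow_obj" and m n :: "'a flow_mor"
  assume ob: "A \<in> flow_objects" "B \<in> flow_objects" and m: "m \<in> flow_hom A B"
  obtain \<Phi>1 X1 S1 \<Phi>2 X2 S2 \<Phi>3 X3 S3 h \<sigma> h' \<sigma>' where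
    [simp]: "A = (\<Phi>1, X1, S1)" "B = (\<Phi>2, X2, S2)" "E = (\<Phi>3, X3, S3)" "m = (h, \<sigma>)" "n = (h', \<sigma>')"
    by (metis surj_pair)
  interpret M: flow_morphism \<Phi>1 X1 S1 \<Phi>2 X2 S2 h \<sigma> using flow_morphismI ob m by simp
  show "amap return_functor A E (Comp RWFlowGS A B E n m) =
        Comp Map (omap return_functor A) (omap return_functor B) (omap return_functor E)
          (amap return_functor B E n) (amap return_functor A B m)"
    using M.A.in_X M.h_section by (auto simp: fun_eq_iff)
qed

lemma return_functor_faithful:
  assumes ob: "A \<in> flow_objects" "B \<in> flow_objects" and m: "m \<in> flow_hom A B" and n: "n \<in> flow_hom A B"
    and eq: "amap return_functor A B m = amap return_functor A B n"
  shows "m = n"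
proof -
  obtain \<Phi>1 X1 S1 \<Phi>2 X2 S2 h \<sigma> h' \<sigma>' where
    [simp]: "A = (\<Phi>1, X1, S1)" "B = (\<Phi>2, X2, S2)" "m = (h, \<sigma>)" "n = (h', \<sigma>')"
    by (metis surj_pair)
  have "h x = h' x" if "x \<in> S1" for x
    using fun_cong[OF eq, of x] that by simp
  moreover have "flow_morphism \<Phi>1 X1 S1 \<Phi>2 X2 S2 h \<sigma>" "flow_morphism \<Phi>1 X1 S1 \<Phi>2 X2 S2 h' \<sigma>'"
    using flow_morphismI ob m n by simp_all
  ultimately show ?thesis
    using flow_morphism_unique[of \<Phi>1 X1 S1 \<Phi>2 X2 S2 h \<sigma> h' \<sigma>'] by simp
qed

lemma return_functor_full:
  assumes ob: "A \<in> flow_objects" "B \<in> flow_objects"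
    and k: "k \<in> map_hom (omap return_functor A) (omap return_functor B)"
  shows "\<exists>m\<in>flow_hom A B. amap return_functor A B m = k"
proof -
  obtain \<Phi>1 X1 S1 \<Phi>2 X2 S2 where [simp]: "A = (\<Phi>1, X1, S1)" "B = (\<Phi>2, X2, S2)"
    by (metis surj_pair)
  interpret A: section_flow \<Phi>1 X1 S1 using section_flow_if_flow_object ob by simp
  interpret B: section_flow \<Phi>2 X2 S2 using section_flow_if_flow_object ob by simp
  note K = map_homD[OF k[simplified], unfolded A.topspace_S B.topspace_S]
  interpret section_conjugacy \<Phi>1 X1 S1 \<Phi>2 X2 S2 k
    using K by unfold_locales simp_all
  have "restrict extend_map S1 = k"
    using K(1) extend_map_on_section by (auto simp: fun_eq_iff extensional_def)
  then show ?thesis using extend_hom by (intro bexI[of _ "(extend_map, extend_time)"]) simp_all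
qed

section \<open>Manifolds and charts\<close>

lemma second_countable_euclideanreal: "second_countable euclideanreal"
proof -
  obtain B :: "real set set" where "countable B" "\<And>C. C \<in> B \<Longrightarrow> open C" "\<And>S. open S \<Longrightarrow> \<exists>U. U \<subseteq> B \<and> S = \<Union>U"
    using univ_second_countable by blast
  then show ?thesis
    unfolding second_countable_def
    by (intro exI[of _ B]) (simp, metis Union_iff Union_upper subsetD)
qed

lemma second_countable_prod_topology:
  assumes "second_countable X" "second_countable Y"
  shows "second_countable (prod_topology X Y)"
proof -
  obtain B where B: "countable B" "\<forall>V\<in>B. openin X V" "\<forall>U x. openin X U \<and> x \<in> U \<longrightarrow> (\<exists>V\<in>B. x \<in> V \<and> V \<subseteq> U)"
    using assms(1) by (auto simp: second_countable_def)
  obtain C where C: "countable C" "\<forall>V\<in>C. openin Y V" "\<forall>U x. openin Y U \<and> x \<in> U \<longrightarrow> (\<exists>V\<in>C. x \<in> V \<and> V \<subseteq> U)"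
    using assms(2) by (auto simp: second_countable_def)
  let ?D = "(\<lambda>(U, V). U \<times> V) ` (B \<times> C)"
  show ?thesis
    unfolding second_countable_def
  proof (intro exI[of _ ?D] conjI allI impI)
    show "countable ?D" using B(1) C(1) by blast
    show "\<forall>V\<in>?D. openin (prod_topology X Y) V" using B(2) C(2) by (auto simp: openin_prod_Times_iff)
    fix W p assume W: "openin (prod_topology X Y) W \<and> p \<in> W"
    obtain x y where p: "p = (x, y)" by (cases p)
    obtain U V where UV: "openin X U" "openin Y V" "x \<in> U" "y \<in> V" "U \<times> V \<subseteq> W"
      using W unfolding openin_prod_topology_alt p by blast
    obtain U' where U': "U' \<in> B" "x \<in> U'" "U' \<subseteq> U" using B(3) UV(1,3) by blast
    obtain V' where V': "V' \<in> C" "y \<in> V'" "V' \<subseteq> V" using C(3) UV(2,4) by blast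
    show "\<exists>Z\<in>?D. p \<in> Z \<and> Z \<subseteq> W"
      using U' V' UV(5) p by (intro bexI[of _ "U' \<times> V'"]) auto
  qed
qed

lemma topological_manifold_homeomorphic:
  assumes man: "topological_manifold n X" and hom: "homeomorphic_map X Y f"
  shows "topological_manifold n Y"
  unfolding topological_manifold_def
proof (intro conjI ballI)
  have XY: "X homeomorphic_space Y" using hom homeomorphic_map_imp_homeomorphic_space by blast
  show "second_countable Y"
    using man homeomorphic_space_second_countability[OF XY] by (simp add: topological_manifold_def)
  show "Hausdorff_space Y"
    using man homeomorphic_Hausdorff_space[OF XY] by (simp add: topological_manifold_def)
  fix y assume "y \<in> topspace Y"
  then obtain x where x: "x \<in> topspace X" "y = f x"
    using homeomorphic_imp_surjective_map[OF hom] by blast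
  obtain U V where U: "openin X U" "x \<in> U" "openin (Euclidean_space n) V"
    "subtopology X U homeomorphic_space subtopology (Euclidean_space n) V"
    using man x(1) by (auto simp: topological_manifold_def)
  have "openin Y (f ` U)"
    using homeomorphic_map_openness_eq[OF hom] U(1) by blast
  moreover have "homeomorphic_map (subtopology X U) (subtopology Y (f ` U)) f"
    using hom openin_subset[OF U(1)] homeomorphic_imp_surjective_map[OF hom]
    by (intro homeomorphic_map_subtopologies) auto
  then have "subtopology Y (f ` U) homeomorphic_space subtopology (Euclidean_space n) V"
    using U(4) homeomorphic_map_imp_homeomorphic_space homeomorphic_space_sym homeomorphic_space_trans by blast
  ultimately show "\<exists>U V. openin Y U \<and> y \<in> U \<and> openin (Euclidean_space n) V \<and>
        subtopology Y U homeomorphic_space subtopology (Euclidean_space n) V"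
    using U(2,3) x(2) by blast
qed

lemma unit_ball_subset: "unit_ball n \<subseteq> topspace (Euclidean_space n)"
  by (auto simp: unit_ball_def)

lemma Euclidean_coordinate_continuous: "continuous_map (Euclidean_space n) euclideanreal (\<lambda>v. v i)"
  unfolding Euclidean_space_def
  by (intro continuous_map_from_subtopology continuous_map_product_projection) simp

lemma openin_unit_ball: "openin (Euclidean_space n) (unit_ball n)"
proof -
  have "continuous_map (Euclidean_space n) euclideanreal (\<lambda>v. \<Sum>i<n. (v i)\<^sup>2)"
    by (intro continuous_map_sum continuous_map_real_pow Euclidean_coordinate_continuous) simp
  then have "openin (Euclidean_space n) {v \<in> topspace (Euclidean_space n). (\<Sum>i<n. (v i)\<^sup>2) \<in> {..<1}}"
    by (rule openin_continuous_map_preimage) simp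
  then show ?thesis by (simp add: unit_ball_def)
qed

lemma continuous_map_into_Euclidean_space:
  assumes "\<And>i. i < n \<Longrightarrow> continuous_map X euclideanreal (\<lambda>x. f x i)" "\<And>x i. x \<in> topspace X \<Longrightarrow> n \<le> i \<Longrightarrow> f x i = 0"
  shows "continuous_map X (Euclidean_space n) f"
proof (rule continuous_map_eq)
  show "continuous_map X (Euclidean_space n) (\<lambda>x i. if i < n then f x i else 0)"
    using assms(1) by (simp add: continuous_map_componentwise_Euclidean_space)
qed (use assms(2) in \<open>auto simp: fun_eq_iff\<close>)

lemma openin_Euclidean_space_contains_ball:
  assumes V: "openin (Euclidean_space n) V" and a: "a \<in> V"
  obtains r where "0 < r" "\<And>v. v \<in> topspace (Euclidean_space n) \<Longrightarrow> (\<Sum>i<n. (v i - a i)\<^sup>2) < r\<^sup>2 \<Longrightarrow> v \<in> V"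
proof -
  obtain W where W: "openin (powertop_real UNIV) W" "V = W \<inter> {x. \<forall>i\<ge>n. x i = 0}"
    using V by (auto simp: Euclidean_space_def openin_subtopology)
  then obtain U where U: "finite {i. U i \<noteq> UNIV}" "\<And>i. open (U i)" "a \<in> Pi\<^sub>E UNIV U" "Pi\<^sub>E UNIV U \<subseteq> W"
    using a unfolding openin_product_topology_alt by auto
  have "\<exists>r>0. \<forall>y. \<bar>y - a i\<bar> < r \<longrightarrow> y \<in> U i" for i
    using U(2)[of i] U(3) unfolding open_dist dist_real_def by (auto simp: PiE_iff)
  then obtain r where r: "\<And>i. 0 < r i" "\<And>i y. \<bar>y - a i\<bar> < r i \<Longrightarrow> y \<in> U i" by metis
  define \<rho> where "\<rho> = Min (insert 1 (r ` {..<n}))"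
  have \<rho>: "0 < \<rho>" using r(1) by (simp add: \<rho>_def)
  have "v \<in> V" if v: "v \<in> topspace (Euclidean_space n)" "(\<Sum>i<n. (v i - a i)\<^sup>2) < \<rho>\<^sup>2" for v
  proof -
    have "v i \<in> U i" for i
    proof (cases "i < n")
      case True
      have "(v i - a i)\<^sup>2 \<le> (\<Sum>i<n. (v i - a i)\<^sup>2)" using True by (intro member_le_sum) auto
      then have "(v i - a i)\<^sup>2 < \<rho>\<^sup>2" using v(2) by simp
      then have "\<bar>v i - a i\<bar> < \<rho>" using \<rho> by (metis abs_of_pos power2_less_imp_less power2_abs less_imp_le)
      moreover have "\<rho> \<le> r i" using True by (auto simp: \<rho>_def intro!: Min_le)
      ultimately show ?thesis using r(2)[of "v i" i] by simp
    next
      case False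
      then have "v i = a i" using v(1) a W(2) by (simp add: topspace_Euclidean_space)
      then show ?thesis using U(3) by (simp add: PiE_iff)
    qed
    then show ?thesis using U(4) W(2) v(1) by (auto simp: topspace_Euclidean_space)
  qed
  then show ?thesis using that \<rho> by blast
qed

text \<open>
  Shrink the domain of a chart until its image is a round ball around the image of \<open>x\<close>, then apply the
  affine map that takes this ball to the unit ball.
\<close>
lemma manifold_unit_ball_chart:
  assumes man: "topological_manifold n X" and x: "x \<in> topspace X"
  obtains U \<phi> where "openin X U" "x \<in> U"
    "homeomorphic_map (subtopology X U) (subtopology (Euclidean_space n) (unit_ball n)) \<phi>" "\<phi> x = (\<lambda>i. 0)"
proof -
  obtain U0 V0 where U0: "openin X U0" "x \<in> U0" "openin (Euclidean_space n) V0"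
    "subtopology X U0 homeomorphic_space subtopology (Euclidean_space n) V0"
    using man x by (auto simp: topological_manifold_def)
  then obtain \<phi>0 where \<phi>0: "homeomorphic_map (subtopology X U0) (subtopology (Euclidean_space n) V0) \<phi>0"
    using homeomorphic_space by blast
  have U0X: "U0 \<subseteq> topspace X" using U0(1) openin_subset by blast
  have V0E: "V0 \<subseteq> topspace (Euclidean_space n)" using U0(3) openin_subset by blast
  have im0: "\<phi>0 ` U0 = V0"
    using homeomorphic_imp_surjective_map[OF \<phi>0] U0X V0E by (simp add: Int_absorb1)
  define a where "a = \<phi>0 x"
  have a: "a \<in> V0" "a \<in> topspace (Euclidean_space n)" using im0 U0(2) V0E by (auto simp: a_def)
  obtain r where r: "0 < r" "\<And>v. v \<in> topspace (Euclidean_space n) \<Longrightarrow> (\<Sum>i<n. (v i - a i)\<^sup>2) < r\<^sup>2 \<Longrightarrow> v \<in> V0"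
    by (rule openin_Euclidean_space_contains_ball[OF U0(3) a(1)]) blast
  define \<alpha> where "\<alpha> = (\<lambda>v::nat \<Rightarrow> real. \<lambda>i. (v i - a i) / r)"
  define \<beta> where "\<beta> = (\<lambda>v::nat \<Rightarrow> real. \<lambda>i. r * v i + a i)"
  have a0: "a i = 0" if "n \<le> i" for i using a(2) that by (simp add: topspace_Euclidean_space)
  have "homeomorphic_maps (Euclidean_space n) (Euclidean_space n) \<alpha> \<beta>"
    unfolding homeomorphic_maps_def
  proof (intro conjI ballI)
    show "continuous_map (Euclidean_space n) (Euclidean_space n) \<alpha>"
      unfolding \<alpha>_def using r(1) a0
      by (intro continuous_map_into_Euclidean_space continuous_map_real_divide continuous_map_diff Euclidean_coordinate_continuous)
        (auto simp: topspace_Euclidean_space)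
    show "continuous_map (Euclidean_space n) (Euclidean_space n) \<beta>"
      unfolding \<beta>_def using a0
      by (intro continuous_map_into_Euclidean_space continuous_map_real_mult continuous_map_add Euclidean_coordinate_continuous)
        (auto simp: topspace_Euclidean_space)
  qed (use r(1) in \<open>auto simp: \<alpha>_def \<beta>_def\<close>)
  then have \<alpha>: "homeomorphic_map (Euclidean_space n) (Euclidean_space n) \<alpha>" by (rule homeomorphic_maps_imp_map)
  have \<alpha>_ball: "\<alpha> v \<in> unit_ball n \<longleftrightarrow> (\<Sum>i<n. (v i - a i)\<^sup>2) < r\<^sup>2" if "v \<in> topspace (Euclidean_space n)" for v
  proof -
    have "\<alpha> v \<in> topspace (Euclidean_space n)" using that a0 by (auto simp: \<alpha>_def topspace_Euclidean_space)
    moreover have "(\<Sum>i<n. (\<alpha> v i)\<^sup>2) = (\<Sum>i<n. (v i - a i)\<^sup>2) / r\<^sup>2"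
      by (simp add: \<alpha>_def power_divide sum_divide_distrib)
    ultimately show ?thesis using r(1) by (simp add: unit_ball_def)
  qed
  define B where "B = {v \<in> V0. \<alpha> v \<in> unit_ball n}"
  have B: "homeomorphic_map (subtopology (Euclidean_space n) B) (subtopology (Euclidean_space n) (unit_ball n)) \<alpha>"
    using \<alpha>_ball r(2) by (intro homeomorphic_map_subtopologies_alt[OF \<alpha>]) (auto simp: B_def)
  define U where "U = {y \<in> U0. \<phi>0 y \<in> B}"
  have "homeomorphic_map (subtopology (subtopology X U0) U) (subtopology (subtopology (Euclidean_space n) V0) B) \<phi>0"
    by (rule homeomorphic_map_subtopologies_alt[OF \<phi>0]) (auto simp: U_def)
  moreover have "U0 \<inter> U = U" "V0 \<inter> B = B" by (auto simp: U_def B_def)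
  ultimately have "homeomorphic_map (subtopology X U) (subtopology (Euclidean_space n) B) \<phi>0"
    by (simp add: subtopology_subtopology)
  then have \<phi>: "homeomorphic_map (subtopology X U) (subtopology (Euclidean_space n) (unit_ball n)) (\<alpha> \<circ> \<phi>0)"
    using B by (rule homeomorphic_map_compose)
  have "openin (Euclidean_space n) {v \<in> topspace (Euclidean_space n). \<alpha> v \<in> unit_ball n}"
    by (rule openin_continuous_map_preimage[OF homeomorphic_imp_continuous_map[OF \<alpha>] openin_unit_ball])
  then have "openin (Euclidean_space n) (V0 \<inter> {v \<in> topspace (Euclidean_space n). \<alpha> v \<in> unit_ball n})"
    using U0(3) by (rule openin_Int[rotated])
  moreover have "V0 \<inter> {v \<in> topspace (Euclidean_space n). \<alpha> v \<in> unit_ball n} = B" using V0E by (auto simp: B_def)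
  ultimately have "openin (subtopology (Euclidean_space n) V0) B"
    using openin_subtopology_Int2[of "Euclidean_space n" B V0] by (simp add: \<open>V0 \<inter> B = B\<close>)
  then have "openin (subtopology X U0) {y \<in> topspace (subtopology X U0). \<phi>0 y \<in> B}"
    using homeomorphic_imp_continuous_map[OF \<phi>0] openin_continuous_map_preimage by blast
  moreover have "{y \<in> topspace (subtopology X U0). \<phi>0 y \<in> B} = U" using U0X by (auto simp: U_def)
  ultimately have "openin X U" using U0(1) openin_trans_full by metis
  moreover have "\<alpha> a \<in> unit_ball n" using \<alpha>_ball[OF a(2)] r(1) by simp
  then have "x \<in> U" using U0(2) a(1) by (simp add: U_def B_def flip: a_def)
  moreover have "(\<alpha> \<circ> \<phi>0) x = (\<lambda>i. 0)" by (simp add: \<alpha>_def a_def)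
  ultimately show ?thesis using that \<phi> by blast
qed

text \<open>
  The product of a ball chart with the line is a chart onto a cylinder, and \<open>W\<close> is the part of its
  domain that is mapped into the round ball inside the cylinder. The factor \<open>3\<close> keeps the
  line coordinate within \<open>1 / 3\<close> of \<open>s\<close>, so that \<open>W\<close> is thinner than one period of the suspension.
\<close>
lemma product_with_line_chart:
  fixes s :: real
  assumes U: "openin X U" and x: "x \<in> U" and \<phi>x: "\<phi> x = (\<lambda>i. 0)"
    and \<phi>: "homeomorphic_map (subtopology X U) (subtopology (Euclidean_space n) (unit_ball n)) \<phi>"
  defines "\<theta> \<equiv> (\<lambda>(y, t). \<lambda>i. if i < n then \<phi> y i else if i = n then 3 * (t - s) else (0::real))"
  obtains W where "openin (prod_topology X euclideanreal) W"
    "homeomorphic_map (subtopology (prod_topology X euclideanreal) W) (subtopology (Euclidean_space (Suc n)) (unit_ball (Suc n))) \<theta>"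
    "\<And>t. \<bar>t - s\<bar> < 1 / 3 \<Longrightarrow> (x, t) \<in> W" "\<And>y t. (y, t) \<in> W \<Longrightarrow> y \<in> topspace X \<and> \<bar>t - s\<bar> < 1 / 3"
proof -
  let ?XR = "prod_topology X euclideanreal" and ?E = "Euclidean_space n" and ?E' = "Euclidean_space (Suc n)"
  have UX: "U \<subseteq> topspace X" using U openin_subset by blast
  let ?B = "subtopology ?E (unit_ball n)"
  \<comment> \<open>The identification of \<open>\<real>\<^sup>n \<times> \<real>\<close> with \<open>\<real>\<^sup>n\<^sup>+\<^sup>1\<close>, shifted and rescaled along the line, with inverse \<open>c'\<close>.\<close>
  define c :: "(nat \<Rightarrow> real) \<times> real \<Rightarrow> nat \<Rightarrow> real"
    where "c = (\<lambda>(v, t). \<lambda>i. if i < n then v i else if i = n then 3 * (t - s) else 0)"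
  define c' :: "(nat \<Rightarrow> real) \<Rightarrow> (nat \<Rightarrow> real) \<times> real"
    where "c' = (\<lambda>v. (\<lambda>i. if i < n then v i else 0, v n / 3 + s))"
  define Z where "Z = {v. fst (c' v) \<in> unit_ball n}"
  have hc: "homeomorphic_maps (prod_topology ?E euclideanreal) ?E' c c'"
    unfolding homeomorphic_maps_def
  proof (intro conjI ballI)
    show "continuous_map (prod_topology ?E euclideanreal) ?E' c"
    proof (rule continuous_map_into_Euclidean_space)
      fix i :: nat assume "i < Suc n"
      show "continuous_map (prod_topology ?E euclideanreal) euclideanreal (\<lambda>p. c p i)"
      proof (cases "i < n")
        case True
        have "continuous_map (prod_topology ?E euclideanreal) euclideanreal (\<lambda>p. fst p i)"
          using continuous_map_compose[OF continuous_map_fst Euclidean_coordinate_continuous] by (simp add: o_def)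
        then show ?thesis using True by (simp add: c_def case_prod_unfold)
      next
        case False
        then have "(\<lambda>p. c p i) = (\<lambda>p. 3 * (snd p - s))" using \<open>i < Suc n\<close> by (auto simp: c_def fun_eq_iff)
        moreover have "continuous_map (prod_topology ?E euclideanreal) euclideanreal (\<lambda>p. 3 * (snd p - s))"
          by (intro continuous_map_real_mult continuous_map_diff continuous_map_snd) simp_all
        ultimately show ?thesis by simp
      qed
    qed (auto simp: c_def)
    show "continuous_map ?E' (prod_topology ?E euclideanreal) c'"
      unfolding c'_def
      by (intro continuous_map_pairedI continuous_map_into_Euclidean_space continuous_map_add
          continuous_map_real_divide Euclidean_coordinate_continuous) (auto intro: Euclidean_coordinate_continuous)
    show "c' (c p) = p" if "p \<in> topspace (prod_topology ?E euclideanreal)" for p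
      using that by (auto simp: c_def c'_def topspace_Euclidean_space fun_eq_iff diff_divide_distrib)
    show "c (c' v) = v" if "v \<in> topspace ?E'" for v
      using that by (auto simp: c_def c'_def topspace_Euclidean_space fun_eq_iff less_Suc_eq)
  qed
  have "homeomorphic_maps (subtopology (prod_topology ?E euclideanreal) (unit_ball n \<times> UNIV)) (subtopology ?E' Z) c c'"
  proof (rule homeomorphic_maps_subtopologies_alt[OF hc])
    show "c ` (topspace (prod_topology ?E euclideanreal) \<inter> unit_ball n \<times> UNIV) \<subseteq> Z"
    proof -
      have "c' (c p) = p" if "p \<in> topspace (prod_topology ?E euclideanreal)" for p
        using hc that unfolding homeomorphic_maps_def by blast
      then show ?thesis by (auto simp: Z_def)
    qed
    show "c' ` (topspace ?E' \<inter> Z) \<subseteq> unit_ball n \<times> UNIV"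
      unfolding image_subset_iff Z_def mem_Times_iff by simp
  qed
  then have hc': "homeomorphic_map (prod_topology ?B euclideanreal) (subtopology ?E' Z) c"
    using homeomorphic_maps_imp_map by (fastforce simp: subtopology_Times)
  obtain \<psi> where "homeomorphic_maps (subtopology X U) ?B \<phi> \<psi>" using \<phi> homeomorphic_map_maps by blast
  then have "homeomorphic_maps (prod_topology (subtopology X U) euclideanreal) (prod_topology ?B euclideanreal)
      (\<lambda>(y, t). (\<phi> y, t)) (\<lambda>(y, t). (\<psi> y, t))"
    using homeomorphic_maps_prod[of "subtopology X U" euclideanreal ?B euclideanreal \<phi> "\<lambda>t. t" \<psi> "\<lambda>t. t"]
    by (simp add: homeomorphic_maps_def)
  then have "homeomorphic_map (prod_topology (subtopology X U) euclideanreal) (subtopology ?E' Z) (c \<circ> (\<lambda>(y, t). (\<phi> y, t)))"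
    using hc' homeomorphic_map_compose homeomorphic_maps_imp_map by blast
  moreover have "c \<circ> (\<lambda>(y, t). (\<phi> y, t)) = \<theta>" by (auto simp: c_def \<theta>_def fun_eq_iff)
  moreover have "prod_topology (subtopology X U) euclideanreal = subtopology ?XR (U \<times> UNIV)"
    by (simp add: subtopology_Times)
  ultimately have \<theta>: "homeomorphic_map (subtopology ?XR (U \<times> UNIV)) (subtopology ?E' Z) \<theta>" by simp
  have tU: "topspace (subtopology ?XR (U \<times> UNIV)) = U \<times> UNIV" using UX by auto
  define W where "W = {p \<in> U \<times> UNIV. \<theta> p \<in> unit_ball (Suc n)}"
  have ballZ: "unit_ball (Suc n) \<subseteq> Z"
  proof
    fix v assume v: "v \<in> unit_ball (Suc n)"
    then have "(\<Sum>i<n. (v i)\<^sup>2) + (v n)\<^sup>2 < 1" by (simp add: unit_ball_def)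
    moreover have "0 \<le> (v n)\<^sup>2" by simp
    ultimately have "(\<Sum>i<n. (v i)\<^sup>2) < 1" by linarith
    then show "v \<in> Z" by (simp add: Z_def c'_def unit_ball_def topspace_Euclidean_space)
  qed
  have "homeomorphic_map (subtopology (subtopology ?XR (U \<times> UNIV)) W) (subtopology (subtopology ?E' Z) (unit_ball (Suc n))) \<theta>"
    by (rule homeomorphic_map_subtopologies_alt[OF \<theta>]) (auto simp: W_def)
  moreover have "(U \<times> UNIV) \<inter> W = W" "Z \<inter> unit_ball (Suc n) = unit_ball (Suc n)" using ballZ by (auto simp: W_def)
  ultimately have homW: "homeomorphic_map (subtopology ?XR W) (subtopology ?E' (unit_ball (Suc n))) \<theta>"
    by (simp add: subtopology_subtopology)
  have "openin (subtopology ?E' Z) (unit_ball (Suc n))"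
    using openin_subtopology_Int2[OF openin_unit_ball, of "Suc n" Z] ballZ by (simp add: Int_absorb1)
  then have "openin (subtopology ?XR (U \<times> UNIV)) {p \<in> topspace (subtopology ?XR (U \<times> UNIV)). \<theta> p \<in> unit_ball (Suc n)}"
    using homeomorphic_imp_continuous_map[OF \<theta>] openin_continuous_map_preimage by blast
  then have "openin (subtopology ?XR (U \<times> UNIV)) W" unfolding tU W_def .
  moreover have "openin ?XR (U \<times> UNIV)" using U by (simp add: openin_prod_Times_iff)
  ultimately have W: "openin ?XR W" using openin_trans_full by blast
  have xW: "(x, t) \<in> W" if "\<bar>t - s\<bar> < 1 / 3" for t
  proof -
    have "\<bar>3 * (t - s)\<bar> < 1" using that by argo
    then have "(3 * (t - s))\<^sup>2 < 1" by (simp only: abs_square_less_1)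
    then show ?thesis using x \<phi>x by (simp add: W_def \<theta>_def unit_ball_def topspace_Euclidean_space)
  qed
  have "y \<in> topspace X \<and> \<bar>t - s\<bar> < 1 / 3" if "(y, t) \<in> W" for y t
  proof -
    have "\<theta> (y, t) \<in> unit_ball (Suc n)" using that by (simp add: W_def)
    then have "(\<Sum>i<n. (\<phi> y i)\<^sup>2) + (3 * (t - s))\<^sup>2 < 1" by (simp add: unit_ball_def \<theta>_def)
    moreover have "0 \<le> (\<Sum>i<n. (\<phi> y i)\<^sup>2)" by (intro sum_nonneg) simp
    ultimately have "(3 * (t - s))\<^sup>2 < 1" by linarith
    then have "\<bar>3 * (t - s)\<bar> < 1" by (simp only: abs_square_less_1)
    then have "\<bar>t - s\<bar> < 1 / 3" by argo
    then show ?thesis using that UX by (auto simp: W_def)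
  qed
  then show ?thesis using that[OF W homW xW] by blast
qed

section \<open>The suspension of a homeomorphism\<close>

definition quotient_topology :: "'a topology \<Rightarrow> ('a \<Rightarrow> 'b) \<Rightarrow> 'b topology" where
  "quotient_topology X q = topology (\<lambda>U. U \<subseteq> q ` topspace X \<and> openin X {x \<in> topspace X. q x \<in> U})"

lemma openin_quotient_topology:
  "openin (quotient_topology X q) U \<longleftrightarrow> U \<subseteq> q ` topspace X \<and> openin X {x \<in> topspace X. q x \<in> U}"
proof -
  have "istopology (\<lambda>U. U \<subseteq> q ` topspace X \<and> openin X {x \<in> topspace X. q x \<in> U})"
    unfolding istopology_def
  proof (intro conjI allI impI)
    fix U V assume "U \<subseteq> q ` topspace X \<and> openin X {x \<in> topspace X. q x \<in> U}"
      "V \<subseteq> q ` topspace X \<and> openin X {x \<in> topspace X. q x \<in> V}"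
    moreover have "{x \<in> topspace X. q x \<in> U \<inter> V} = {x \<in> topspace X. q x \<in> U} \<inter> {x \<in> topspace X. q x \<in> V}" by blast
    ultimately show "U \<inter> V \<subseteq> q ` topspace X" "openin X {x \<in> topspace X. q x \<in> U \<inter> V}" by auto
  next
    fix K assume K: "\<forall>U\<in>K. U \<subseteq> q ` topspace X \<and> openin X {x \<in> topspace X. q x \<in> U}"
    have "{x \<in> topspace X. q x \<in> \<Union>K} = (\<Union>U\<in>K. {x \<in> topspace X. q x \<in> U})" by blast
    then show "\<Union>K \<subseteq> q ` topspace X" "openin X {x \<in> topspace X. q x \<in> \<Union>K}"
      using K by auto
  qed
  then show ?thesis unfolding quotient_topology_def by (simp add: topology_inverse')
qed

lemma topspace_quotient_topology: "topspace (quotient_topology X q) = q ` topspace X"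
proof
  show "topspace (quotient_topology X q) \<subseteq> q ` topspace X"
    using openin_topspace[of "quotient_topology X q"] unfolding openin_quotient_topology by blast
  have "{x \<in> topspace X. q x \<in> q ` topspace X} = topspace X" by blast
  then have "openin (quotient_topology X q) (q ` topspace X)"
    by (simp add: openin_quotient_topology)
  then show "q ` topspace X \<subseteq> topspace (quotient_topology X q)" by (rule openin_subset)
qed

lemma quotient_map_quotient_topology: "quotient_map X (quotient_topology X q) q"
  by (auto simp: quotient_map_def topspace_quotient_topology openin_quotient_topology)

text \<open>
  The injection \<open>j\<close> places the quotient inside a given type: the class of \<open>(x, t)\<close> under
  \<open>(x, t) \<sim> (f x, t - 1)\<close> is encoded by its representative whose second coordinate lies in \<open>[0, 1)\<close>.
\<close>
locale suspension =
  fixes f :: "'a \<Rightarrow> 'a" and X :: "'a topology" and n :: nat and j :: "'a \<times> real \<Rightarrow> 'b"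
  assumes hom: "homeomorphic_map X X f" and man: "topological_manifold n X" and inj_j: "inj j"
begin

abbreviation pow :: "int \<Rightarrow> 'a \<Rightarrow> 'a" where "pow \<equiv> int_iterate f (topspace X)"

lemma f_bij: "bij_betw f (topspace X) (topspace X)"
  using hom by (simp add: homeomorphic_eq_everything_map bij_betw_def)

lemma pow_1 [simp]: "pow 1 x = f x"
  by (simp add: int_iterate_def)

lemma pow_in: "x \<in> topspace X \<Longrightarrow> pow i x \<in> topspace X"
  by (rule int_iterate_in[OF f_bij])

lemma pow_Suc: "x \<in> topspace X \<Longrightarrow> pow (i + 1) x = f (pow i x)"
  by (rule int_iterate_Suc[OF f_bij])

lemma pow_add: "x \<in> topspace X \<Longrightarrow> pow (i + m) x = pow i (pow m x)"
proof (induction i rule: int_induct[where k = 0])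
  case base
  then show ?case by simp
next
  case (step1 i)
  then show ?case using pow_Suc[of x "i + m"] pow_Suc[of "pow m x" i] by (simp add: pow_in ac_simps)
next
  case (step2 i)
  have "f (pow (i - 1 + m) x) = f (pow (i - 1) (pow m x))"
    using step2 pow_Suc[of x "i - 1 + m"] pow_Suc[of "pow m x" "i - 1"] by (simp add: pow_in algebra_simps)
  then show ?case using f_bij step2(3) by (auto simp: bij_betw_def pow_in dest: inj_onD)
qed

lemma pow_continuous: "continuous_map X X (pow i)"
proof (induction i rule: int_induct[where k = 0])
  case base
  then show ?case by (rule continuous_map_eq[OF continuous_map_id]) simp
next
  case (step1 i)
  have "continuous_map X X (f \<circ> pow i)"
    using step1(2) homeomorphic_imp_continuous_map[OF hom] by (rule continuous_map_compose)
  then show ?case by (rule continuous_map_eq) (simp add: pow_Suc)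
next
  case (step2 i)
  obtain g where g: "homeomorphic_maps X X f g" using hom homeomorphic_map_maps by blast
  then have "continuous_map X X (g \<circ> pow i)"
    using step2(2) by (auto simp: homeomorphic_maps_def intro: continuous_map_compose)
  then show ?case
  proof (rule continuous_map_eq)
    fix x assume x: "x \<in> topspace X"
    then show "(g \<circ> pow i) x = pow (i - 1) x"
      using pow_Suc[OF x, of "i - 1"] g pow_in[OF x] by (simp add: homeomorphic_maps_def)
  qed
qed

abbreviation "XR \<equiv> prod_topology X euclideanreal"

definition q :: "'a \<times> real \<Rightarrow> 'b" where
  "q p = j (pow \<lfloor>snd p\<rfloor> (fst p), frac (snd p))"

definition M :: "'b topology" where
  "M = quotient_topology XR q"

definition \<Phi> :: "'b \<times> real \<Rightarrow> 'b" where
  "\<Phi> = restrict (\<lambda>(z, s). q (fst (inv_into (topspace XR) q z), snd (inv_into (topspace XR) q z) + s)) (topspace M \<times> UNIV)"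

definition S :: "'b set" where
  "S = (\<lambda>x. q (x, 0)) ` topspace X"

lemma topspace_M: "topspace M = q ` topspace XR"
  by (simp add: M_def topspace_quotient_topology)

lemma q_in: "x \<in> topspace X \<Longrightarrow> q (x, t) \<in> topspace M"
  by (auto simp: topspace_M)

lemma q_cases:
  assumes "z \<in> topspace M"
  obtains x t where "x \<in> topspace X" "z = q (x, t)"
  using assms by (auto simp: topspace_M)

lemma q_shift: "x \<in> topspace X \<Longrightarrow> q (pow m x, t - of_int m) = q (x, t)"
  by (simp add: q_def pow_add[symmetric] frac_def)

text \<open>
  The fibres of \<open>q\<close> are the orbits of the translations \<open>(x, t) \<mapsto> (pow m x, t - m)\<close>.
\<close>
lemma q_eqD:
  assumes x: "x \<in> topspace X" "y \<in> topspace X" and eq: "q (x, t) = q (y, s)"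
  obtains m where "y = pow m x" "s = t - of_int m"
proof -
  have e: "pow \<lfloor>t\<rfloor> x = pow \<lfloor>s\<rfloor> y" "frac t = frac s"
    using eq inj_j by (auto simp: q_def dest: injD)
  have "y = pow (- \<lfloor>s\<rfloor>) (pow \<lfloor>s\<rfloor> y)" using pow_add[OF x(2), of "- \<lfloor>s\<rfloor>" "\<lfloor>s\<rfloor>"] by simp
  also have "\<dots> = pow (\<lfloor>t\<rfloor> - \<lfloor>s\<rfloor>) x" using e(1) pow_add[OF x(1), of "- \<lfloor>s\<rfloor>" "\<lfloor>t\<rfloor>"] by simp
  finally have "y = pow (\<lfloor>t\<rfloor> - \<lfloor>s\<rfloor>) x" .
  moreover have "s = t - of_int (\<lfloor>t\<rfloor> - \<lfloor>s\<rfloor>)" using e(2) by (simp add: frac_def)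
  ultimately show ?thesis by (rule that)
qed

lemma q_eq_near:
  assumes "x \<in> topspace X" "y \<in> topspace X" "q (x, t) = q (y, s)" "\<bar>t - s\<bar> < 1"
  shows "x = y" "t = s"
proof -
  obtain m where m: "y = pow m x" "s = t - of_int m" by (rule q_eqD[OF assms(1-3)])
  then have "m = 0" using assms(4) by simp
  then show "x = y" "t = s" using m by auto
qed

lemma quotient_q: "quotient_map XR M q"
  unfolding M_def by (rule quotient_map_quotient_topology)

lemma q_continuous: "continuous_map XR M q"
  by (rule quotient_imp_continuous_map[OF quotient_q])

text \<open>
  The saturation of an open set is the union of its translates.
\<close>
lemma q_open: "open_map XR M q"
  unfolding open_map_def
proof (intro allI impI)
  fix W assume W: "openin XR W"
  have WX: "W \<subseteq> topspace XR" using W openin_subset by blast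
  let ?s = "\<lambda>m. \<lambda>p. (pow m (fst p), snd p - of_int m)"
  have "{p \<in> topspace XR. q p \<in> q ` W} = (\<Union>m. {p \<in> topspace XR. ?s m p \<in> W})"
  proof (intro equalityI subsetI)
    fix p assume p: "p \<in> {p \<in> topspace XR. q p \<in> q ` W}"
    then obtain w where w: "w \<in> W" "q p = q w" by blast
    have "fst p \<in> topspace X" "fst w \<in> topspace X" "q (fst p, snd p) = q (fst w, snd w)"
      using p w WX by auto
    then obtain m where "fst w = pow m (fst p)" "snd w = snd p - of_int m" by (rule q_eqD)
    then have "?s m p = w" by (simp add: prod_eq_iff)
    then show "p \<in> (\<Union>m. {p \<in> topspace XR. ?s m p \<in> W})" using p w(1) by blast
  next
    fix p assume "p \<in> (\<Union>m. {p \<in> topspace XR. ?s m p \<in> W})"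
    then obtain m where p: "p \<in> topspace XR" "?s m p \<in> W" by blast
    then have "q p = q (?s m p)" using q_shift[of "fst p" m "snd p"] by auto
    then show "p \<in> {p \<in> topspace XR. q p \<in> q ` W}" using p by blast
  qed
  moreover have "continuous_map XR XR (?s m)" for m
    using continuous_map_compose[OF continuous_map_fst pow_continuous]
    by (intro continuous_map_pairedI continuous_map_diff continuous_map_snd) (simp_all add: o_def)
  then have "openin XR {p \<in> topspace XR. ?s m p \<in> W}" for m
    using W openin_continuous_map_preimage by blast
  ultimately have "openin XR {p \<in> topspace XR. q p \<in> q ` W}" by auto
  then show "openin M (q ` W)"
    using WX by (auto simp: M_def openin_quotient_topology)
qed

lemma M_second_countable: "second_countable M"
proof (rule second_countable_open_map_image[OF q_continuous q_open])
  show "q ` topspace XR = topspace M" by (simp only: topspace_M)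
  show "second_countable XR"
    using man second_countable_euclideanreal
    by (intro second_countable_prod_topology) (simp_all add: topological_manifold_def)
qed

text \<open>
  Two points of a circle lie on a common open arc. Hence two points of the suspension have lifts to one
  strip of width one, where \<open>q\<close> is injective and \<open>X \<times> \<real>\<close> is Hausdorff.
\<close>
lemma M_Hausdorff: "Hausdorff_space M"
  unfolding Hausdorff_space_def
proof (intro allI impI)
  fix z w assume zw: "z \<in> topspace M \<and> w \<in> topspace M \<and> z \<noteq> w"
  obtain x s where z: "x \<in> topspace X" "z = q (x, s)" using zw q_cases by blast
  obtain y t where w: "y \<in> topspace X" "w = q (y, t)" using zw q_cases by blast
  \<comment> \<open>The endpoint of the strip: one of three values avoids the two given residues.\<close>
  have "\<exists>c::real. 0 \<le> c \<and> c < 1 \<and> c \<noteq> a \<and> c \<noteq> b" for a b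
    by (intro exI[of _ "if 0 \<noteq> a \<and> 0 \<noteq> b then 0 else if 1 / 4 \<noteq> a \<and> 1 / 4 \<noteq> b then 1 / 4 else 1 / 2"]) auto
  then obtain c where c: "0 \<le> c" "c < 1" "c \<noteq> frac s" "c \<noteq> frac t" by blast
  have lift: "\<exists>x' s'. x' \<in> topspace X \<and> q (x, s) = q (x', s') \<and> c < s' \<and> s' < c + 1"
    if x: "x \<in> topspace X" and s: "c \<noteq> frac s" for x s
  proof (cases "c < frac s")
    case True
    have "q (x, s) = q (pow \<lfloor>s\<rfloor> x, frac s)" using q_shift[OF x, of "\<lfloor>s\<rfloor>" s] by (simp add: frac_def)
    then show ?thesis using True c x frac_lt_1[of s] pow_in by (intro exI[of _ "pow \<lfloor>s\<rfloor> x"] exI[of _ "frac s"]) auto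
  next
    case False
    have "q (x, s) = q (pow (\<lfloor>s\<rfloor> - 1) x, frac s + 1)"
      using q_shift[OF x, of "\<lfloor>s\<rfloor> - 1" s] by (simp add: frac_def algebra_simps)
    moreover have "frac s < c" using False s by simp
    then have "c < frac s + 1" "frac s + 1 < c + 1" using c(2) frac_ge_0[of s] by linarith+
    ultimately show ?thesis using x pow_in by blast
  qed
  obtain x' s' where x': "x' \<in> topspace X" "z = q (x', s')" "c < s'" "s' < c + 1" using lift[OF z(1) c(3)] z(2) by auto
  obtain y' t' where y': "y' \<in> topspace X" "w = q (y', t')" "c < t'" "t' < c + 1" using lift[OF w(1) c(4)] w(2) by auto
  have "Hausdorff_space XR"
    using man by (simp add: Hausdorff_space_prod_topology topological_manifold_def)
  moreover have "(x', s') \<in> topspace XR" "(y', t') \<in> topspace XR" "(x', s') \<noteq> (y', t')"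
    using x' y' zw by auto
  ultimately obtain U V where UV: "openin XR U" "openin XR V" "(x', s') \<in> U" "(y', t') \<in> V" "disjnt U V"
    unfolding Hausdorff_space_def by blast
  let ?I = "topspace X \<times> {c<..<c + 1}"
  have I: "openin XR ?I" by (simp add: openin_prod_Times_iff)
  have "disjnt (q ` (U \<inter> ?I)) (q ` (V \<inter> ?I))"
    unfolding disjnt_iff
  proof (intro allI notI)
    fix v assume "v \<in> q ` (U \<inter> ?I) \<and> v \<in> q ` (V \<inter> ?I)"
    then obtain a r b u where *: "(a, r) \<in> U \<inter> ?I" "(b, u) \<in> V \<inter> ?I" "q (a, r) = q (b, u)" by auto
    then have "\<bar>r - u\<bar> < 1" by auto
    then have "a = b" "r = u" using q_eq_near[of a b r u] * by auto
    then show False using * UV(5) by (auto simp: disjnt_iff)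
  qed
  moreover have "openin M (q ` (U \<inter> ?I))" "openin M (q ` (V \<inter> ?I))"
    using q_open UV I by (auto simp: open_map_def)
  moreover have "z \<in> q ` (U \<inter> ?I)" "w \<in> q ` (V \<inter> ?I)" using x' y' UV by auto
  ultimately show "\<exists>U V. openin M U \<and> openin M V \<and> z \<in> U \<and> w \<in> V \<and> disjnt U V" by blast
qed

lemma q_homeomorphic:
  assumes W: "openin XR W" and inj: "inj_on q W"
  shows "homeomorphic_map (subtopology XR W) (subtopology M (q ` W)) q"
proof -
  have WX: "W \<subseteq> topspace XR" using W openin_subset by blast
  have qW: "q ` W \<subseteq> topspace M" using WX by (auto simp: topspace_M)
  show ?thesis
  proof (rule bijective_open_imp_homeomorphic_map)
    show "continuous_map (subtopology XR W) (subtopology M (q ` W)) q"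
      using q_continuous by (auto simp: continuous_map_in_subtopology continuous_map_from_subtopology)
    show "open_map (subtopology XR W) (subtopology M (q ` W)) q"
      unfolding open_map_def
    proof (intro allI impI)
      fix V assume V: "openin (subtopology XR W) V"
      then have "openin XR V" "V \<subseteq> W" using W by (auto simp: openin_open_subtopology)
      then have "openin M (q ` V)" "q ` V \<subseteq> q ` W" using q_open by (auto simp: open_map_def)
      then show "openin (subtopology M (q ` W)) (q ` V)"
        using openin_subtopology_Int2[of M "q ` V" "q ` W"] by (simp add: Int_absorb1)
    qed
    show "q ` topspace (subtopology XR W) = topspace (subtopology M (q ` W))"
      using WX qW by (simp add: Int_absorb1)
    show "inj_on q (topspace (subtopology XR W))" using inj by (rule inj_on_subset) simp
  qed
qed

text \<open>
  The ball chart of \<open>X \<times> \<real>\<close> around \<open>(x, s)\<close> descends along \<open>q\<close>, since its domain is too thin to contain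
  two equivalent points. The last coordinate of the chart measures time from \<open>s\<close>; for \<open>s = 0\<close> it
  vanishes exactly on the section.
\<close>
lemma suspension_chart:
  assumes x: "x \<in> topspace X"
  obtains W \<kappa> where "openin M (q ` W)"
    "homeomorphic_map (subtopology M (q ` W)) (subtopology (Euclidean_space (Suc n)) (unit_ball (Suc n))) \<kappa>"
    "\<And>t. \<bar>t - s\<bar> < 1 / 3 \<Longrightarrow> (x, t) \<in> W" "\<And>y t. (y, t) \<in> W \<Longrightarrow> y \<in> topspace X \<and> \<bar>t - s\<bar> < 1 / 3"
    "\<And>y t. (y, t) \<in> W \<Longrightarrow> \<kappa> (q (y, t)) n = 3 * (t - s)"
proof -
  obtain U \<phi> where U: "openin X U" "x \<in> U" "\<phi> x = (\<lambda>i. 0)"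
    "homeomorphic_map (subtopology X U) (subtopology (Euclidean_space n) (unit_ball n)) \<phi>"
    by (rule manifold_unit_ball_chart[OF man x])
  define \<theta> where "\<theta> = (\<lambda>(y, t). \<lambda>i. if i < n then \<phi> y i else if i = n then 3 * (t - s) else (0::real))"
  obtain W where W: "openin XR W"
    "homeomorphic_map (subtopology XR W) (subtopology (Euclidean_space (Suc n)) (unit_ball (Suc n))) \<theta>"
    "\<And>t. \<bar>t - s\<bar> < 1 / 3 \<Longrightarrow> (x, t) \<in> W" "\<And>y t. (y, t) \<in> W \<Longrightarrow> y \<in> topspace X \<and> \<bar>t - s\<bar> < 1 / 3"
    unfolding \<theta>_def by (rule product_with_line_chart[OF U, of s]) blast
  have inj: "inj_on q W"
  proof (rule inj_onI)
    fix p p' assume p: "p \<in> W" "p' \<in> W" and eq: "q p = q p'"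
    obtain y t y' t' where [simp]: "p = (y, t)" "p' = (y', t')" by (cases p, cases p')
    have "\<bar>t - s\<bar> < 1 / 3" "\<bar>t' - s\<bar> < 1 / 3" "y \<in> topspace X" "y' \<in> topspace X" using W(4) p by auto
    moreover from this have "\<bar>t - t'\<bar> < 1" by argo
    ultimately show "p = p'" using q_eq_near[of y y' t t'] eq by simp
  qed
  obtain g where g: "homeomorphic_maps (subtopology XR W) (subtopology M (q ` W)) q g"
    using q_homeomorphic[OF W(1) inj] homeomorphic_map_maps by blast
  then have "homeomorphic_map (subtopology M (q ` W)) (subtopology XR W) g"
    using homeomorphic_maps_map by blast
  then have \<kappa>: "homeomorphic_map (subtopology M (q ` W)) (subtopology (Euclidean_space (Suc n)) (unit_ball (Suc n))) (\<theta> \<circ> g)"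
    using W(2) homeomorphic_map_compose by blast
  have "(\<theta> \<circ> g) (q (y, t)) n = 3 * (t - s)" if "(y, t) \<in> W" for y t
  proof -
    have "(y, t) \<in> topspace (subtopology XR W)" using that openin_subset[OF W(1)] by auto
    then have "g (q (y, t)) = (y, t)" using g by (simp add: homeomorphic_maps_def)
    then show ?thesis by (simp add: \<theta>_def)
  qed
  moreover have "openin M (q ` W)" using q_open W(1) by (simp add: open_map_def)
  ultimately show ?thesis using that[of W "\<theta> \<circ> g"] \<kappa> W(3,4) by blast
qed

lemma M_manifold: "topological_manifold (Suc n) M"
  unfolding topological_manifold_def
proof (intro conjI ballI)
  fix z assume "z \<in> topspace M"
  then obtain x s where z: "x \<in> topspace X" "z = q (x, s)" using q_cases by blast
  obtain W \<kappa> where W: "openin M (q ` W)"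
    "homeomorphic_map (subtopology M (q ` W)) (subtopology (Euclidean_space (Suc n)) (unit_ball (Suc n))) \<kappa>"
    "\<And>t. \<bar>t - s\<bar> < 1 / 3 \<Longrightarrow> (x, t) \<in> W"
    by (rule suspension_chart[OF z(1), of s]) blast
  have "z \<in> q ` W" using z(2) W(3)[of s] by simp
  then show "\<exists>U V. openin M U \<and> z \<in> U \<and> openin (Euclidean_space (Suc n)) V \<and>
        subtopology M U homeomorphic_space subtopology (Euclidean_space (Suc n)) V"
    using W(1) openin_unit_ball homeomorphic_map_imp_homeomorphic_space[OF W(2)] by blast
qed (use M_second_countable M_Hausdorff in auto)

lemma flow_q: "x \<in> topspace X \<Longrightarrow> \<Phi> (q (x, t), s) = q (x, t + s)"
proof -
  assume x: "x \<in> topspace X"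
  define p where "p = inv_into (topspace XR) q (q (x, t))"
  have mem: "q (x, t) \<in> q ` topspace XR" using x by auto
  have p: "p \<in> topspace XR" "q p = q (x, t)"
    unfolding p_def using inv_into_into[OF mem] f_inv_into_f[OF mem] by auto
  then have "fst p \<in> topspace X" "q (x, t) = q (fst p, snd p)" by auto
  then obtain m where m: "fst p = pow m x" "snd p = t - of_int m" using q_eqD[OF x] by blast
  have "\<Phi> (q (x, t), s) = q (fst p, snd p + s)" using q_in[OF x] by (simp add: \<Phi>_def p_def)
  also have "snd p + s = t + s - of_int m" using m(2) by simp
  also have "q (fst p, t + s - of_int m) = q (x, t + s)" using q_shift[OF x] m(1) by simp
  finally show ?thesis .
qed

text \<open>
  The map \<open>q\<close> times the identity of the line is a quotient map because the line is locally compact, so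
  continuity may be checked on \<open>X \<times> \<real> \<times> \<real>\<close>.
\<close>
lemma flow: "is_flow \<Phi> M"
  unfolding is_flow_def
proof (intro conjI ballI allI)
  show "\<exists>n. topological_manifold n M" using M_manifold by blast
  show "\<Phi> \<in> extensional (topspace M \<times> UNIV)" by (simp add: \<Phi>_def)
  have "quotient_map (prod_topology XR euclideanreal) (prod_topology M euclideanreal) (\<lambda>(x, y). (q x, y))"
    by (rule quotient_map_prod_left[OF _ _ quotient_q])
      (auto simp: Hausdorff_space_euclidean locally_compact_space_euclidean)
  moreover have "continuous_map (prod_topology XR euclideanreal) M (\<Phi> \<circ> (\<lambda>(x, y). (q x, y)))"
  proof (rule continuous_map_eq)
    have "continuous_map (prod_topology XR euclideanreal) XR (\<lambda>p. (fst (fst p), snd (fst p) + snd p))"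
      by (intro continuous_map_pairedI continuous_map_add continuous_map_snd
          continuous_map_compose[OF continuous_map_fst continuous_map_fst, unfolded o_def]
          continuous_map_compose[OF continuous_map_fst continuous_map_snd, unfolded o_def])
    then show "continuous_map (prod_topology XR euclideanreal) M (q \<circ> (\<lambda>p. (fst (fst p), snd (fst p) + snd p)))"
      using q_continuous by (rule continuous_map_compose)
  qed (auto simp: flow_q)
  ultimately show "continuous_map (prod_topology M euclideanreal) M \<Phi>"
    by (rule continuous_compose_quotient_map)
  fix z assume "z \<in> topspace M"
  then obtain x t where z: "x \<in> topspace X" "z = q (x, t)" using q_cases by blast
  show "\<Phi> (z, 0) = z" "\<Phi> (\<Phi> (z, s), s') = \<Phi> (z, s + s')" for s s'
    using z by (simp_all add: flow_q add.assoc)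
qed

lemma q_in_S: "x \<in> topspace X \<Longrightarrow> q (x, t) \<in> S \<longleftrightarrow> t \<in> \<int>"
proof
  assume x: "x \<in> topspace X"
  { assume "q (x, t) \<in> S"
    then obtain y where y: "y \<in> topspace X" "q (x, t) = q (y, 0)" by (auto simp: S_def)
    then obtain m where "0 = t - of_int m" using q_eqD[OF x y] by blast
    then show "t \<in> \<int>" by simp }
  { assume "t \<in> \<int>"
    then obtain m where "t = of_int m" by (auto elim: Ints_cases)
    then have "q (x, t) = q (pow m x, 0)" using q_shift[OF x, of m t] by simp
    then show "q (x, t) \<in> S" using pow_in[OF x] by (auto simp: S_def) }
qed

lemma S_closed: "closedin M S"
proof -
  have SM: "S \<subseteq> topspace M" using q_in by (auto simp: S_def)
  have "closedin XR {p \<in> topspace XR. snd p \<in> \<int>}"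
    by (rule closedin_continuous_map_preimage[OF continuous_map_snd]) simp
  moreover have "{p \<in> topspace XR. q p \<in> S} = {p \<in> topspace XR. snd p \<in> \<int>}"
    using q_in_S by auto
  ultimately have "closedin XR {p \<in> topspace XR. q p \<in> S}" by (simp only:)
  then show ?thesis
    using quotient_q SM unfolding quotient_map_closedin by blast
qed

lemma section_homeomorphic: "homeomorphic_map X (subtopology M S) (\<lambda>x. q (x, 0))"
proof (rule bijective_open_imp_homeomorphic_map)
  have SM: "topspace (subtopology M S) = S" using S_closed closedin_subset by fastforce
  have "continuous_map X XR (\<lambda>x. (x, 0))"
    by (intro continuous_map_pairedI) (auto simp: continuous_map_id[unfolded id_def])
  then have "continuous_map X M (q \<circ> (\<lambda>x. (x, 0)))" using q_continuous by (rule continuous_map_compose)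
  then show "continuous_map X (subtopology M S) (\<lambda>x. q (x, 0))"
    by (auto simp: continuous_map_in_subtopology S_def o_def)
  show "(\<lambda>x. q (x, 0)) ` topspace X = topspace (subtopology M S)" unfolding SM by (simp add: S_def)
  show "inj_on (\<lambda>x. q (x, 0)) (topspace X)" by (rule inj_onI) (rule q_eq_near(1), auto)
  show "open_map X (subtopology M S) (\<lambda>x. q (x, 0))"
    unfolding open_map_def
  proof (intro allI impI)
    fix U assume U: "openin X U"
    have UX: "U \<subseteq> topspace X" using U openin_subset by blast
    have "openin XR (U \<times> {- 1 / 2<..<1 / 2})" using U by (simp add: openin_prod_Times_iff)
    then have op: "openin M (q ` (U \<times> {- 1 / 2<..<1 / 2}))" using q_open by (simp add: open_map_def)
    have "(\<lambda>x. q (x, 0)) ` U = S \<inter> q ` (U \<times> {- 1 / 2<..<1 / 2})"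
    proof (intro equalityI subsetI)
      fix z assume "z \<in> S \<inter> q ` (U \<times> {- 1 / 2<..<1 / 2})"
      then obtain x t where z: "z \<in> S" "z = q (x, t)" "x \<in> U" "- 1 / 2 < t" "t < 1 / 2" by auto
      then have "t \<in> \<int>" using q_in_S UX by blast
      then have "t = 0" using z(4,5) by (auto elim!: Ints_cases)
      then show "z \<in> (\<lambda>x. q (x, 0)) ` U" using z by blast
    qed (use UX in \<open>auto simp: S_def\<close>)
    then show "openin (subtopology M S) ((\<lambda>x. q (x, 0)) ` U)"
      using openin_subtopology_Int2[OF op] by simp
  qed
qed

lemma topspace_S: "topspace (subtopology M S) = S"
  using closedin_subset[OF S_closed] by auto

lemma section_codim_one: "codim_one_submanifold (Suc n) M S"
  unfolding codim_one_submanifold_def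
  using S_closed topological_manifold_homeomorphic[OF man section_homeomorphic] by simp

lemma orbit_continuous: "z \<in> topspace M \<Longrightarrow> continuous_map euclideanreal M (\<lambda>t. \<Phi> (z, t))"
  using continuous_map_compose[of euclideanreal "prod_topology M euclideanreal" "\<lambda>t. (z, t)" M \<Phi>] flow
  by (auto simp: is_flow_def o_def continuous_map_pairedI)

text \<open>
  The two arcs are connected, so each lies in one component of \<open>U - S\<close>. If both components agreed, the
  last chart coordinate would vanish somewhere on this connected set, hence at a point of the section.
  The length \<open>1 / 4\<close> keeps the arcs inside the chart, which extends \<open>1 / 3\<close> in time.
\<close>
lemma flat_chart_on_section:
  assumes x: "x \<in> topspace X"
  shows "\<exists>U \<kappa>. neighbourhood_in M (q (x, 0)) U \<and> flat_chart (Suc n) M S U \<kappa> \<and>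
    (\<exists>C D. C \<in> connected_components_of (subtopology M (U - S)) \<and>
           D \<in> connected_components_of (subtopology M (U - S)) \<and> C \<noteq> D \<and>
           \<Phi> ` ({q (x, 0)} \<times> {- (1 / 4)..<0}) \<subseteq> C \<and> \<Phi> ` ({q (x, 0)} \<times> {0<..1 / 4}) \<subseteq> D)"
proof -
  let ?z = "q (x, 0)"
  have zM: "?z \<in> topspace M" using q_in[OF x] .
  obtain W \<kappa> where W: "openin M (q ` W)"
    "homeomorphic_map (subtopology M (q ` W)) (subtopology (Euclidean_space (Suc n)) (unit_ball (Suc n))) \<kappa>"
    "\<And>t. \<bar>t - 0\<bar> < 1 / 3 \<Longrightarrow> (x, t) \<in> W" "\<And>y t. (y, t) \<in> W \<Longrightarrow> y \<in> topspace X \<and> \<bar>t - 0\<bar> < 1 / 3"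
    "\<And>y t. (y, t) \<in> W \<Longrightarrow> \<kappa> (q (y, t)) n = 3 * (t - 0)"
    by (rule suspension_chart[OF x, of 0]) blast
  let ?U = "q ` W"
  have UM: "?U \<subseteq> topspace M" using W(1) openin_subset by blast
  have tU: "topspace (subtopology M ?U) = ?U" using UM by auto
  have ball: "topspace (subtopology (Euclidean_space (Suc n)) (unit_ball (Suc n))) = unit_ball (Suc n)"
    using unit_ball_subset by auto
  have nbhd: "neighbourhood_in M ?z ?U"
    using UM W(1) W(3)[of 0] by (auto simp: neighbourhood_in_def)
  have im: "\<kappa> ` ?U = unit_ball (Suc n)"
    using homeomorphic_imp_surjective_map[OF W(2)] unfolding tU ball .
  have S_iff: "w \<in> S \<longleftrightarrow> \<kappa> w n = 0" if w: "w \<in> ?U" for w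
  proof -
    obtain y t where [simp]: "w = q (y, t)" and yt: "(y, t) \<in> W" using w by auto
    have t: "\<bar>t\<bar> < 1 / 3" "y \<in> topspace X" using W(4)[OF yt] by auto
    have "t \<in> \<int> \<longleftrightarrow> t = 0" using t(1) by (auto elim!: Ints_cases)
    then show ?thesis using q_in_S[OF t(2)] W(5)[OF yt] by simp
  qed
  have chart: "flat_chart (Suc n) M S ?U \<kappa>"
    unfolding flat_chart_def
  proof
    show "\<kappa> ` (?U \<inter> S) = unit_ball (Suc n) \<inter> {v. v (Suc n - 1) = 0}"
    proof -
      have "?U \<inter> S = {w \<in> ?U. \<kappa> w n = 0}" using S_iff by blast
      then have "\<kappa> ` (?U \<inter> S) = {v \<in> \<kappa> ` ?U. v n = 0}" by auto
      then show ?thesis using im by auto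
    qed
  qed (rule W(2))
  have arc: "\<Phi> (?z, t) \<in> ?U" "\<kappa> (\<Phi> (?z, t)) n = 3 * t" if t: "\<bar>t\<bar> \<le> 1 / 4" for t
  proof -
    have "(x, t) \<in> W" using W(3)[of t] t by simp
    then show "\<Phi> (?z, t) \<in> ?U" "\<kappa> (\<Phi> (?z, t)) n = 3 * t"
      using W(5)[of x t] by (simp_all add: flow_q[OF x])
  qed
  let ?Y = "subtopology M (?U - S)"
  have tY: "topspace ?Y = ?U - S" using UM by auto
  have half: "connectedin ?Y (\<Phi> ` ({?z} \<times> I))" if I: "connected I" "\<And>t. t \<in> I \<Longrightarrow> \<bar>t\<bar> \<le> 1 / 4 \<and> t \<noteq> 0" for I
  proof -
    have "\<Phi> ` ({?z} \<times> I) = (\<lambda>t. \<Phi> (?z, t)) ` I" by auto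
    moreover have "connectedin M ((\<lambda>t. \<Phi> (?z, t)) ` I)"
      using I(1) by (intro connectedin_continuous_map_image[OF orbit_continuous[OF zM]]) simp
    moreover have "(\<lambda>t. \<Phi> (?z, t)) ` I \<subseteq> ?U - S"
      using arc S_iff I(2) by auto
    ultimately show ?thesis by (simp add: connectedin_subtopology)
  qed
  let ?a = "\<Phi> (?z, - (1 / 4))" and ?b = "\<Phi> (?z, 1 / 4)"
  let ?C = "connected_component_of_set ?Y ?a" and ?D = "connected_component_of_set ?Y ?b"
  have ab: "?a \<in> ?U - S" "?b \<in> ?U - S" using arc[of "- (1 / 4)"] arc[of "1 / 4"] S_iff by auto
  have C: "?C \<in> connected_components_of ?Y" and D: "?D \<in> connected_components_of ?Y"
    using ab unfolding connected_component_in_connected_components_of tY by auto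
  have CI: "\<Phi> ` ({?z} \<times> {- (1 / 4)..<0}) \<subseteq> ?C" and DI: "\<Phi> ` ({?z} \<times> {0<..1 / 4}) \<subseteq> ?D"
    by (intro connected_component_of_maximal half; force)+
  have "?C \<noteq> ?D"
  proof
    assume eq: "?C = ?D"
    have conn: "connectedin ?Y ?C" by (rule connectedin_connected_component_of)
    have sub: "?C \<subseteq> ?U - S" using connected_components_of_subset[OF C] tY by simp
    have "continuous_map (subtopology M ?U) (Euclidean_space (Suc n)) \<kappa>"
      using homeomorphic_imp_continuous_map[OF W(2)] by (simp add: continuous_map_in_subtopology)
    then have "continuous_map ?Y (Euclidean_space (Suc n)) \<kappa>"
      by (rule continuous_map_from_subtopology_mono) blast
    then have "continuous_map ?Y euclideanreal (\<lambda>w. \<kappa> w n)"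
      using continuous_map_compose[OF _ Euclidean_coordinate_continuous] by (simp add: o_def)
    then have "connectedin euclideanreal ((\<lambda>w. \<kappa> w n) ` ?C)"
      using conn by (rule connectedin_continuous_map_image)
    then have "connected ((\<lambda>w. \<kappa> w n) ` ?C)" by simp
    moreover have "- (3 / 4) \<in> (\<lambda>w. \<kappa> w n) ` ?C"
    proof (rule image_eqI)
      show "- (3 / 4) = \<kappa> ?a n" using arc(2)[of "- (1 / 4)"] by simp
      show "?a \<in> ?C" using CI by (simp add: image_subset_iff)
    qed
    moreover have "3 / 4 \<in> (\<lambda>w. \<kappa> w n) ` ?C"
    proof (rule image_eqI)
      show "3 / 4 = \<kappa> ?b n" using arc(2)[of "1 / 4"] by simp
      show "?b \<in> ?C" unfolding eq using DI by (simp add: image_subset_iff)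
    qed
    ultimately have "0 \<in> (\<lambda>w. \<kappa> w n) ` ?C"
      by (rule connectedD_interval) auto
    then show False using sub S_iff by auto
  qed
  then show ?thesis using nbhd chart C D CI DI by blast
qed

lemma section_transversal: "topologically_transversal (Suc n) \<Phi> M S"
  unfolding topologically_transversal_def
proof (intro conjI ballI allI)
  show "codim_one_submanifold (Suc n) M S" by (rule section_codim_one)
  show "locally_flat (Suc n) M S"
    unfolding locally_flat_def
  proof
    fix z assume "z \<in> S"
    then obtain x where x: "x \<in> topspace X" "z = q (x, 0)" by (auto simp: S_def)
    show "\<exists>U \<phi>. neighbourhood_in M z U \<and> flat_chart (Suc n) M S U \<phi>"
      using flat_chart_on_section[OF x(1)] x(2) by blast
  qed
  show "compactin (subtopology M S) (\<Phi> ` ({y} \<times> {a..b}) \<inter> S)" if y: "y \<in> topspace M" for y a b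
  proof -
    have "compactin M ((\<lambda>t. \<Phi> (y, t)) ` {a..b})"
      by (rule image_compactin[OF _ orbit_continuous[OF y]]) simp
    moreover have "(\<lambda>t. \<Phi> (y, t)) ` {a..b} = \<Phi> ` ({y} \<times> {a..b})" by auto
    ultimately have "compactin M (S \<inter> \<Phi> ` ({y} \<times> {a..b}))"
      using closed_Int_compactin[OF S_closed] by simp
    then show ?thesis by (simp add: compactin_subtopology Int_commute)
  qed
  show "\<exists>\<delta>p \<delta>m :: 'b \<Rightarrow> real. \<forall>x\<in>S. \<exists>U \<phi>.
        neighbourhood_in M x U \<and> flat_chart (Suc n) M S U \<phi> \<and>
        0 < \<delta>p x \<and> \<delta>m x < 0 \<and>
        (\<exists>C D. C \<in> connected_components_of (subtopology M (U - S)) \<and>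
               D \<in> connected_components_of (subtopology M (U - S)) \<and> C \<noteq> D \<and>
               \<Phi> ` ({x} \<times> {\<delta>m x..<0}) \<subseteq> C \<and> \<Phi> ` ({x} \<times> {0<..\<delta>p x}) \<subseteq> D) \<and>
        \<Phi> ` ({x} \<times> {\<delta>m x..\<delta>p x}) \<inter> S = {x} \<and>
        (\<exists>V \<delta>. neighbourhood_in M x V \<and> V \<subseteq> U \<and> 0 < \<delta> \<and>
               (\<forall>y\<in>V \<inter> S. \<delta> < \<delta>p y \<and> \<delta>m y < - \<delta>))"
  proof (rule exI[of _ "\<lambda>_. 1 / 4"], rule exI[of _ "\<lambda>_. - (1 / 4)"], rule ballI)
    fix z assume z: "z \<in> S"
    then obtain x where x: "x \<in> topspace X" "z = q (x, 0)" by (auto simp: S_def)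
    obtain U \<phi> where U: "neighbourhood_in M z U" "flat_chart (Suc n) M S U \<phi>"
      and comp: "\<exists>C D. C \<in> connected_components_of (subtopology M (U - S)) \<and>
               D \<in> connected_components_of (subtopology M (U - S)) \<and> C \<noteq> D \<and>
               \<Phi> ` ({z} \<times> {- (1 / 4)..<0}) \<subseteq> C \<and> \<Phi> ` ({z} \<times> {0<..1 / 4}) \<subseteq> D"
      using flat_chart_on_section[OF x(1)] x(2) by blast
    have "\<Phi> (z, t) \<in> S \<longleftrightarrow> t = 0" if "- (1 / 4) \<le> t" "t \<le> 1 / 4" for t
      using q_in_S[OF x(1), of t] flow_q[OF x(1), of 0 t] x(2) that by (auto elim!: Ints_cases)
    moreover have "\<Phi> (z, 0) = z" using flow_q[OF x(1), of 0 0] x(2) by simp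
    ultimately have "\<Phi> ` ({z} \<times> {- (1 / 4)..1 / 4}) \<inter> S = {z}"
      using z by (auto intro!: image_eqI[of _ _ "(z, 0)"])
    moreover have "\<exists>V \<delta>. neighbourhood_in M z V \<and> V \<subseteq> U \<and> 0 < \<delta> \<and>
               (\<forall>y\<in>V \<inter> S. \<delta> < 1 / 4 \<and> - (1 / 4) < - (\<delta>::real))"
      using U(1) by (intro exI[of _ U] exI[of _ "1 / 5"]) auto
    ultimately show "\<exists>U \<phi>. neighbourhood_in M z U \<and> flat_chart (Suc n) M S U \<phi> \<and>
        0 < (1 / 4 :: real) \<and> - (1 / 4 :: real) < 0 \<and>
        (\<exists>C D. C \<in> connected_components_of (subtopology M (U - S)) \<and>
               D \<in> connected_components_of (subtopology M (U - S)) \<and> C \<noteq> D \<and>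
               \<Phi> ` ({z} \<times> {- (1 / 4)..<0}) \<subseteq> C \<and> \<Phi> ` ({z} \<times> {0<..1 / 4}) \<subseteq> D) \<and>
        \<Phi> ` ({z} \<times> {- (1 / 4)..1 / 4}) \<inter> S = {z} \<and>
        (\<exists>V \<delta>. neighbourhood_in M z V \<and> V \<subseteq> U \<and> 0 < \<delta> \<and>
               (\<forall>y\<in>V \<inter> S. \<delta> < 1 / 4 \<and> - (1 / 4) < - (\<delta>::real)))"
      using U comp by - (rule exI[of _ U], rule exI[of _ \<phi>], intro conjI, (assumption | simp)+)
  qed
qed

lemma flow_object: "(\<Phi>, M, S) \<in> flow_objects"
proof -
  have "\<exists>t>0. \<Phi> (z, t) \<in> S" "\<exists>t<0. \<Phi> (z, t) \<in> S" if zM: "z \<in> topspace M" for z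
  proof -
    obtain x t where z: "x \<in> topspace X" "z = q (x, t)" by (rule q_cases[OF zM])
    have hit: "\<Phi> (z, of_int m - t) \<in> S" for m
      using z q_in_S[OF z(1)] by (simp add: flow_q)
    have "0 < of_int (\<lfloor>t\<rfloor> + 1) - t" "of_int (\<lceil>t\<rceil> - 1) - t < 0" by linarith+
    then show "\<exists>t>0. \<Phi> (z, t) \<in> S" "\<exists>t<0. \<Phi> (z, t) \<in> S" using hit by blast+
  qed
  then have "global_section \<Phi> M S"
    unfolding global_section_def using M_manifold section_transversal by blast
  then show ?thesis using flow by (simp add: flow_objects_def)
qed

lemma suspension_poincare: "x \<in> topspace X \<Longrightarrow> poincare_map \<Phi> S (q (x, 0)) = q (f x, 0)"
proof -
  assume x: "x \<in> topspace X"
  have "return_time \<Phi> S (q (x, 0)) = 1"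
    by (rule return_time_eqI) (use q_in_S[OF x] in \<open>auto simp: flow_q[OF x] elim!: Ints_cases\<close>)
  then show ?thesis
    using q_shift[OF x, of 1 1] by (simp add: poincare_map_def flow_q[OF x])
qed

end

section \<open>The equivalence\<close>

lemma inj_prod_real:
  assumes "(UNIV :: real set) \<lesssim> (UNIV :: 'a set)"
  shows "\<exists>j :: 'a \<times> real \<Rightarrow> 'a. inj j"
proof -
  obtain i :: "real \<Rightarrow> 'a" where i: "inj i" using assms by (auto simp: lepoll_def)
  have inf: "infinite (UNIV :: 'a set)"
    using i finite_imageD[of i UNIV] infinite_UNIV_char_0[where 'a = real] by (meson finite_subset subset_UNIV)
  have "(card_of (UNIV :: real set), card_of (UNIV :: 'a set)) \<in> ordLeq"
    using i card_of_ordLeq[of "UNIV :: real set" "UNIV :: 'a set"] by blast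
  then have "(card_of ((UNIV :: 'a set) \<times> (UNIV :: real set)), card_of (UNIV :: 'a set)) \<in> ordIso"
    using card_of_Times_infinite[OF inf, of "UNIV :: real set"] by simp
  then have "(card_of ((UNIV :: 'a set) \<times> (UNIV :: real set)), card_of (UNIV :: 'a set)) \<in> ordLeq"
    by (rule ordIso_imp_ordLeq)
  then show ?thesis
    using card_of_ordLeq[of "(UNIV :: 'a set) \<times> (UNIV :: real set)" "UNIV :: 'a set"] by auto
qed

lemma return_functor_essentially_surjective:
  fixes A :: "'a map_obj"
  assumes large: "(UNIV :: real set) \<lesssim> (UNIV :: 'a set)" and A: "A \<in> map_objects"
  shows "\<exists>B\<in>flow_objects. \<exists>e. is_iso Map A (omap return_functor B) e"
proof -
  obtain f X where A_eq [simp]: "A = (f, X)" by (cases A)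
  have fX: "homeomorphic_map X X f" "\<And>x. x \<in> topspace X \<Longrightarrow> f x \<in> topspace X"
    using A map_objectsD[of f X] by auto
  obtain n where man: "topological_manifold n X" using A by (auto simp: map_objects_def)
  obtain j :: "'a \<times> real \<Rightarrow> 'a" where "inj j" using inj_prod_real[OF large] by blast
  then interpret suspension f X n j using fX man by unfold_locales
  let ?B = "(\<Phi>, M, S)" and ?P = "restrict (poincare_map \<Phi> S) S" and ?Y = "subtopology M S"
  define e where "e = restrict (\<lambda>x. q (x, 0)) (topspace X)"
  have e: "homeomorphic_map X ?Y e"
    by (rule homeomorphic_map_eq[OF section_homeomorphic]) (simp add: e_def)
  have eS: "e ` topspace X = S" by (simp add: e_def S_def)
  have eP: "e (f x) = ?P (e x)" if "x \<in> topspace X" for x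
    using that fX(2) suspension_poincare by (auto simp: e_def S_def)
  obtain g0 where g0: "homeomorphic_maps X ?Y e g0" using e homeomorphic_map_maps by blast
  define g where "g = restrict g0 S"
  have g: "homeomorphic_maps X ?Y e g"
    by (rule homeomorphic_maps_eq[OF g0]) (simp_all add: g_def topspace_S)
  then have ge: "\<And>x. x \<in> topspace X \<Longrightarrow> g (e x) = x" and eg: "\<And>z. z \<in> S \<Longrightarrow> e (g z) = z"
    and cont: "continuous_map X ?Y e" "continuous_map ?Y X g"
    unfolding homeomorphic_maps_def topspace_S by blast+
  have gX: "\<And>z. z \<in> S \<Longrightarrow> g z \<in> topspace X"
    using continuous_map_funspace[OF cont(2)] unfolding topspace_S by blast
  have e_hom: "e \<in> map_hom (f, X) (?P, ?Y)"
    using cont(1) eP by (simp add: map_hom_def e_def)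
  have "g (?P z) = f (g z)" if z: "z \<in> S" for z
    using eP[OF gX[OF z]] eg[OF z] ge[of "f (g z)"] gX[OF z] fX(2) by simp
  then have g_hom: "g \<in> map_hom (?P, ?Y) (f, X)"
    using cont(2) unfolding map_hom_def prod.case topspace_S by (simp add: g_def)
  have "is_iso Map A (omap return_functor ?B) e"
    unfolding is_iso_def Map_simps
  proof (intro conjI bexI[of _ g])
    show "Comp Map A (omap return_functor ?B) A g e = Ident Map A"
      using ge by (auto simp: fun_eq_iff)
    show "Comp Map (omap return_functor ?B) A (omap return_functor ?B) e g = Ident Map (omap return_functor ?B)"
      using eg topspace_S by (auto simp: fun_eq_iff)
  qed (use e_hom g_hom in simp_all)
  then show ?thesis using flow_object by blast
qed

theorem corollary4p15:
  assumes "(UNIV :: real set) \<lesssim> (UNIV :: 'a set)"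
  shows "equivalent_categories (Map :: ('a map_obj, 'a \<Rightarrow> 'a) cat)
           (RWFlowGS :: ('a flow_obj, 'a flow_mor) cat)"
proof (rule equivalent_categories_if_fully_faithful_ess_surj)
  show "is_category Map" by (rule Map_category)
  show "is_category RWFlowGS" by (rule RWFlowGS_category)
  show "is_functor RWFlowGS Map return_functor" by (rule return_functor)
  show "m = m'" if "A \<in> Obj RWFlowGS" "B \<in> Obj RWFlowGS" "m \<in> Hom RWFlowGS A B" "m' \<in> Hom RWFlowGS A B"
    "amap return_functor A B m = amap return_functor A B m'" for A B and m m' :: "'a flow_mor"
    using return_functor_faithful that by simp
  show "\<exists>m\<in>Hom RWFlowGS A B. amap return_functor A B m = k"
    if "A \<in> Obj RWFlowGS" "B \<in> Obj RWFlowGS" "k \<in> Hom Map (omap return_functor A) (omap return_functor B)"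
    for A B and k :: "'a \<Rightarrow> 'a"
    using return_functor_full that by simp
  show "\<exists>B\<in>Obj RWFlowGS. \<exists>e. is_iso Map A (omap return_functor B) e" if "A \<in> Obj Map" for A :: "'a map_obj"
    using return_functor_essentially_surjective[OF assms] that by simp
qed

end
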